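(* Let $k\ge 2$, $m\ge 1$, $\Delta\ge 3$ and $n\ge 2$ be integers, and let $T$ be a $k$-uniform hypertree in $\mathbb{T}_k(m,\Delta,n)$ whose distance spectral radius is maximum among all hypertrees in $\mathbb{T}_k(m,\Delta,n)$. Then $T\cong C_k(m^*,\Delta,\lfloor n/2\rfloor,\lceil n/2\rceil)$, where $m^*=m-n(\Delta-2)$.
   Context: A hypergraph $G$ is $k$-uniform if every edge is a $k$-element subset of $V(G)$. The degree $d_G(v)$ of a vertex is the number of edges containing it. A path from $u$ to $v$ is a sequence $(v_0,e_1,v_1,\dots,e_p,v_p)$ with $v_0=u$, $v_p=v$, $v_{i-1},v_i\in e_i$, $v_{i-1}\ne v_i$, all $v_i$ and all $e_i$ distinct; its length is $p$. A cycle is such a sequence with at least two distinct edges, all $v_i,e_i$ distinct except $v_0=v_p$. A hypergraph is connected if any two vertices are joined by a path; a hypertree is a connected hypergraph with no cycles. The distance $d_G(u,v)$ is the length of a shortest path from $u$ to $v$ ($d_G(u,u)=0$); the distance matrix is $D(G)=(d_G(u,v))_{u,v\in V(G)}$, and the distance spectral radius $\rho(G)$ of a connected hypergraph $G$ is the largest eigenvalue of $D(G)$. A $k$-uniform loose path $P^k_m$ with $m$ edges is a $k$-uniform hypertree whose vertices and edges can be labeled $(u_0,e_1,u_1,\dots,u_{m-1},e_m,u_m)$ so that $u_1,\dots,u_{m-1}$ have degree $2$ and all other vertices have degree $1$. A $k$-uniform hyperstar $S^k_l$ is a $k$-uniform hypertree with $l$ edges all sharing a common vertex (its center); attaching $S^k_l$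 at a vertex $v$ means taking a vertex-disjoint copy and identifying its center with $v$ ($S^k_0$ is a single vertex). For integers $\Delta\ge 3$ and $a,b\ge 0$ with $a+b<m$, $C_k(m,\Delta,a,b)$ is the $k$-uniform hypertree obtained from $P^k_m=(u_0,e_1,u_1,\dots,e_m,u_m)$ by attaching a copy of $S^k_{\Delta-2}$ at $u_i$ for every $i$ with $1\le i\le a$ or $m-b\le i\le m-1$. $\mathbb{T}_k(m,\Delta,n)$ denotes the set of $k$-uniform hypertrees with $m$ edges, maximum degree $\Delta$, and exactly $n$ vertices of degree $\Delta$. *)

theory Defs
  imports Complex_Main
begin

definition hypergraph :: "'a set \<Rightarrow> 'a set set \<Rightarrow> bool" where
  "hypergraph V E \<longleftrightarrow> finite V \<and> (\<forall>e\<in>E. e \<subseteq> V)"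

definition uniform :: "nat \<Rightarrow> 'a set \<Rightarrow> 'a set set \<Rightarrow> bool" where
  "uniform k V E \<longleftrightarrow> hypergraph V E \<and> (\<forall>e\<in>E. card e = k)"

definition deg :: "'a set set \<Rightarrow> 'a \<Rightarrow> nat" where
  "deg E v = card {e\<in>E. v \<in> e}"

definition is_path :: "'a set set \<Rightarrow> 'a \<Rightarrow> 'a \<Rightarrow> 'a list \<Rightarrow> 'a set list \<Rightarrow> bool" where
  "is_path E u v vs es \<longleftrightarrow>
     length vs = Suc (length es) \<and> hd vs = u \<and> last vs = v \<and>
     distinct vs \<and> distinct es \<and> set es \<subseteq> E \<and>
     (\<forall>i<length es. vs ! i \<in> es ! i \<and> vs ! Suc i \<in> es ! i \<and> vs ! i \<noteq> vs ! Suc i)"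

definition is_cycle :: "'a set set \<Rightarrow> 'a list \<Rightarrow> 'a set list \<Rightarrow> bool" where
  "is_cycle E vs es \<longleftrightarrow>
     length vs = Suc (length es) \<and> length es \<ge> 2 \<and> hd vs = last vs \<and>
     distinct (tl vs) \<and> distinct es \<and> set es \<subseteq> E \<and>
     (\<forall>i<length es. vs ! i \<in> es ! i \<and> vs ! Suc i \<in> es ! i \<and> vs ! i \<noteq> vs ! Suc i)"

definition connected_hg :: "'a set \<Rightarrow> 'a set set \<Rightarrow> bool" where
  "connected_hg V E \<longleftrightarrow> (\<forall>u\<in>V. \<forall>v\<in>V. \<exists>vs es. is_path E u v vs es)"

definition hypertree :: "'a set \<Rightarrow> 'a set set \<Rightarrow> bool" where
  "hypertree V E \<longleftrightarrow> hypergraph V E \<and> connected_hg V E \<and> \<not> (\<exists>vs es. is_cycle E vs es)"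

definition hdist :: "'a set set \<Rightarrow> 'a \<Rightarrow> 'a \<Rightarrow> nat" where
  "hdist E u v = (LEAST p. \<exists>vs es. is_path E u v vs es \<and> length es = p)"

definition dist_eigenvalue :: "'a set \<Rightarrow> 'a set set \<Rightarrow> real \<Rightarrow> bool" where
  "dist_eigenvalue V E r \<longleftrightarrow>
     (\<exists>x :: 'a \<Rightarrow> real. (\<exists>v\<in>V. x v \<noteq> 0) \<and>
        (\<forall>u\<in>V. (\<Sum>w\<in>V. real (hdist E u w) * x w) = r * x u))"

definition dist_spectral_radius :: "'a set \<Rightarrow> 'a set set \<Rightarrow> real" where
  "dist_spectral_radius V E = Max {r. dist_eigenvalue V E r}"

definition in_TT :: "nat \<Rightarrow> nat \<Rightarrow> nat \<Rightarrow> nat \<Rightarrow> 'a set \<Rightarrow> 'a set set \<Rightarrow> bool" where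
  "in_TT k m \<Delta> n V E \<longleftrightarrow>
     uniform k V E \<and> hypertree V E \<and> card E = m \<and>
     Max (deg E ` V) = \<Delta> \<and> card {v\<in>V. deg E v = \<Delta>} = n"

definition hg_iso :: "'a set \<Rightarrow> 'a set set \<Rightarrow> 'b set \<Rightarrow> 'b set set \<Rightarrow> bool" where
  "hg_iso V E V' E' \<longleftrightarrow> (\<exists>f. bij_betw f V V' \<and> (\<lambda>e. f ` e) ` E = E')"

text \<open>Concrete model of C_k(m, Delta, a, b). Vertices are triples:
  u_i = (0,i,0) for 0 \<le> i \<le> m;
  (1,i,j), 1 \<le> j \<le> k-2, are the remaining vertices of path edge e_i (1 \<le> i \<le> m);
  (t+1,i,j), 1 \<le> t \<le> Delta-2, 1 \<le> j \<le> k-1, are the non-center vertices of the t-th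
  edge of the hyperstar S^k_{Delta-2} attached at u_i, for i in the attachment set.\<close>

definition C_attach :: "nat \<Rightarrow> nat \<Rightarrow> nat \<Rightarrow> nat set" where
  "C_attach m a b = {i. (1 \<le> i \<and> i \<le> a) \<or> (m - b \<le> i \<and> i \<le> m - 1)}"

definition C_E :: "nat \<Rightarrow> nat \<Rightarrow> nat \<Rightarrow> nat \<Rightarrow> nat \<Rightarrow> (nat \<times> nat \<times> nat) set set" where
  "C_E k m \<Delta> a b =
     {{(0, i - 1, 0), (0, i, 0)} \<union> {(1, i, j) | j. 1 \<le> j \<and> j \<le> k - 2} | i. 1 \<le> i \<and> i \<le> m}
   \<union> {insert (0, i, 0) {(t + 1, i, j) | j. 1 \<le> j \<and> j \<le> k - 1}
       | i t. i \<in> C_attach m a b \<and> 1 \<le> t \<and> t \<le> \<Delta> - 2}"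

definition C_V :: "nat \<Rightarrow> nat \<Rightarrow> nat \<Rightarrow> nat \<Rightarrow> nat \<Rightarrow> (nat \<times> nat \<times> nat) set" where
  "C_V k m \<Delta> a b = {(0, i, 0) | i. i \<le> m} \<union> \<Union> (C_E k m \<Delta> a b)"

end

(*
  An edge of a hypertree separates its vertices from each other, so d(u,v) counts the edges
  separating u and v, and for a weight x the form x^T D x splits edge by edge. If x is the Perron
  vector of an extremal T, no rearrangement T' of T inside the class may satisfy
  x^T D' x > x^T D x. All rearrangements exchange some edges at a vertex a with some edges at a
  vertex b, where the exchanged edges do not separate a and b. If P and Q are the parts hanging at a
  and b on these edges and C is the rest, the form grows by
    2 (x(P) - x(Q)) * sum_{c in C} (d(b,c) - d(a,c)) x_c.
  Transmission is strictly convex along paths, so a branch wants to move outwards; hence all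
  degrees are 1, 2 or Delta, and no vertex of degree Delta lies between two vertices of degree 2.
  Exchanges starting from the lightest of three branches show that an edge has at most two
  non-leaf vertices and a vertex at most two non-pendant edges. So T is a loose path with stars at
  a vertices at one end and at b vertices at the other. If a >= b + 2, move one star to the shorter
  end: the Perron vectors x, x' of both trees satisfy
    (rho' - rho) <x,x'> = x'(P) rho (x_q - x_p) + x(P) rho' (x'_q - x'_p),
  and both differences are positive because the Perron vector is convex along the spine and larger
  on the side with fewer stars.
*)
theory Submission
  imports Defs "HOL-Combinatorics.Transposition" "HOL-Analysis.Function_Topology"
begin

section \<open>Walks, paths and separation\<close>

text \<open>Reachability replaces lists of vertices and edges: once "deleting an edge separates its
  vertices" is the tree axiom, lying on the same side of an edge is an equivalence relation, and
  distances are counts of edges. Lists occur only where the given definitions are matched. The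
  prescribed number of vertices of degree \<Delta> shapes the exchanges: each must keep all degrees,
  or interchange the degrees of two vertices, or touch only degrees below \<Delta>. Sometimes a
  vertex has to travel together with everything hanging at it; this is an exchange of edges, tested
  with the Perron vector whose entries at \<open>a\<close> and \<open>b\<close> are swapped. Testing
  with the Perron vector of the extremal hypertree alone does not settle the balancing step: the
  moved part is excluded from the sum over the rest, and this leaves a negative correction. The
  Perron vector of the new hypertree has the opposite correction, so the form is evaluated on the
  pair of both.\<close>

inductive reach :: "'a set set \<Rightarrow> 'a \<Rightarrow> 'a \<Rightarrow> bool" for F where
  reach_refl [simp, intro]: "reach F u u"
| reach_step: "reach F u v \<Longrightarrow> e \<in> F \<Longrightarrow> v \<in> e \<Longrightarrow> w \<in> e \<Longrightarrow> reach F u w"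

lemma reach_edge: "e \<in> F \<Longrightarrow> v \<in> e \<Longrightarrow> w \<in> e \<Longrightarrow> reach F v w"
  by (meson reach.intros)

lemma reach_trans:
  assumes "reach F u v" "reach F v w"
  shows "reach F u w"
  using assms(2,1) by (induction) (auto intro: reach.intros)

lemma reach_sym: "reach F u v \<Longrightarrow> reach F v u"
  by (induction rule: reach.induct) (auto intro: reach_trans reach_edge)

lemma reach_mono: "reach F u v \<Longrightarrow> F \<subseteq> G \<Longrightarrow> reach G u v"
  by (induction rule: reach.induct) (auto intro: reach.intros)

text \<open>Cut the walk just before it first uses \<open>e\<close>: there it stands on a vertex of
  \<open>e\<close>.\<close>

lemma reach_avoid:
  "reach F u v \<Longrightarrow> reach (F - {e}) u v \<or> (\<exists>a\<in>e. reach (F - {e}) u a)"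
proof (induction rule: reach.induct)
  case step: (reach_step u v e' w)
  then show ?case by (cases "e' = e") (auto intro: reach_step)
qed auto

text \<open>Invariants refute reachability; this is how colour functions certify that an edge
  separates its vertices.\<close>

lemma reach_const:
  assumes "reach F u v" "\<And>e a b. e \<in> F \<Longrightarrow> a \<in> e \<Longrightarrow> b \<in> e \<Longrightarrow> f a = f b"
  shows "f u = f v"
  using assms by (induction) metis+

text \<open>Induction along the walk, keeping vertices and edges distinct. If the new vertex already
  occurs, the path is truncated there; if the new edge \<open>e\<close> already occurs, the path is
  cut where it enters \<open>e\<close>, and \<open>e\<close> leads directly to the new
  vertex.\<close>

lemma reach_imp_path:
  assumes "reach F u v"
  shows "\<exists>vs es. is_path F u v vs es"
  using assms
proof (induction rule: reach.induct)
  case (reach_refl u)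
  have "is_path F u u [u] []" by (simp add: is_path_def)
  then show ?case by blast
next
  case step: (reach_step u y e z)
  then obtain vs es where p: "is_path F u y vs es" by blast
  note P = p[unfolded is_path_def]
  have len: "length vs = Suc (length es)" using P by simp
  have trunc: "is_path F u (vs ! i) (take (Suc i) vs) (take i es)" if "i \<le> length es" for i
  proof -
    have "last (take (Suc i) vs) = vs ! i"
      using that len by (simp add: take_Suc_conv_app_nth)
    moreover have "hd (take (Suc i) vs) = u" using P by (simp add: hd_take)
    ultimately show ?thesis
      using that P set_take_subset[of i es] unfolding is_path_def by auto
  qed
  show ?case
  proof (cases "z \<in> set vs")
    case True
    then obtain i where "i < length vs" "vs ! i = z" by (meson in_set_conv_nth)
    then show ?thesis using trunc[of i] len by (metis less_Suc_eq_le)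
  next
    case z: False
    have app: "is_path F u z (ws @ [z]) (fs @ [e])"
      if w: "is_path F u a ws fs" "a \<in> e" "e \<notin> set fs" "set ws \<subseteq> set vs" for a ws fs
    proof -
      note W = w(1)[unfolded is_path_def]
      have wn: "ws \<noteq> []" using W by auto
      have lst: "ws ! length fs = a" using W wn by (metis diff_Suc_1 last_conv_nth)
      have "a \<noteq> z" using w(4) z W wn by (metis last_in_set subsetD)
      show ?thesis
        unfolding is_path_def
      proof (intro conjI allI impI)
        fix i assume "i < length (fs @ [e])"
        then consider "i < length fs" | "i = length fs" by fastforce
        then have "(ws @ [z]) ! i \<in> (fs @ [e]) ! i \<and> (ws @ [z]) ! Suc i \<in> (fs @ [e]) ! i
          \<and> (ws @ [z]) ! i \<noteq> (ws @ [z]) ! Suc i"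
          using W w(2) step.hyps lst \<open>a \<noteq> z\<close> by cases (simp_all add: nth_append)
        then show "(ws @ [z]) ! i \<in> (fs @ [e]) ! i" "(ws @ [z]) ! Suc i \<in> (fs @ [e]) ! i"
          "(ws @ [z]) ! i \<noteq> (ws @ [z]) ! Suc i" by blast+
      next
        show "distinct (ws @ [z])" "distinct (fs @ [e])" using W w z by auto
        show "hd (ws @ [z]) = u" using W wn by simp
      qed (use W step.hyps in auto)
    qed
    show ?thesis
    proof (cases "e \<in> set es")
      case False
      have "is_path F u z (vs @ [z]) (es @ [e])" using app[OF p] step.hyps False by auto
      then show ?thesis by blast
    next
      case True
      then obtain i where i: "i < length es" "es ! i = e" by (meson in_set_conv_nth)
      have "is_path F u (vs ! i) (take (Suc i) vs) (take i es)" using trunc i by simp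
      moreover have "vs ! i \<in> e" using P i by auto
      moreover have "e \<notin> set (take i es)"
        using P i by (auto simp: in_set_conv_nth nth_eq_iff_index_eq)
      moreover have "set (take (Suc i) vs) \<subseteq> set vs" by (rule set_take_subset)
      ultimately show ?thesis using app by blast
    qed
  qed
qed

lemma is_path_reach:
  assumes "is_path E u v vs es" "i \<le> j" "j \<le> length es"
    and "\<And>l. i \<le> l \<Longrightarrow> l < j \<Longrightarrow> es ! l \<in> F"
  shows "reach F (vs ! i) (vs ! j)"
  using assms(2-4)
proof (induction j rule: dec_induct)
  case (step j)
  then have "reach F (vs ! i) (vs ! j)" by simp
  moreover have "vs ! j \<in> es ! j" "vs ! Suc j \<in> es ! j"
    using assms(1) step.prems by (auto simp: is_path_def)
  ultimately show ?case using step by (meson reach_step lessI)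
qed auto

lemma is_path_nth:
  assumes "is_path E u v vs es"
  shows "vs ! 0 = u" "vs ! length es = v"
proof -
  have "vs \<noteq> []" using assms by (auto simp: is_path_def)
  then show "vs ! 0 = u" "vs ! length es = v"
    using assms by (auto simp: is_path_def hd_conv_nth last_conv_nth)
qed

lemma path_imp_reach:
  assumes "is_path E u v vs es"
  shows "reach E u v"
  using is_path_reach[OF assms, of 0 "length es" E] is_path_nth[OF assms] assms
  by (auto simp: is_path_def in_set_conv_nth subset_iff)

text \<open>The combinatorial substitute for \<open>hdist\<close>: in a hypertree every path from
  \<open>u\<close> to \<open>v\<close> uses exactly these edges, so on vertices both agree.\<close>

definition sepd :: "'a set set \<Rightarrow> 'a \<Rightarrow> 'a \<Rightarrow> nat" where
  "sepd E u v = card {e\<in>E. \<not> reach (E - {e}) u v}"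

text \<open>Acyclicity is encoded as \<open>edge_sep\<close>. For k at least 2 the locale is
  equivalent to \<open>uniform\<close> together with \<open>hypertree\<close>, by
  \<open>hypertree_htree\<close> and \<open>hypertree_of\<close>.\<close>

locale htree =
  fixes V :: "'a set" and E :: "'a set set" and k :: nat
  assumes finV: "finite V"
    and edge_sub: "e \<in> E \<Longrightarrow> e \<subseteq> V"
    and edge_card: "e \<in> E \<Longrightarrow> card e = k"
    and k2: "2 \<le> k"
    and conn: "u \<in> V \<Longrightarrow> v \<in> V \<Longrightarrow> reach E u v"
    and edge_sep: "e \<in> E \<Longrightarrow> u \<in> e \<Longrightarrow> v \<in> e \<Longrightarrow> u \<noteq> v \<Longrightarrow> \<not> reach (E - {e}) u v"

text \<open>Without its edge \<open>e\<close>, the path still joins \<open>u\<close> to one vertex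
  of \<open>e\<close> and another vertex of \<open>e\<close> to \<open>v\<close>; if
  \<open>u\<close> and \<open>v\<close> were joined avoiding \<open>e\<close>, so would be these two
  vertices. Hence all paths between two vertices have the same length.\<close>

lemma (in htree) path_edges:
  assumes p: "is_path E u v vs es"
  shows "set es = {e\<in>E. \<not> reach (E - {e}) u v}"
proof (intro set_eqI iffI)
  fix e assume "e \<in> set es"
  then obtain i where i: "i < length es" "es ! i = e" by (meson in_set_conv_nth)
  have eE: "e \<in> E" using p \<open>e \<in> set es\<close> by (auto simp: is_path_def)
  have other: "es ! l \<in> E - {e}" if "l < length es" "l \<noteq> i" for l
    using that p i by (auto simp: is_path_def nth_eq_iff_index_eq subset_iff)
  have "reach (E - {e}) (vs ! 0) (vs ! i)"
    by (rule is_path_reach[OF p]) (use i other in auto)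
  moreover have "reach (E - {e}) (vs ! Suc i) (vs ! length es)"
    by (rule is_path_reach[OF p]) (use i other in auto)
  moreover have "\<not> reach (E - {e}) (vs ! i) (vs ! Suc i)"
    using edge_sep[OF eE] p i by (auto simp: is_path_def)
  ultimately show "e \<in> {e\<in>E. \<not> reach (E - {e}) u v}"
    using is_path_nth[OF p] eE by simp (meson reach_trans reach_sym)
next
  fix e assume e: "e \<in> {e\<in>E. \<not> reach (E - {e}) u v}"
  show "e \<in> set es"
  proof (rule ccontr)
    assume "e \<notin> set es"
    then have "is_path (E - {e}) u v vs es" using p by (auto simp: is_path_def)
    then have "reach (E - {e}) u v" by (rule path_imp_reach)
    then show False using e by simp
  qed
qed

lemma (in htree) path_length:
  assumes "is_path E u v vs es"
  shows "length es = sepd E u v"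
proof -
  have "length es = card (set es)" using assms by (simp add: is_path_def distinct_card)
  then show ?thesis by (simp add: path_edges[OF assms] sepd_def)
qed

lemma (in htree) hdist_eq:
  assumes "u \<in> V" "v \<in> V"
  shows "hdist E u v = sepd E u v"
proof -
  obtain vs es where "is_path E u v vs es" using reach_imp_path[OF conn[OF assms]] by auto
  then show ?thesis
    unfolding hdist_def by (intro Least_equality) (auto dest: path_length)
qed

text \<open>A path between two vertices of \<open>e\<close> that avoids \<open>e\<close> is closed
  to a cycle by \<open>e\<close> itself.\<close>

lemma hypertree_htree:
  assumes "uniform k V E" "hypertree V E" "2 \<le> k"
  shows "htree V E k"
proof
  show "finite V" "2 \<le> k" using assms by (auto simp: uniform_def hypergraph_def)
  show "e \<subseteq> V" "card e = k" if "e \<in> E" for e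
    using that assms by (auto simp: uniform_def hypergraph_def)
  show "reach E u v" if "u \<in> V" "v \<in> V" for u v
  proof -
    have "\<exists>vs es. is_path E u v vs es"
      using that assms(2) by (simp add: hypertree_def connected_hg_def)
    then show ?thesis using path_imp_reach by fastforce
  qed
  show "\<not> reach (E - {e}) u v" if e: "e \<in> E" "u \<in> e" "v \<in> e" "u \<noteq> v" for e u v
  proof
    assume "reach (E - {e}) u v"
    then obtain vs es where p: "is_path (E - {e}) u v vs es" by (meson reach_imp_path)
    note P = p[unfolded is_path_def]
    have vs: "vs = u # tl vs" "vs \<noteq> []" using P by (cases vs; auto)+
    have "es \<noteq> []" using is_path_nth[OF p] e by auto
    have lst: "vs ! length es = v" by (rule is_path_nth[OF p])
    have "distinct (u # tl vs)" using P vs by metis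
    have "is_cycle E (vs @ [u]) (es @ [e])"
      unfolding is_cycle_def
    proof (intro conjI allI impI)
      show "length (es @ [e]) \<ge> 2" using \<open>es \<noteq> []\<close> by (cases es) auto
      have "tl (vs @ [u]) = tl vs @ [u]" using vs by simp
      then show "distinct (tl (vs @ [u]))" using \<open>distinct (u # tl vs)\<close> by simp
      show "hd (vs @ [u]) = last (vs @ [u])" using vs P by auto
      fix i assume i: "i < length (es @ [e])"
      show "(vs @ [u]) ! i \<in> (es @ [e]) ! i" "(vs @ [u]) ! Suc i \<in> (es @ [e]) ! i"
        "(vs @ [u]) ! i \<noteq> (vs @ [u]) ! Suc i"
        using i P e lst by (auto simp: nth_append less_Suc_eq)
    qed (use P e in auto)
    then show False using assms unfolding hypertree_def by blast
  qed
qed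

text \<open>A cycle leads from \<open>vs ! 1\<close> back to \<open>vs ! 0\<close> along all its
  edges but \<open>es ! 0\<close>, which \<open>edge_sep\<close> forbids.\<close>

lemma (in htree) hypertree_of: "uniform k V E" "hypertree V E"
proof -
  show "uniform k V E" using finV edge_sub edge_card by (auto simp: uniform_def hypergraph_def)
  have "False" if c: "is_cycle E vs es" for vs es
  proof -
    note C = c[unfolded is_cycle_def]
    have len: "length vs = Suc (length es)" "length es \<ge> 2" using C by auto
    have step: "reach (E - {es ! 0}) (vs ! 1) (vs ! Suc j)" if "j < length es" for j
      using that
    proof (induction j)
      case (Suc j)
      have "es ! Suc j \<in> E - {es ! 0}"
        using C Suc.prems nth_eq_iff_index_eq[of es "Suc j" 0] by (auto simp: subset_iff simp del: length_greater_0_conv)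
      moreover have "vs ! Suc j \<in> es ! Suc j" "vs ! Suc (Suc j) \<in> es ! Suc j" using C Suc.prems by auto
      ultimately show ?case using Suc by (meson Suc_lessD reach_step)
    qed auto
    have "vs \<noteq> []" using len by auto
    have "vs ! length es = vs ! 0"
      using C len \<open>vs \<noteq> []\<close> by (metis diff_Suc_1 hd_conv_nth last_conv_nth)
    moreover have "Suc (length es - 1) = length es" "length es - 1 < length es" using len by auto
    ultimately have "reach (E - {es ! 0}) (vs ! 1) (vs ! 0)"
      using step[of "length es - 1"] by simp
    moreover have "vs ! 0 \<in> es ! 0" "vs ! Suc 0 \<in> es ! 0" "vs ! 0 \<noteq> vs ! Suc 0" "es ! 0 \<in> E"
      using C len by (auto simp: subset_iff dest: spec[of _ 0]) (metis C len(2) length_0_conv length_greater_0_conv not_numeral_le_zero nth_mem)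
    ultimately show False using edge_sep by (metis One_nat_def reach_sym)
  qed
  then show "hypertree V E"
    unfolding hypertree_def connected_hg_def hypergraph_def
    using finV edge_sub by (auto intro: reach_imp_path conn)
qed

section \<open>Branches of a hypertree\<close>

context htree
begin

lemma finE: "finite E"
  using finV edge_sub by (meson PowI finite_Pow_iff rev_finite_subset subsetI)

lemma fin_edge: "e \<in> E \<Longrightarrow> finite e"
  using finV edge_sub finite_subset by blast

lemma edge_other: assumes "e \<in> E" obtains v where "v \<in> e" "v \<noteq> u"
proof -
  have "\<not> e \<subseteq> {u}"
    using edge_card[OF assms] k2 card_mono[of "{u}" e] by auto
  then show ?thesis using that by auto
qed

text \<open>For an edge \<open>e\<close> the classes of \<open>sim e\<close> on \<open>V\<close> are
  the components left after deleting \<open>e\<close>, the sides of \<open>e\<close>; each contains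
  exactly one vertex of \<open>e\<close>.\<close>

abbreviation sim :: "'a set \<Rightarrow> 'a \<Rightarrow> 'a \<Rightarrow> bool" where
  "sim e \<equiv> reach (E - {e})"

lemma sim_edge: "h \<in> E \<Longrightarrow> h \<noteq> e \<Longrightarrow> u \<in> h \<Longrightarrow> v \<in> h \<Longrightarrow> sim e u v"
  by (rule reach_edge[of h]) auto

lemma proj_ex:
  assumes "e \<in> E" "u \<in> V"
  shows "\<exists>v\<in>e. sim e v u"
proof -
  obtain c where c: "c \<in> e" using edge_other[OF assms(1)] by blast
  then have "reach E c u" using conn assms edge_sub by blast
  then show ?thesis using c
  proof (induction rule: reach.induct)
    case step: (reach_step u y h z)
    then obtain v where "v \<in> e" "sim e v y" by blast
    then show ?case
      using step.hyps by (cases "h = e") (auto intro: reach_step)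
  qed auto
qed

text \<open>The vertex of \<open>e\<close> through which \<open>u\<close> is reached; it names the
  side of \<open>e\<close> on which \<open>u\<close> lies. Determined only for
  \<open>e \<in> E\<close> and \<open>u \<in> V\<close>.\<close>

definition proj :: "'a set \<Rightarrow> 'a \<Rightarrow> 'a" where
  "proj e u = (SOME v. v \<in> e \<and> sim e v u)"

lemma proj:
  assumes "e \<in> E" "u \<in> V"
  shows "proj e u \<in> e" "sim e (proj e u) u"
  using someI_ex[of "\<lambda>v. v \<in> e \<and> sim e v u"] proj_ex[OF assms]
  unfolding proj_def by blast+

lemma proj_unique:
  assumes "e \<in> E" "u \<in> V" "v \<in> e" "sim e v u"
  shows "proj e u = v"
  using proj[OF assms(1,2)] edge_sep assms by (meson reach_sym reach_trans)

lemma proj_self: "e \<in> E \<Longrightarrow> v \<in> e \<Longrightarrow> proj e v = v"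
  using proj_unique edge_sub by blast

lemma proj_eq_iff:
  assumes "e \<in> E" "u \<in> V" "v \<in> V"
  shows "proj e u = proj e v \<longleftrightarrow> sim e u v"
  using proj[OF assms(1,2)] proj[OF assms(1,3)] proj_unique assms
  by (metis reach_sym reach_trans)

lemma proj_const: "e \<in> E \<Longrightarrow> h \<in> E \<Longrightarrow> h \<noteq> e \<Longrightarrow> u \<in> h \<Longrightarrow> v \<in> h \<Longrightarrow> proj e u = proj e v"
  using proj_eq_iff[of e u v] sim_edge[of h e u v] edge_sub[of h] by auto

text \<open>If \<open>u\<close> and \<open>v\<close> both reached \<open>e\<close> without using
  \<open>h\<close>, then \<open>e\<close> would join them and \<open>h\<close> would not separate
  them. So one of them reaches \<open>h\<close> without using \<open>e\<close>, and as
  \<open>h\<close> differs from \<open>e\<close>, all of \<open>h\<close> lies on its side.\<close>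

lemma laminar:
  assumes "e \<in> E" "h \<in> E" "e \<noteq> h" "u \<in> V" "v \<in> V" "\<not> sim h u v" "r \<in> h"
  shows "sim e r u \<or> sim e r v"
proof -
  have side: "sim e r x \<or> (\<exists>a\<in>e. reach (E - {h} - {e}) x a)" if x: "x \<in> V" for x
  proof -
    obtain r1 where r1: "r1 \<in> h" "sim h r1 x" using proj_ex[OF assms(2) x] by auto
    from this(2) have "reach (E - {h} - {e}) x r1 \<or> (\<exists>a\<in>e. reach (E - {h} - {e}) x a)"
      by (rule reach_avoid[OF reach_sym])
    moreover have "sim e r x" if "reach (E - {h} - {e}) x r1"
    proof -
      have "sim e x r1" by (rule reach_mono[OF that]) auto
      moreover have "sim e r r1" using sim_edge assms r1 by metis
      ultimately show ?thesis by (meson reach_sym reach_trans)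
    qed
    ultimately show ?thesis by blast
  qed
  have False if "a \<in> e" "reach (E - {h} - {e}) u a" "b \<in> e" "reach (E - {h} - {e}) v b" for a b
  proof -
    have "sim h u a" "sim h v b"
      using reach_mono[OF that(2), of "E - {h}"] reach_mono[OF that(4), of "E - {h}"] by auto
    moreover have "sim h a b" using sim_edge assms that by blast
    ultimately show False using assms(6) by (meson reach_sym reach_trans)
  qed
  then show ?thesis using side assms by blast
qed

text \<open>Let \<open>v\<close> be the vertex of \<open>e2\<close> on the side of \<open>u\<close>.
  If \<open>e1\<close> also separated \<open>w\<close> from \<open>u\<close>, it would separate
  \<open>v\<close> from \<open>u\<close>, and by laminarity \<open>w\<close>, a vertex of
  \<open>e1\<close>, would lie on the side of \<open>e2\<close> containing \<open>u\<close>.\<close>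

lemma branch_disj:
  assumes "e1 \<in> E" "e2 \<in> E" "e1 \<noteq> e2" "w \<in> e1" "w \<in> e2" "u \<in> V" "\<not> sim e2 w u"
  shows "sim e1 w u"
proof (rule ccontr)
  assume n: "\<not> sim e1 w u"
  let ?v = "proj e2 u"
  have v: "?v \<in> e2" "sim e2 ?v u" using proj assms by blast+
  have "sim e1 w ?v" using sim_edge assms v by blast
  then have "\<not> sim e1 ?v u" using n by (meson reach_trans)
  then have "sim e2 w ?v \<or> sim e2 w u"
    using laminar[of e2 e1 ?v u w] assms v edge_sub by blast
  then show False using assms(7) v by (meson reach_trans)
qed

lemma first_edge:
  assumes "v \<in> V" "u \<in> V" "u \<noteq> v"
  obtains e where "e \<in> E" "v \<in> e" "\<not> sim e v u"
proof -
  obtain vs es where p: "is_path E v u vs es" using reach_imp_path[OF conn[OF assms(1,2)]] by auto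
  have "es \<noteq> []" using is_path_nth[OF p] assms by auto
  then have "es ! 0 \<in> set es" "vs ! 0 \<in> es ! 0" using p by (auto simp: is_path_def)
  then show ?thesis using that path_edges[OF p] is_path_nth[OF p] by auto
qed

section \<open>Additivity of the distance\<close>

lemma sepd_self [simp]: "sepd E u u = 0"
  by (simp add: sepd_def)

lemma sepd_sym: "sepd E u v = sepd E v u"
  unfolding sepd_def by (metis reach_sym)

lemma sepd_triangle: "sepd E u w \<le> sepd E u v + sepd E v w"
proof -
  have "sepd E u w \<le> card ({e\<in>E. \<not> sim e u v} \<union> {e\<in>E. \<not> sim e v w})"
    unfolding sepd_def by (rule card_mono) (auto simp: finE, meson reach_trans)
  also have "\<dots> \<le> sepd E u v + sepd E v w" unfolding sepd_def by (rule card_Un_le)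
  finally show ?thesis .
qed

lemma sepd_pos: assumes "u \<in> V" "v \<in> V" "u \<noteq> v" shows "0 < sepd E u v"
proof -
  obtain e where "e \<in> E" "\<not> sim e u v" using first_edge[of u v] assms by auto
  then show ?thesis unfolding sepd_def by (auto simp: card_gt_0_iff finE)
qed

lemma sepd_edge: assumes "e \<in> E" "u \<in> e" "v \<in> e" "u \<noteq> v" shows "sepd E u v = 1"
proof -
  have "{g\<in>E. \<not> sim g u v} = {e}" using assms edge_sep sim_edge by blast
  then show ?thesis by (simp add: sepd_def)
qed

text \<open>No edge \<open>h\<close> separates both \<open>p\<close> from \<open>w\<close> and
  \<open>w\<close> from \<open>c\<close>: by laminarity its vertices would lie on the side of
  \<open>e\<close> containing \<open>p\<close> and also on the one containing
  \<open>w\<close>.\<close>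

lemma sepd_add:
  assumes "e \<in> E" "w \<in> e" "p \<in> V" "c \<in> V" "\<not> sim e w p" "sim e w c"
  shows "sepd E p c = sepd E p w + sepd E w c"
proof -
  have dis: False if h: "h \<in> E" "\<not> sim h p w" "\<not> sim h w c" for h
  proof -
    have "h \<noteq> e" using assms h by blast
    let ?v = "proj e p"
    have v: "?v \<in> e" "sim e ?v p" using proj assms by blast+
    have vw: "\<not> sim e ?v w" using v assms by (meson reach_trans reach_sym)
    have "sim h w ?v" using sim_edge assms v \<open>h \<noteq> e\<close> by metis
    then have nv: "\<not> sim h ?v p" using h by (meson reach_sym reach_trans)
    obtain r where r: "r \<in> h" using edge_other[OF h(1)] by blast
    have V: "?v \<in> V" "w \<in> V" using v assms edge_sub by blast+
    have "sim e r ?v \<or> sim e r p"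
      using laminar[OF assms(1) h(1) _ V(1) assms(3) nv r] \<open>h \<noteq> e\<close> by simp
    then have "sim e r ?v" using v by (meson reach_trans reach_sym)
    moreover have "sim e r w \<or> sim e r c"
      using laminar[OF assms(1) h(1) _ V(2) assms(4) h(3) r] \<open>h \<noteq> e\<close> by simp
    then have "sim e r w" using assms(6) by (meson reach_trans reach_sym)
    ultimately show False using vw by (meson reach_trans reach_sym)
  qed
  have "{g\<in>E. \<not> sim g p c} = {g\<in>E. \<not> sim g p w} \<union> {g\<in>E. \<not> sim g w c}"
    using dis by (auto intro: reach_trans) (meson reach_sym reach_trans)+
  moreover have "{g\<in>E. \<not> sim g p w} \<inter> {g\<in>E. \<not> sim g w c} = {}" using dis by blast
  ultimately show ?thesis unfolding sepd_def by (simp add: card_Un_disjoint finE)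
qed

lemma sepd_proj:
  assumes "e \<in> E" "u \<in> e" "v \<in> e" "u \<noteq> v" "c \<in> V" "sim e u c"
  shows "sepd E v c = sepd E u c + 1"
  using sepd_add[of e u v c] sepd_edge[of e v u] edge_sep[of e u v] edge_sub assms by auto

end

text \<open>Colour functions certify tree-likeness: \<open>\<phi> g\<close> distinguishes the vertices of \<open>g\<close> but not
  those of any other edge.\<close>

lemma htree_colour:
  fixes \<phi> :: "'a set \<Rightarrow> 'a \<Rightarrow> 'b"
  assumes "finite V" "\<And>e. e \<in> E \<Longrightarrow> e \<subseteq> V \<and> card e = k" "2 \<le> k"
    and "\<And>u v. u \<in> V \<Longrightarrow> v \<in> V \<Longrightarrow> reach E u v"
    and const: "\<And>g h u v. g \<in> E \<Longrightarrow> h \<in> E \<Longrightarrow> g \<noteq> h \<Longrightarrow> u \<in> h \<Longrightarrow> v \<in> h \<Longrightarrow> \<phi> g u = \<phi> g v"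
    and inj: "\<And>g. g \<in> E \<Longrightarrow> inj_on (\<phi> g) g"
  shows "htree V E k"
    and "u \<in> V \<Longrightarrow> v \<in> V \<Longrightarrow> sepd E u v = card {g\<in>E. \<phi> g u \<noteq> \<phi> g v}"
proof -
  have same: "\<phi> g u = \<phi> g v" if "g \<in> E" "reach (E - {g}) u v" for g u v
    by (rule reach_const[OF that(2)]) (use const that in blast)
  show h: "htree V E k"
  proof
    fix e u v assume "e \<in> E" "u \<in> e" "v \<in> e" "u \<noteq> v"
    then show "\<not> reach (E - {e}) u v" using same inj by (metis inj_onD)
  qed (use assms in auto)
  interpret htree V E k by (rule h)
  assume uv: "u \<in> V" "v \<in> V"
  have "sim g u v" if g: "g \<in> E" "\<phi> g u = \<phi> g v" for g
  proof -
    have "\<phi> g (proj g u) = \<phi> g u" "\<phi> g (proj g v) = \<phi> g v" using same proj uv g by blast+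
    then have "proj g u = proj g v" using proj uv g inj by (metis inj_onD)
    then show ?thesis using proj_eq_iff uv g by blast
  qed
  then have "{g\<in>E. \<not> sim g u v} = {g\<in>E. \<phi> g u \<noteq> \<phi> g v}" using same by blast
  then show "sepd E u v = card {g\<in>E. \<phi> g u \<noteq> \<phi> g v}" by (simp add: sepd_def)
qed

section \<open>Exchanging edges between two vertices\<close>

context htree
begin

text \<open>Only edges of \<open>H\<close> that contain \<open>x\<close> count. So a single
  \<open>H\<close> describes both what hangs at \<open>a\<close> and what hangs at \<open>b\<close>,
  and it may be almost all of \<open>E\<close>.\<close>

definition branch :: "'a set set \<Rightarrow> 'a \<Rightarrow> 'a set" where
  "branch H x = {u\<in>V. \<exists>e\<in>H. x \<in> e \<and> \<not> sim e x u}"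

lemma branch_subset: "branch H x \<subseteq> V"
  by (auto simp: branch_def)

lemma branch_edge:
  assumes "H \<subseteq> E" "e \<in> H" "x \<in> e" "u \<in> e" "u \<noteq> x"
  shows "u \<in> branch H x"
proof -
  have "e \<in> E" using assms by blast
  then have "\<not> sim e x u" "u \<in> V" using edge_sep[of e x u] edge_sub[of e] assms by auto
  then show ?thesis using assms by (auto simp: branch_def)
qed

lemma branch_root: "x \<notin> branch H x"
  by (simp add: branch_def)

lemma branch_opposite: "(\<And>e. e \<in> H \<Longrightarrow> sim e x y) \<Longrightarrow> y \<notin> branch H x"
  by (auto simp: branch_def)

lemma branch_closed:
  assumes "H \<subseteq> E" "r \<in> branch H x" "r \<in> h" "h \<in> E" "\<not> (h \<in> H \<and> x \<in> h)"
  shows "h \<subseteq> branch H x"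
proof
  fix u assume u: "u \<in> h"
  obtain e where e: "e \<in> H" "x \<in> e" "\<not> sim e x r" using assms by (auto simp: branch_def)
  then have "h \<noteq> e" using assms by auto
  then have "sim e u r" using sim_edge assms u by metis
  then have "\<not> sim e x u" using e reach_trans by metis
  then show "u \<in> branch H x" using e u edge_sub[OF assms(4)] by (auto simp: branch_def)
qed

text \<open>Let \<open>e\<close> be the edge at \<open>x\<close> leading to \<open>p\<close>. If
  \<open>g\<close> separated \<open>x\<close> from \<open>p\<close>, it would also separate from
  \<open>p\<close> the vertex of \<open>e\<close> on the side of \<open>p\<close>; by laminarity
  \<open>g\<close> would then lie on that side of \<open>e\<close>, inside the branch. So edges
  outside see the branch collapsed to its root.\<close>

lemma branch_sim_root:
  assumes "H \<subseteq> E" "p \<in> branch H x" "g \<in> E" "g \<inter> branch H x = {}"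
  shows "sim g x p"
proof (rule ccontr)
  assume n: "\<not> sim g x p"
  obtain e where e: "e \<in> H" "x \<in> e" "\<not> sim e x p" "p \<in> V" using assms by (auto simp: branch_def)
  then have eE: "e \<in> E" using assms by blast
  have v: "proj e p \<in> e" "sim e (proj e p) p" using proj[OF eE e(4)] by auto
  then have "proj e p \<noteq> x" using e by auto
  then have "proj e p \<in> branch H x" using branch_edge assms e v by metis
  then have ge: "e \<noteq> g" using v assms by auto
  have "sim g x (proj e p)" using sim_edge eE ge e(2) v(1) by metis
  then have nv: "\<not> sim g (proj e p) p" using n reach_trans by metis
  obtain r where r: "r \<in> g" using edge_other[OF assms(3)] by blast
  have "sim e r (proj e p) \<or> sim e r p"
    using laminar[OF eE assms(3) ge _ e(4) nv r] v edge_sub eE by auto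
  then have "sim e r p" using v by (meson reach_trans)
  then have "\<not> sim e x r" using e reach_trans by metis
  then have "r \<in> branch H x" using e r edge_sub[OF assms(3)] by (auto simp: branch_def)
  then show False using r assms by blast
qed

lemma branch_sim_opposite:
  assumes "H \<subseteq> E" "\<And>e. e \<in> H \<Longrightarrow> sim e x y" "x \<in> V" "y \<in> V"
    and "g \<in> E" "r \<in> g" "r \<in> branch H x"
  shows "sim g x y"
proof (rule ccontr)
  assume n: "\<not> sim g x y"
  obtain e where e: "e \<in> H" "x \<in> e" "\<not> sim e x r" using assms by (auto simp: branch_def)
  then have eE: "e \<in> E" using assms by blast
  have ge: "e \<noteq> g" using n assms(2) e by auto
  have "sim e r x \<or> sim e r y" using laminar[OF eE assms(5) ge assms(3,4) n assms(6)] .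
  then have "sim e x r" using assms(2)[OF e(1)] by (meson reach_trans reach_sym)
  then show False using e by simp
qed

text \<open>A common vertex \<open>u\<close> would satisfy d(u,y) = d(u,x) + d(x,y) and d(u,x) =
  d(u,y) + d(y,x), forcing d(x,y) = 0.\<close>

lemma branch_disjoint:
  assumes "H \<subseteq> E" "\<And>e. e \<in> H \<Longrightarrow> sim e x y" "x \<in> V" "y \<in> V" "x \<noteq> y"
  shows "branch H x \<inter> branch H y = {}"
proof (rule ccontr)
  assume "branch H x \<inter> branch H y \<noteq> {}"
  then obtain u e f where u: "u \<in> V" and e: "e \<in> H" "x \<in> e" "\<not> sim e x u"
    and f: "f \<in> H" "y \<in> f" "\<not> sim f y u" by (auto simp: branch_def)
  have "sepd E u y = sepd E u x + sepd E x y"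
    by (rule sepd_add[of e]) (use e u assms in auto)
  moreover have "sepd E u x = sepd E u y + sepd E y x"
    by (rule sepd_add[of f]) (use f u assms in \<open>auto intro: reach_sym\<close>)
  ultimately show False using sepd_pos[of x y] assms by linarith
qed

end

locale exchange = htree V E k for V :: "'a set" and E k +
  fixes a b :: 'a and H :: "'a set set"
  assumes ab: "a \<in> V" "b \<in> V" "a \<noteq> b" and HE: "H \<subseteq> E" and Hab: "e \<in> H \<Longrightarrow> sim e a b"
begin

abbreviation "P \<equiv> branch H a"
abbreviation "Q \<equiv> branch H b"

text \<open>The transposition re-hangs edges of \<open>H\<close> from \<open>a\<close> to
  \<open>b\<close> and from \<open>b\<close> to \<open>a\<close>, fixes those containing neither,
  and keeps cardinalities.\<close>

definition xedge :: "'a set \<Rightarrow> 'a set" where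
  "xedge e = (if e \<in> H then transpose a b ` e else e)"

text \<open>To an edge of the core, a vertex of \<open>P\<close> or \<open>Q\<close> looks like the
  point where its part is attached; after the exchange this is the opposite root.\<close>

definition swp :: "'a \<Rightarrow> 'a" where
  "swp u = (if u \<in> P then b else if u \<in> Q then a else u)"

text \<open>Colours for the exchanged hypertree: edges meeting \<open>P \<union> Q\<close> keep their projections, all other
  edges see \<open>P\<close> and \<open>Q\<close> collapsed to their new points of attachment.\<close>

definition col :: "'a set \<Rightarrow> 'a \<Rightarrow> 'a" where
  "col g u = (if g \<inter> (P \<union> Q) = {} then proj g (swp u) else proj g u)"

lemma Hba: "e \<in> H \<Longrightarrow> sim e b a"
  using Hab reach_sym by metis

lemma notin: "a \<notin> P" "b \<notin> P" "a \<notin> Q" "b \<notin> Q"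
  using branch_root branch_opposite[of H a b] branch_opposite[of H b a] Hab Hba by metis+

lemma disj: "P \<inter> Q = {}"
  using branch_disjoint[OF HE Hab] ab by simp

lemma swp_simps: "u \<in> P \<Longrightarrow> swp u = b" "u \<in> Q \<Longrightarrow> swp u = a" "u \<notin> P \<Longrightarrow> u \<notin> Q \<Longrightarrow> swp u = u"
  "swp a = a" "swp b = b"
  using disj notin by (auto simp: swp_def)

lemma H_not_both: "e \<in> H \<Longrightarrow> a \<in> e \<Longrightarrow> b \<notin> e"
  using edge_sep Hab HE ab by blast

lemma xedge_a: "e \<in> H \<Longrightarrow> a \<in> e \<Longrightarrow> xedge e = insert b (e - {a})"
  using H_not_both[of e] by (auto simp: xedge_def transpose_def image_iff split: if_splits)

lemma xedge_b: "e \<in> H \<Longrightarrow> b \<in> e \<Longrightarrow> xedge e = insert a (e - {b})"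
  using H_not_both[of e] by (auto simp: xedge_def transpose_def image_iff split: if_splits)

lemma xedge_none: "\<not> (e \<in> H \<and> (a \<in> e \<or> b \<in> e)) \<Longrightarrow> xedge e = e"
proof -
  assume n: "\<not> (e \<in> H \<and> (a \<in> e \<or> b \<in> e))"
  have "transpose a b ` e = id ` e" if "a \<notin> e" "b \<notin> e"
    by (rule image_cong) (use that in \<open>auto simp: transpose_def\<close>)
  then show ?thesis using n by (auto simp: xedge_def)
qed

lemma xedge_card: "card (xedge e) = card e"
  by (simp add: xedge_def card_image)

lemma xedge_sub: "e \<in> E \<Longrightarrow> xedge e \<subseteq> V"
  using edge_sub[of e] ab by (auto simp: xedge_def transpose_def)

lemma meets_sim:
  assumes "g \<in> E" "g \<inter> (P \<union> Q) \<noteq> {}"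
  shows "sim g a b"
  using assms branch_sim_opposite[of H a b g] branch_sim_opposite[of H b a g] HE Hab Hba ab
  by (metis Int_emptyI UnE reach_sym)

lemma meets_proj_transpose:
  assumes "g \<in> E" "g \<inter> (P \<union> Q) \<noteq> {}"
  shows "proj g (transpose a b u) = proj g u"
proof -
  have "proj g a = proj g b" using proj_eq_iff meets_sim assms ab by metis
  then show ?thesis by (auto simp: transpose_def)
qed

lemma core_edge:
  assumes "g \<in> E" "g \<inter> (P \<union> Q) = {}"
  shows "xedge g = g" "u \<in> g \<Longrightarrow> swp u = u"
proof -
  have "\<not> (g \<in> H \<and> (a \<in> g \<or> b \<in> g))"
    using branch_edge[OF HE] edge_other[OF assms(1)] assms(2) by (metis Int_iff UnCI emptyE)
  then show "xedge g = g" by (rule xedge_none)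
  show "u \<in> g \<Longrightarrow> swp u = u" using assms by (intro swp_simps) auto
qed

text \<open>Cases \<open>A\<close> and \<open>B\<close> are the re-hung edges, \<open>P\<close> and
  \<open>Q\<close> the edges inside the moved parts, \<open>C\<close> those of the core.\<close>

lemma edge_cases:
  assumes "h \<in> E"
  obtains (A) "h \<in> H" "a \<in> h" "h - {a} \<subseteq> P" | (B) "h \<in> H" "b \<in> h" "h - {b} \<subseteq> Q"
    | (P) "h \<subseteq> P" "xedge h = h" | (Q) "h \<subseteq> Q" "xedge h = h"
    | (C) "h \<inter> (P \<union> Q) = {}" "xedge h = h"
proof -
  consider "h \<in> H" "a \<in> h" | "h \<in> H" "b \<in> h" | "\<not> (h \<in> H \<and> (a \<in> h \<or> b \<in> h))" by blast
  then show ?thesis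
  proof cases
    case 1
    then show ?thesis using that(1) branch_edge[OF HE 1(1) 1(2)] by blast
  next
    case 2
    then show ?thesis using that(2) branch_edge[OF HE 2(1) 2(2)] by blast
  next
    case 3
    then show ?thesis using that(3-5) branch_closed[OF HE _ _ assms, of _ a]
        branch_closed[OF HE _ _ assms, of _ b] xedge_none[OF 3] by blast
  qed
qed

lemma col_const:
  assumes "g \<in> E" "h \<in> E" "g \<noteq> h" "u \<in> xedge h" "v \<in> xedge h"
  shows "col g u = col g v"
proof (cases "g \<inter> (P \<union> Q) = {}")
  case False
  have "\<exists>u0\<in>h. proj g u = proj g u0" "\<exists>v0\<in>h. proj g v = proj g v0"
    using assms(4,5) meets_proj_transpose[OF assms(1) False] by (auto simp: xedge_def split: if_splits)
  moreover have "proj g u0 = proj g v0" if "u0 \<in> h" "v0 \<in> h" for u0 v0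
    using proj_const assms that by metis
  ultimately have "proj g u = proj g v" by metis
  then show ?thesis using False by (simp add: col_def)
next
  case True
  have "proj g (swp u) = proj g (swp v)"
    using assms(2)
  proof (cases rule: edge_cases)
    case A
    then have "swp w = b" if "w \<in> xedge h" for w using that swp_simps xedge_a by auto
    then show ?thesis using assms by simp
  next
    case B
    then have "swp w = a" if "w \<in> xedge h" for w using that swp_simps xedge_b by auto
    then show ?thesis using assms by simp
  next
    case P
    then show ?thesis using assms swp_simps by (metis subsetD)
  next
    case Q
    then show ?thesis using assms swp_simps by (metis subsetD)
  next
    case C
    then have "swp u = u" "swp v = v" using core_edge assms by auto
    then show ?thesis using proj_const assms C by metis
  qed
  then show ?thesis using True by (simp add: col_def)
qed

lemma col_inj:
  assumes "g \<in> E"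
  shows "inj_on (col g) (xedge g)"
proof (cases "g \<inter> (P \<union> Q) = {}")
  case False
  have *: "col g u = u0" if "u = transpose a b u0" "u0 \<in> g" for u u0
    using that False meets_proj_transpose[OF assms False] proj_self[OF assms] by (simp add: col_def)
  show ?thesis
  proof (cases "g \<in> H")
    case True
    then show ?thesis using * by (auto simp: xedge_def inj_on_def)
  next
    case nH: False
    then show ?thesis using False proj_self[OF assms] by (auto simp: xedge_def inj_on_def col_def)
  qed
next
  case True
  then show ?thesis using core_edge[OF assms True] proj_self[OF assms]
    by (auto simp: inj_on_def col_def)
qed

text \<open>On a common image of two edges the colour of the first would be constant by
  \<open>col_const\<close> and injective by \<open>col_inj\<close>, although the image has at least
  two vertices.\<close>

lemma xedge_inj: "inj_on xedge E"
proof (rule inj_onI, rule ccontr)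
  fix g h assume gh: "g \<in> E" "h \<in> E" "xedge g = xedge h" "g \<noteq> h"
  have "card (xedge g) = k" using gh edge_card by (simp add: xedge_card)
  then have "finite (xedge g)" "\<not> card (xedge g) \<le> Suc 0" using k2 by (auto intro: card_ge_0_finite)
  then have "\<exists>u\<in>xedge g. \<exists>v\<in>xedge g. u \<noteq> v" by (simp add: card_le_Suc0_iff_eq)
  then obtain u v where uv: "u \<in> xedge g" "v \<in> xedge g" "u \<noteq> v" by blast
  then have "col g u = col g v" by (intro col_const[OF gh(1,2,4)]) (simp_all only: gh(3))
  with uv show False using col_inj[OF gh(1)] by (meson inj_onD)
qed

definition "E' = xedge ` E"

text \<open>Collapsing \<open>P\<close> to \<open>a\<close> and \<open>Q\<close> to \<open>b\<close>
  turns old walks into walks of the core. A vertex hanging on an edge \<open>e\<close> of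
  \<open>H\<close> is joined to its vertex of \<open>e\<close> by edges containing neither
  \<open>a\<close> nor \<open>b\<close>, which are unchanged, and the new copy of \<open>e\<close>
  leads on to the opposite root.\<close>

lemma conn': assumes "u \<in> V" "v \<in> V" shows "reach E' u v"
proof -
  define psi where "psi w = (if w \<in> P then a else if w \<in> Q then b else w)" for w
  have psi: "reach E' (psi u) (psi v)" if "reach E u v" for u v
    using that
  proof (induction rule: reach.induct)
    case step: (reach_step u y h z)
    have "reach E' (psi y) (psi z)"
      using step.hyps(2)
    proof (cases rule: edge_cases)
      case A
      then have "psi w = a" if "w \<in> h" for w using that notin by (auto simp: psi_def)
      then show ?thesis using step by simp
    next
      case B
      then have "psi w = b" if "w \<in> h" for w using that notin disj by (auto simp: psi_def)
      then show ?thesis using step by simp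
    next
      case P
      then show ?thesis using step by (auto simp: psi_def)
    next
      case Q
      then show ?thesis using step disj by (auto simp: psi_def)
    next
      case C
      then have "psi y = y" "psi z = z" using step by (auto simp: psi_def)
      moreover have "h \<in> E'" using C step.hyps(2) unfolding E'_def by (metis image_eqI)
      ultimately show ?thesis using step reach_edge by metis
    qed
    then show ?case using step reach_trans by metis
  qed simp
  have core: "reach E' a w" if "w \<in> V" "w \<notin> P \<union> Q" for w
    using psi[OF conn[OF ab(1) that(1)]] that notin by (simp add: psi_def)
  have attached: "reach E' w y" if xy: "(x = a \<and> y = b) \<or> (x = b \<and> y = a)" and w: "w \<in> branch H x" for x y w
  proof -
    have Hxy: "sim e x y" if "e \<in> H" for e using that xy Hab Hba by auto
    obtain e where e: "e \<in> H" "x \<in> e" "\<not> sim e x w" "w \<in> V" using w by (auto simp: branch_def)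
    have eE: "e \<in> E" using e HE by blast
    have v: "proj e w \<in> e" "sim e (proj e w) w" using proj[OF eE e(4)] by auto
    have vx: "proj e w \<noteq> x" using v e by auto
    have nsim: "\<not> sim e (proj e w) x" using edge_sep eE e v vx by metis
    have "reach E' (proj e w) w" using v(2) nsim
    proof (induction rule: reach.induct)
      case step: (reach_step v u h z)
      have "x \<notin> h"
        using step reach_step by metis
      moreover have "y \<notin> h"
      proof
        assume "y \<in> h"
        then have "sim e v y" using step reach_step by metis
        then show False using step.prems Hxy[OF e(1)] reach_sym reach_trans by metis
      qed
      ultimately have "xedge h = h" using xy by (intro xedge_none) auto
      then have "h \<in> E'" using step.hyps(2) unfolding E'_def by (metis DiffE image_eqI)
      then show ?case using step reach_step by metis
    qed simp
    moreover have "xedge e = insert y (e - {x})" using xy xedge_a[OF e(1)] xedge_b[OF e(1)] e(2) by auto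
    then have "reach E' y (proj e w)" using v vx eE
      by (intro reach_edge[of "xedge e"]) (auto simp: E'_def)
    ultimately show ?thesis using reach_sym reach_trans by metis
  qed
  have all: "reach E' a w" if "w \<in> V" for w
    using core[OF that] core[of b] attached[of a b w] attached[of b a w] ab notin
    by (metis Un_iff reach_sym reach_trans)
  show ?thesis using all assms reach_sym reach_trans by metis
qed

definition "col' g' = col (inv_into E xedge g')"

lemma col'_xedge: "g \<in> E \<Longrightarrow> col' (xedge g) = col g"
  by (simp add: col'_def xedge_inj)

lemma colour_hyps:
  "\<And>e. e \<in> E' \<Longrightarrow> e \<subseteq> V \<and> card e = k"
  "\<And>g h u v. g \<in> E' \<Longrightarrow> h \<in> E' \<Longrightarrow> g \<noteq> h \<Longrightarrow> u \<in> h \<Longrightarrow> v \<in> h \<Longrightarrow> col' g u = col' g v"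
  "\<And>g. g \<in> E' \<Longrightarrow> inj_on (col' g) g"
proof -
  show "e \<subseteq> V \<and> card e = k" if "e \<in> E'" for e
    using that xedge_sub by (auto simp: E'_def xedge_card edge_card)
  show "col' g u = col' g v" if g: "g \<in> E'" "h \<in> E'" "g \<noteq> h" "u \<in> h" "v \<in> h" for g h u v
  proof -
    obtain g0 h0 where "g = xedge g0" "g0 \<in> E" "h = xedge h0" "h0 \<in> E"
      using g unfolding E'_def by (metis imageE)
    then show ?thesis using col_const[of g0 h0 u v] g by (auto simp: col'_xedge)
  qed
  show "inj_on (col' g) g" if "g \<in> E'" for g
    using that col_inj by (auto simp: E'_def col'_xedge)
qed

lemma htree': "htree V E' k"
  by (rule htree_colour(1)[OF finV _ k2 conn', where \<phi> = col']) (fact colour_hyps | assumption)+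

lemma sepd': 
  assumes "u \<in> V" "v \<in> V"
  shows "sepd E' u v = card {g\<in>E. col g u \<noteq> col g v}"
proof -
  have "sepd E' u v = card {g\<in>E'. col' g u \<noteq> col' g v}"
    by (rule htree_colour(2)[OF finV _ k2 conn', where \<phi> = col']) (fact colour_hyps assms | assumption)+
  also have "{g\<in>E'. col' g u \<noteq> col' g v} = xedge ` {g\<in>E. col g u \<noteq> col g v}"
    by (auto simp: E'_def col'_xedge)
  also have "card \<dots> = card {g\<in>E. col g u \<noteq> col g v}"
    by (rule card_image) (rule inj_on_subset[OF xedge_inj], auto)
  finally show ?thesis .
qed

section \<open>Distances after an exchange\<close>

definition "outer u v = card {g\<in>E. g \<inter> (P \<union> Q) \<noteq> {} \<and> proj g u \<noteq> proj g v}"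
definition "inner u v = card {g\<in>E. g \<inter> (P \<union> Q) = {} \<and> proj g u \<noteq> proj g v}"

lemma split_card: "card {g\<in>E. R g} = card {g\<in>E. g \<inter> (P \<union> Q) \<noteq> {} \<and> R g} + card {g\<in>E. g \<inter> (P \<union> Q) = {} \<and> R g}"
  by (subst card_Un_disjoint[symmetric]) (auto simp: finE intro: arg_cong[where f=card])

text \<open>Edges meeting \<open>P \<union> Q\<close> keep their colours, so the exchange acts on
  distances only through core edges, which see \<open>swp u\<close> and \<open>swp v\<close> in
  place of \<open>u\<close> and \<open>v\<close>.\<close>

lemma sepd_split:
  assumes "u \<in> V" "v \<in> V"
  shows "sepd E u v = outer u v + inner u v" "sepd E' u v = outer u v + inner (swp u) (swp v)"
proof -
  have "{g\<in>E. \<not> sim g u v} = {g\<in>E. proj g u \<noteq> proj g v}" using proj_eq_iff assms by blast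
  then show "sepd E u v = outer u v + inner u v"
    unfolding sepd_def outer_def inner_def using split_card by metis
  have eq: "{g\<in>E. g \<inter> (P \<union> Q) \<noteq> {} \<and> col g u \<noteq> col g v} = {g\<in>E. g \<inter> (P \<union> Q) \<noteq> {} \<and> proj g u \<noteq> proj g v}"
    "{g\<in>E. g \<inter> (P \<union> Q) = {} \<and> col g u \<noteq> col g v} = {g\<in>E. g \<inter> (P \<union> Q) = {} \<and> proj g (swp u) \<noteq> proj g (swp v)}"
    by (auto simp: col_def)
  show "sepd E' u v = outer u v + inner (swp u) (swp v)"
    unfolding sepd'[OF assms] outer_def inner_def using split_card[of "\<lambda>g. col g u \<noteq> col g v"]
    by (simp only: eq)
qed

lemma inner_root:
  assumes "u \<in> P \<Longrightarrow> u' = a" "u \<in> Q \<Longrightarrow> u' = b" "u \<notin> P \<Longrightarrow> u \<notin> Q \<Longrightarrow> u' = u" "u \<in> V" "v \<in> V"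
  shows "inner u v = inner u' v" "inner v u = inner v u'"
proof -
  have "proj g u = proj g u'" if "g \<in> E" "g \<inter> (P \<union> Q) = {}" for g
    using branch_sim_root[OF HE, of u a g] branch_sim_root[OF HE, of u b g] that assms ab
      proj_eq_iff[OF that(1)] by (metis Int_Un_distrib Un_empty)
  then show "inner u v = inner u' v" "inner v u = inner v u'"
    unfolding inner_def by (auto intro!: arg_cong[where f=card])
qed

lemma outer_root: assumes "v \<in> V" shows "outer a v = outer b v"
proof -
  have "proj g a = proj g b" if "g \<in> E" "g \<inter> (P \<union> Q) \<noteq> {}" for g
    using meets_sim[OF that] proj_eq_iff[OF that(1)] ab by simp
  then show ?thesis unfolding outer_def by (metis (lifting))
qed

lemma inner_sym: "inner u v = inner v u" by (simp add: inner_def eq_commute)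

lemma sepd_core: "u \<in> V - P - Q \<Longrightarrow> v \<in> V - P - Q \<Longrightarrow> sepd E' u v = sepd E u v"
  by (simp add: sepd_split swp_simps)

text \<open>Core edges see both vertices at their roots; interchanging the roots \<open>a\<close>
  and \<open>b\<close> does not change the number of core edges between them.\<close>

lemma sepd_outer:
  assumes "u \<in> P \<union> Q" "v \<in> P \<union> Q"
  shows "sepd E' u v = sepd E u v"
proof -
  have V: "u \<in> V" "v \<in> V" using assms branch_subset by blast+
  define r where "r w = (if w \<in> P then a else b)" for w
  have r: "inner w z = inner (r w) z" "inner z w = inner z (r w)" if "w \<in> P \<union> Q" "z \<in> V" for w z
    using that inner_root[of w "r w" z] disj branch_subset[of H a] branch_subset[of H b]
    by (cases "w \<in> P"; force simp: r_def)+
  have "r v \<in> V" using ab by (simp add: r_def)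
  then have "inner u v = inner (r u) (r v)" using r(2)[OF assms(2) V(1)] r(1)[OF assms(1)] by simp
  moreover have "swp w = transpose a b (r w)" if "w \<in> P \<union> Q" for w
    using that swp_simps by (auto simp: r_def)
  ultimately have "inner (swp u) (swp v) = inner u v"
    using assms inner_sym[of a b] by (auto simp: r_def inner_def)
  then show ?thesis using V by (simp add: sepd_split)
qed

text \<open>Moving from root \<open>a\<close> to root \<open>b\<close> changes the distance to a
  core vertex by d(b,v) - d(a,v); the form as sums avoids subtraction of natural numbers.\<close>

lemma sepd_P:
  assumes "u \<in> P" "v \<in> V - P - Q"
  shows "sepd E' u v + sepd E a v = sepd E u v + sepd E b v"
proof -
  have V: "u \<in> V" using assms branch_subset by blast
  have "inner u v = inner a v" using assms V disj by (intro inner_root(1)) auto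
  then show ?thesis using assms V ab outer_root[of v] by (simp add: sepd_split swp_simps)
qed

lemma sepd_Q:
  assumes "u \<in> Q" "v \<in> V - P - Q"
  shows "sepd E' u v + sepd E b v = sepd E u v + sepd E a v"
proof -
  have V: "u \<in> V" using assms branch_subset by blast
  have "inner u v = inner b v" using assms V disj by (intro inner_root(1)) auto
  then show ?thesis using assms V ab outer_root[of v] by (simp add: sepd_split swp_simps)
qed

lemma card_E': "card E' = card E"
  unfolding E'_def by (rule card_image[OF xedge_inj])

lemma deg_E':
  shows "v \<noteq> a \<Longrightarrow> v \<noteq> b \<Longrightarrow> deg E' v = deg E v"
    and "deg E' a = card {e\<in>E - H. a \<in> e} + card {e\<in>H. b \<in> e}"
    and "deg E' b = card {e\<in>E - H. b \<in> e} + card {e\<in>H. a \<in> e}"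
proof -
  have *: "deg E' v = card {e\<in>E. v \<in> xedge e}" for v
  proof -
    have "{e\<in>E'. v \<in> e} = xedge ` {e\<in>E. v \<in> xedge e}" by (auto simp: E'_def)
    then show ?thesis unfolding deg_def
      using card_image[OF inj_on_subset[OF xedge_inj, of "{e\<in>E. v \<in> xedge e}"]] by auto
  qed
  have mem: "v \<in> xedge e \<longleftrightarrow> (if e \<in> H then transpose a b v \<in> e else v \<in> e)" for v e
    by (auto simp: xedge_def image_iff) (metis transpose_involutory)
  show "v \<noteq> a \<Longrightarrow> v \<noteq> b \<Longrightarrow> deg E' v = deg E v"
    unfolding * mem by (simp add: deg_def)
  have H: "finite H" using finE HE finite_subset by blast
  have "{e\<in>E. a \<in> xedge e} = {e\<in>E - H. a \<in> e} \<union> {e\<in>H. b \<in> e}"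
    "{e\<in>E. b \<in> xedge e} = {e\<in>E - H. b \<in> e} \<union> {e\<in>H. a \<in> e}"
    unfolding mem using HE by auto
  then show "deg E' a = card {e\<in>E - H. a \<in> e} + card {e\<in>H. b \<in> e}"
    "deg E' b = card {e\<in>E - H. b \<in> e} + card {e\<in>H. a \<in> e}"
    unfolding * using card_Un_disjoint[of "{e\<in>E - H. a \<in> e}" "{e\<in>H. b \<in> e}"]
      card_Un_disjoint[of "{e\<in>E - H. b \<in> e}" "{e\<in>H. a \<in> e}"] finE H by auto
qed

end

section \<open>Perron vectors of distance matrices\<close>

definition qform :: "'a set \<Rightarrow> ('a \<Rightarrow> 'a \<Rightarrow> real) \<Rightarrow> ('a \<Rightarrow> real) \<Rightarrow> real" where
  "qform V d x = (\<Sum>u\<in>V. \<Sum>v\<in>V. d u v * x u * x v)"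

definition sqn :: "'a set \<Rightarrow> ('a \<Rightarrow> real) \<Rightarrow> real" where
  "sqn V x = (\<Sum>u\<in>V. (x u)\<^sup>2)"

text \<open>That \<open>r\<close> is the largest eigenvalue is not part of this notion; it enters
  through the Rayleigh bound obtained along with the vector.\<close>

definition is_perron :: "'a set \<Rightarrow> ('a \<Rightarrow> 'a \<Rightarrow> real) \<Rightarrow> real \<Rightarrow> ('a \<Rightarrow> real) \<Rightarrow> bool" where
  "is_perron V d r x \<longleftrightarrow> 0 < r \<and> (\<forall>u\<in>V. 0 < x u) \<and> (\<forall>u\<in>V. (\<Sum>w\<in>V. d u w * x w) = r * x u)"

lemma qform_cong: "(\<And>v. v \<in> V \<Longrightarrow> x v = y v) \<Longrightarrow> qform V d x = qform V d y"
  unfolding qform_def by (intro sum.cong) auto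

lemma sqn_cong: "(\<And>v. v \<in> V \<Longrightarrow> x v = y v) \<Longrightarrow> sqn V x = sqn V y"
  unfolding sqn_def by (intro sum.cong) auto

lemma qform_scale: "qform V d (\<lambda>v. c * x v) = c\<^sup>2 * qform V d x"
  unfolding qform_def sum_distrib_left by (intro sum.cong refl) (simp add: power2_eq_square)

lemma sqn_scale: "sqn V (\<lambda>v. c * x v) = c\<^sup>2 * sqn V x"
  unfolding sqn_def sum_distrib_left by (intro sum.cong refl) (simp add: power_mult_distrib)

lemma sqn_nonneg: "0 \<le> sqn V x"
  unfolding sqn_def by (intro sum_nonneg) simp

lemma sqn_eq_0: "finite V \<Longrightarrow> sqn V x = 0 \<longleftrightarrow> (\<forall>v\<in>V. x v = 0)"
  unfolding sqn_def by (subst sum_nonneg_eq_0_iff) auto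

lemma qform_eigen:
  assumes "\<And>u. u \<in> V \<Longrightarrow> (\<Sum>w\<in>V. d u w * x w) = r * x u"
  shows "qform V d x = r * sqn V x"
proof -
  have "qform V d x = (\<Sum>u\<in>V. x u * (\<Sum>w\<in>V. d u w * x w))"
    unfolding qform_def sum_distrib_left by (intro sum.cong refl) (simp add: mult_ac)
  also have "\<dots> = (\<Sum>u\<in>V. r * (x u)\<^sup>2)"
    using assms by (intro sum.cong refl) (simp add: power2_eq_square)
  finally show ?thesis by (simp add: sqn_def sum_distrib_left)
qed

text \<open>The form attains its maximum on the unit sphere. Vectors are functions on the whole
  type, so coordinates outside \<open>V\<close> are pinned to 0; the sphere then lies in a product
  of compact intervals, compact by Tychonoff's theorem.\<close>

lemma rayleigh_max:
  assumes fin: "finite V" and "v0 \<in> V"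
  obtains x where "sqn V x = 1" "\<And>y. qform V d y \<le> qform V d x * sqn V y"
proof -
  define S where "S i = (if i \<in> V then {-1..1} else {0::real})" for i
  define K where "K = (PiE UNIV S) \<inter> {x. sqn V x = 1}"
  have "compactin (product_topology (\<lambda>_. euclidean) UNIV) (PiE UNIV S)"
    by (subst compactin_PiE) (auto simp: S_def)
  then have "compact (PiE UNIV S)" by (simp add: euclidean_product_topology)
  moreover have cs: "continuous_on A (\<lambda>x. sqn V x)" "continuous_on A (\<lambda>x. qform V d x)" for A
    unfolding sqn_def qform_def
    by (auto intro!: continuous_intros continuous_on_subset[OF continuous_on_product_coordinates])
  have "closed {x. sqn V x = 1}"
    using cs(1)[of UNIV] by (intro closed_Collect_eq) auto
  ultimately have "compact K" unfolding K_def by (rule compact_Int_closed)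
  moreover have inK: "(\<lambda>v. if v \<in> V then y v else 0) \<in> K" if "sqn V y = 1" for y
  proof -
    have "(y v)\<^sup>2 \<le> 1" if v: "v \<in> V" for v
      using member_le_sum[OF v, of "\<lambda>v. (y v)\<^sup>2"] fin \<open>sqn V y = 1\<close> by (simp add: sqn_def)
    then have "\<bar>y v\<bar> \<le> 1" if "v \<in> V" for v using that by (simp add: abs_square_le_1)
    then have "\<forall>v\<in>V. -1 \<le> y v \<and> y v \<le> 1" by (simp add: abs_le_iff minus_le_iff)
    moreover have "sqn V (\<lambda>v. if v \<in> V then y v else 0) = 1"
      using sqn_cong[of V "\<lambda>v. if v \<in> V then y v else 0" y] that by simp
    ultimately show ?thesis by (auto simp: K_def S_def)
  qed
  have "sqn V (\<lambda>v. if v = v0 then 1 else 0) = 1"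
    unfolding sqn_def using assms by (simp add: if_distrib[of "\<lambda>x. x\<^sup>2"] sum.delta cong: if_cong)
  then have "K \<noteq> {}" using inK by blast
  ultimately obtain x where x: "x \<in> K" "\<And>y. y \<in> K \<Longrightarrow> qform V d y \<le> qform V d x"
    using continuous_attains_sup[of K "qform V d"] cs(2) by auto
  have unit: "qform V d y \<le> qform V d x" if "sqn V y = 1" for y
    using x(2)[OF inK[OF that]] qform_cong[of V "\<lambda>v. if v \<in> V then y v else 0" y d] by simp
  have "qform V d y \<le> qform V d x * sqn V y" for y
  proof (cases "sqn V y = 0")
    case True
    then have "qform V d y = 0" using sqn_eq_0[OF fin] by (simp add: qform_def)
    then show ?thesis using True by simp
  next
    case False
    then have pos: "0 < sqn V y" using sqn_nonneg[of V y] by linarith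
    define c where "c = 1 / sqrt (sqn V y)"
    have c: "c\<^sup>2 * sqn V y = 1" using pos by (simp add: c_def power_divide)
    then have "c\<^sup>2 * qform V d y \<le> qform V d x"
      using unit[of "\<lambda>v. c * y v"] by (simp add: sqn_scale qform_scale)
    then have "sqn V y * (c\<^sup>2 * qform V d y) \<le> sqn V y * qform V d x" using pos by simp
    moreover have "sqn V y * (c\<^sup>2 * qform V d y) = qform V d y * (c\<^sup>2 * sqn V y)" by simp
    ultimately show ?thesis using c by (metis mult.commute mult.right_neutral)
  qed
  then show ?thesis using that x(1) by (auto simp: K_def)
qed

lemma qform_perturb:
  assumes "finite V" "\<And>u v. d u v = d v u" "d z z = 0" "z \<in> V"
  shows "qform V d (\<lambda>v. x v + (if v = z then t else 0)) = qform V d x + 2 * t * (\<Sum>w\<in>V. d z w * x w)"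
proof -
  have "qform V d (\<lambda>v. x v + (if v = z then t else 0))
    = (\<Sum>u\<in>V. \<Sum>v\<in>V. d u v * x u * x v + (if v = z then d u z * x u * t else 0)
        + (if u = z then d z v * t * x v else 0))"
    unfolding qform_def by (intro sum.cong refl) (auto simp: algebra_simps assms(3))
  also have "\<dots> = qform V d x + (\<Sum>u\<in>V. \<Sum>v\<in>V. if v = z then d u z * x u * t else 0)
      + (\<Sum>u\<in>V. \<Sum>v\<in>V. if u = z then d z v * t * x v else 0)"
    unfolding qform_def by (simp only: sum.distrib)
  also have "(\<Sum>u\<in>V. \<Sum>v\<in>V. if v = z then d u z * x u * t else 0) = (\<Sum>u\<in>V. d u z * x u * t)"
    using assms(1,4) by (simp add: sum.delta)
  also have "(\<Sum>u\<in>V. \<Sum>v\<in>V. if u = z then d z v * t * x v else 0) = t * (\<Sum>v\<in>V. d z v * x v)"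
    using assms(1,4) by (subst sum.swap) (simp add: sum.delta sum_distrib_left mult_ac)
  also have "(\<Sum>u\<in>V. d u z * x u * t) = t * (\<Sum>v\<in>V. d z v * x v)"
    unfolding sum_distrib_left assms(2)[of _ z] by (intro sum.cong refl) simp
  finally show ?thesis by simp
qed

lemma sqn_perturb:
  assumes "finite V" "z \<in> V"
  shows "sqn V (\<lambda>v. x v + (if v = z then t else 0)) = sqn V x + 2 * t * x z + t\<^sup>2"
proof -
  have "sqn V (\<lambda>v. x v + (if v = z then t else 0)) = (\<Sum>v\<in>V. (x v)\<^sup>2 + (if v = z then 2 * t * x z + t\<^sup>2 else 0))"
    unfolding sqn_def by (intro sum.cong refl) (auto simp: power2_eq_square algebra_simps)
  then show ?thesis using assms by (simp add: sum.distrib sqn_def)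
qed

text \<open>The first-order condition at a maximum: a nonzero slope violates the bound at t = c /
  r.\<close>

lemma linear_le_quadratic:
  assumes "\<And>t::real. 2 * t * c \<le> r * t\<^sup>2" "0 < r"
  shows "c = 0"
proof -
  have "2 * (c / r) * c \<le> r * (c / r)\<^sup>2" by (rule assms(1))
  then have "c\<^sup>2 / r \<le> 0" using assms(2) by (simp add: power2_eq_square field_simps)
  then show ?thesis using assms(2) by (simp add: divide_le_0_iff)
qed

text \<open>Passing to absolute values does not decrease the form, so they maximise it too. Varying
  one coordinate yields the eigenvalue equation there, and an entry 0 would force all entries to
  vanish, because distinct vertices have positive \<open>d\<close>.\<close>

lemma perron_exists:
  assumes fin: "finite V" and two: "u0 \<in> V" "v0 \<in> V" "u0 \<noteq> v0"
    and sym: "\<And>u v. d u v = d v u" and d0: "\<And>u. d u u = 0"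
    and pos: "\<And>u v. u \<in> V \<Longrightarrow> v \<in> V \<Longrightarrow> u \<noteq> v \<Longrightarrow> 0 < d u v"
  obtains r x where "is_perron V d r x" "\<And>y. qform V d y \<le> r * sqn V y"
proof -
  obtain x0 where x0: "sqn V x0 = 1" "\<And>y. qform V d y \<le> qform V d x0 * sqn V y"
    using rayleigh_max[OF fin two(1)] by metis
  have dn: "0 \<le> d u v" if "u \<in> V" "v \<in> V" for u v
    using pos[OF that] d0[of u] by (cases "u = v") auto
  define x where "x v = \<bar>x0 v\<bar>" for v
  have sx: "sqn V x = 1" using x0(1) by (simp add: x_def sqn_def)
  define r where "r = qform V d x"
  have "qform V d x0 \<le> r"
    unfolding r_def qform_def x_def
  proof (intro sum_mono)
    fix u v assume "u \<in> V" "v \<in> V"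
    then have "d u v * (x0 u * x0 v) \<le> d u v * (\<bar>x0 u\<bar> * \<bar>x0 v\<bar>)"
      using dn by (intro mult_left_mono) (auto simp flip: abs_mult)
    then show "d u v * x0 u * x0 v \<le> d u v * \<bar>x0 u\<bar> * \<bar>x0 v\<bar>" by (simp add: mult.assoc)
  qed
  then have mx: "qform V d y \<le> r * sqn V y" for y
    using x0(2)[of y] sqn_nonneg[of V y] mult_right_mono order_trans by blast
  have rpos: "0 < r"
  proof -
    have "0 < (\<Sum>u\<in>V. \<Sum>v\<in>V. d u v)"
    proof (rule sum_pos2[OF fin two(1)])
      show "0 < (\<Sum>v\<in>V. d u0 v)"
        by (rule sum_pos2[OF fin two(2)]) (use two pos dn in auto)
    qed (use dn in \<open>auto intro!: sum_nonneg\<close>)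
    also have "\<dots> = qform V d (\<lambda>_. 1)" by (simp add: qform_def)
    also have "\<dots> \<le> r * sqn V (\<lambda>_. 1)" by (rule mx)
    finally show ?thesis using sqn_nonneg[of V "\<lambda>_. 1"] by (metis less_irrefl linorder_not_less mult_nonpos_nonneg order.trans)
  qed
  have eig: "(\<Sum>w\<in>V. d z w * x w) = r * x z" if z: "z \<in> V" for z
  proof -
    have "2 * t * ((\<Sum>w\<in>V. d z w * x w) - r * x z) \<le> r * t\<^sup>2" for t
      using mx[of "\<lambda>v. x v + (if v = z then t else 0)"] qform_perturb[OF fin sym d0 z, where x = x and t = t]
        sqn_perturb[OF fin z, where x = x and t = t] sx by (simp add: r_def algebra_simps)
    then have "(\<Sum>w\<in>V. d z w * x w) - r * x z = 0" using rpos linear_le_quadratic by metis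
    then show ?thesis by simp
  qed
  have xn: "0 \<le> x v" for v by (simp add: x_def)
  have "0 < x u" if u: "u \<in> V" for u
  proof (rule ccontr)
    assume "\<not> 0 < x u"
    then have "x u = 0" using xn[of u] by simp
    then have "(\<Sum>w\<in>V. d u w * x w) = 0" using eig u by simp
    then have "\<forall>w\<in>V. d u w * x w = 0"
      using dn u xn by (subst (asm) sum_nonneg_eq_0_iff[OF fin]) auto
    then have "x w = 0" if "w \<in> V" for w
      using that pos[OF u that] \<open>x u = 0\<close> by (cases "u = w") auto
    then show False using sx sqn_eq_0[OF fin, of x] by simp
  qed
  then have "is_perron V d r x" using rpos eig by (simp add: is_perron_def)
  then show ?thesis using that mx by blast
qed

text \<open>Bessel's inequality for the vertex indicators bounds the number of eigenvalues.\<close>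

lemma finite_eigenvalues:
  assumes fin: "finite V" and sym: "\<And>u v. d u v = d v u"
  shows "finite {r. \<exists>x :: 'a \<Rightarrow> real. (\<exists>v\<in>V. x v \<noteq> 0) \<and> (\<forall>u\<in>V. (\<Sum>w\<in>V. d u w * x w) = r * x u)}"
    (is "finite ?R")
proof (rule ccontr)
  assume "infinite ?R"
  then obtain R where R: "finite R" "card R = Suc (card V)" "R \<subseteq> ?R"
    using infinite_arbitrarily_large by blast
  have "\<exists>x. sqn V x = 1 \<and> (\<forall>u\<in>V. (\<Sum>w\<in>V. d u w * x w) = r * x u)" if r: "r \<in> R" for r
  proof -
    obtain x where x: "\<exists>v\<in>V. x v \<noteq> 0" "\<forall>u\<in>V. (\<Sum>w\<in>V. d u w * x w) = r * x u" using subsetD[OF R(3) r] by auto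
    define c where "c = 1 / sqrt (sqn V x)"
    have "0 < sqn V x" using x(1) sqn_eq_0[OF fin, of x] sqn_nonneg[of V x] by fastforce
    then have "c\<^sup>2 * sqn V x = 1" by (simp add: c_def power_divide)
    then have "sqn V (\<lambda>v. c * x v) = 1" by (simp only: sqn_scale)
    moreover have "(\<Sum>w\<in>V. d u w * (c * x w)) = r * (c * x u)" if "u \<in> V" for u
    proof -
      have "(\<Sum>w\<in>V. d u w * (c * x w)) = c * (\<Sum>w\<in>V. d u w * x w)"
        by (simp add: sum_distrib_left mult.left_commute)
      then show ?thesis using x(2) that by simp
    qed
    ultimately show ?thesis by blast
  qed
  then obtain f where f: "\<And>r. r \<in> R \<Longrightarrow> sqn V (f r) = 1"
    "\<And>r u. r \<in> R \<Longrightarrow> u \<in> V \<Longrightarrow> (\<Sum>w\<in>V. d u w * f r w) = r * f r u" by metis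
  have orth: "(\<Sum>v\<in>V. f r v * f s v) = 0" if rs: "r \<in> R" "s \<in> R" "r \<noteq> s" for r s
  proof -
    have "r * (\<Sum>v\<in>V. f r v * f s v) = (\<Sum>u\<in>V. (\<Sum>w\<in>V. d u w * f r w) * f s u)"
      using f(2) rs by (simp add: sum_distrib_left mult.assoc)
    also have "\<dots> = (\<Sum>u\<in>V. \<Sum>w\<in>V. d u w * f r w * f s u)" by (simp add: sum_distrib_right)
    also have "\<dots> = (\<Sum>w\<in>V. \<Sum>u\<in>V. d u w * f r w * f s u)" by (rule sum.swap)
    also have "\<dots> = (\<Sum>w\<in>V. (\<Sum>u\<in>V. d w u * f s u) * f r w)"
      unfolding sum_distrib_right
      by (intro sum.cong refl) (simp add: sym mult.commute mult.left_commute)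
    also have "\<dots> = s * (\<Sum>v\<in>V. f r v * f s v)"
      using f(2) rs by (simp add: sum_distrib_left mult.assoc mult.commute mult.left_commute)
    finally show ?thesis using rs by simp
  qed
  have inner: "(\<Sum>v\<in>V. f r v * f s v) = (if r = s then 1 else 0)" if "r \<in> R" "s \<in> R" for r s
    using orth f(1) that by (auto simp: sqn_def power2_eq_square)
  have bessel: "(\<Sum>r\<in>R. (f r z)\<^sup>2) \<le> 1" if z: "z \<in> V" for z
  proof -
    let ?B = "\<Sum>r\<in>R. (f r z)\<^sup>2"
    let ?p = "\<lambda>v. \<Sum>r\<in>R. f r z * f r v"
    have "(\<Sum>v\<in>V. (?p v)\<^sup>2) = (\<Sum>v\<in>V. \<Sum>r\<in>R. \<Sum>s\<in>R. f r z * f s z * (f r v * f s v))"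
      unfolding power2_eq_square sum_product by (intro sum.cong refl) (simp add: mult_ac)
    also have "\<dots> = (\<Sum>r\<in>R. \<Sum>s\<in>R. f r z * f s z * (\<Sum>v\<in>V. f r v * f s v))"
      unfolding sum_distrib_left by (subst sum.swap, intro sum.cong refl, rule sum.swap)
    also have "\<dots> = (\<Sum>r\<in>R. \<Sum>s\<in>R. f r z * f s z * (if r = s then 1 else 0))"
      using inner by (intro sum.cong refl) auto
    also have "\<dots> = ?B" using R(1) by (simp add: power2_eq_square if_distrib cong: if_cong)
    finally have pp: "(\<Sum>v\<in>V. (?p v)\<^sup>2) = ?B" .
    have "0 \<le> (\<Sum>v\<in>V. ((if v = z then 1 else 0) - ?p v)\<^sup>2)" by (intro sum_nonneg) simp
    also have "\<dots> = (\<Sum>v\<in>V. (if v = z then 1 - 2 * ?p z else 0) + (?p v)\<^sup>2)"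
      by (intro sum.cong refl) (auto simp: power2_eq_square algebra_simps)
    also have "\<dots> = 1 - 2 * ?p z + ?B" using fin z pp by (simp add: sum.distrib)
    also have "?p z = ?B" by (simp add: power2_eq_square)
    finally show ?thesis by simp
  qed
  have "real (card R) = (\<Sum>r\<in>R. sqn V (f r))" using f(1) by simp
  also have "\<dots> = (\<Sum>v\<in>V. \<Sum>r\<in>R. (f r v)\<^sup>2)" unfolding sqn_def by (rule sum.swap)
  also have "\<dots> \<le> (\<Sum>v\<in>V. 1)" by (intro sum_mono bessel)
  finally show False using R(2) by simp
qed

abbreviation rd :: "'a set set \<Rightarrow> 'a \<Rightarrow> 'a \<Rightarrow> real" where
  "rd E u v \<equiv> real (sepd E u v)"

lemma (in htree) dist_eigenvalue_iff:
  "dist_eigenvalue V E r \<longleftrightarrow>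
     (\<exists>x :: 'a \<Rightarrow> real. (\<exists>v\<in>V. x v \<noteq> 0) \<and> (\<forall>u\<in>V. (\<Sum>w\<in>V. rd E u w * x w) = r * x u))"
  unfolding dist_eigenvalue_def by (simp add: hdist_eq)

lemma (in htree) perron:
  assumes "E \<noteq> {}"
  obtains x where "is_perron V (rd E) (dist_spectral_radius V E) x"
    "\<And>y. qform V (rd E) y \<le> dist_spectral_radius V E * sqn V y"
proof -
  obtain e where e: "e \<in> E" using assms by blast
  obtain u0 where "u0 \<in> e" using edge_other[OF e] by blast
  moreover obtain v0 where "v0 \<in> e" "v0 \<noteq> u0" using edge_other[OF e] by blast
  ultimately have two: "u0 \<in> V" "v0 \<in> V" "u0 \<noteq> v0" using edge_sub[OF e] by auto
  obtain r x where rx: "is_perron V (rd E) r x" "\<And>y. qform V (rd E) y \<le> r * sqn V y"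
    by (rule perron_exists[OF finV two, of "rd E"]) (auto simp: sepd_sym sepd_pos)
  let ?R = "{r. dist_eigenvalue V E r}"
  \<comment> \<open>Finiteness gives \<open>Max\<close> its meaning; the Rayleigh bound then shows
    that no eigenvalue exceeds \<open>r\<close>.\<close>
  have "finite ?R" unfolding dist_eigenvalue_iff
    by (rule finite_eigenvalues[OF finV]) (simp add: sepd_sym)
  moreover have "r \<in> ?R"
    using rx(1) two(1) unfolding dist_eigenvalue_iff is_perron_def by (force intro!: exI[of _ x])
  moreover have "s \<le> r" if "s \<in> ?R" for s
  proof -
    obtain y where y: "\<exists>v\<in>V. y v \<noteq> 0" "\<forall>u\<in>V. (\<Sum>w\<in>V. rd E u w * y w) = s * y u"
      using \<open>s \<in> ?R\<close> unfolding dist_eigenvalue_iff by auto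
    have "qform V (rd E) y = s * sqn V y" using y by (intro qform_eigen) auto
    moreover have "0 < sqn V y" using y(1) sqn_eq_0[OF finV, of y] sqn_nonneg[of V y] by fastforce
    ultimately show ?thesis using rx(2)[of y] by simp
  qed
  ultimately have "dist_spectral_radius V E = r"
    unfolding dist_spectral_radius_def by (intro Max_eqI) auto
  then show ?thesis using that rx by simp
qed

section \<open>Isomorphic copies and the effect of an exchange\<close>

lemma reach_image: "reach F u v \<Longrightarrow> reach ((`) f ` F) (f u) (f v)"
proof (induction rule: reach.induct)
  case (reach_step u v e w)
  then show ?case by (metis reach.reach_step image_eqI)
qed simp

lemma reach_image_iff:
  assumes "inj_on f V" "\<And>e. e \<in> F \<Longrightarrow> e \<subseteq> V" "u \<in> V" "v \<in> V"
  shows "reach ((`) f ` F) (f u) (f v) \<longleftrightarrow> reach F u v"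
proof
  assume "reach ((`) f ` F) (f u) (f v)"
  then have "reach ((`) (inv_into V f) ` (`) f ` F) (inv_into V f (f u)) (inv_into V f (f v))"
    by (rule reach_image)
  moreover have "(`) (inv_into V f) ` (`) f ` F = id ` F"
    unfolding image_image
    by (intro image_cong refl)
      (use assms(1,2) inv_into_image_cancel[of f V] in \<open>simp add: image_image\<close>)
  ultimately show "reach F u v" using assms by simp
qed (rule reach_image)

lemma image_inj_on: "inj_on f V \<Longrightarrow> (\<And>e. e \<in> F \<Longrightarrow> e \<subseteq> V) \<Longrightarrow> inj_on ((`) f) F"
  by (meson inj_onI inj_on_image_eq_iff)

lemma (in htree) image_avoid:
  assumes f: "inj_on f V" and "e \<in> E"
  shows "(`) f ` E - {f ` e} = (`) f ` (E - {e})"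
  using image_inj_on[OF f edge_sub] assms(2)
  by (subst inj_on_image_set_diff[of "(`) f" E]) auto

lemma (in htree) htree_image:
  assumes f: "inj_on f V"
  shows "htree (f ` V) ((`) f ` E) k"
proof
  show "finite (f ` V)" using finV by simp
  show "2 \<le> k" by (rule k2)
  show "e \<subseteq> f ` V" "card e = k" if "e \<in> (`) f ` E" for e
    using that edge_sub edge_card f by (auto simp: card_image inj_on_subset)
  show "reach ((`) f ` E) u v" if "u \<in> f ` V" "v \<in> f ` V" for u v
    using that conn reach_image by (metis imageE)
  show "\<not> reach ((`) f ` E - {e}) u v"
    if e: "e \<in> (`) f ` E" "u \<in> e" "v \<in> e" "u \<noteq> v" for e u v
  proof -
    obtain g x y where g: "g \<in> E" "e = f ` g" "u = f x" "v = f y" "x \<in> g" "y \<in> g" using e by auto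
    then have "\<not> sim g x y" using edge_sep[of g x y] e by auto
    moreover have "x \<in> V" "y \<in> V" using g edge_sub by auto
    ultimately show ?thesis
      using reach_image_iff[OF f, of "E - {g}" x y] edge_sub g image_avoid[OF f g(1)] by simp
  qed
qed

lemma (in htree) sepd_image:
  assumes f: "inj_on f V" and "u \<in> V" "v \<in> V"
  shows "sepd ((`) f ` E) (f u) (f v) = sepd E u v"
proof -
  have iff: "reach ((`) f ` E - {f ` e}) (f u) (f v) \<longleftrightarrow> sim e u v" if "e \<in> E" for e
    using reach_image_iff[OF f, of "E - {e}" u v] edge_sub assms image_avoid[OF f that] by simp
  have "{g \<in> (`) f ` E. \<not> reach ((`) f ` E - {g}) (f u) (f v)} = (`) f ` {e\<in>E. \<not> sim e u v}"
    using iff by auto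
  moreover have "inj_on ((`) f) {e\<in>E. \<not> sim e u v}" using edge_sub by (intro image_inj_on[OF f]) auto
  ultimately show ?thesis unfolding sepd_def by (simp add: card_image)
qed

lemma (in htree) deg_image:
  assumes f: "inj_on f V" and "v \<in> V"
  shows "deg ((`) f ` E) (f v) = deg E v"
proof -
  have "{g \<in> (`) f ` E. f v \<in> g} = (`) f ` {e\<in>E. v \<in> e}"
    using inj_on_image_mem_iff[OF assms] edge_sub by blast
  moreover have "inj_on ((`) f) {e\<in>E. v \<in> e}" using edge_sub by (intro image_inj_on[OF f]) auto
  ultimately show ?thesis unfolding deg_def by (simp add: card_image)
qed

text \<open>Extremality is assumed against hypertrees on sets of natural numbers, while exchanges
  stay on \<open>V\<close>. Eigenvectors cross a relabelling by composition.\<close>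

lemma (in htree) dist_spectral_radius_image:
  assumes f: "inj_on f V"
  shows "dist_spectral_radius (f ` V) ((`) f ` E) = dist_spectral_radius V E"
proof -
  interpret T: htree "f ` V" "(`) f ` E" k by (rule htree_image[OF f])
  have "dist_eigenvalue (f ` V) ((`) f ` E) r \<longleftrightarrow> dist_eigenvalue V E r" for r
  proof -
    have sum: "(\<Sum>w\<in>f ` V. rd ((`) f ` E) (f u) w * y w) = (\<Sum>w\<in>V. rd E u w * y (f w))"
      if "u \<in> V" for u y
      using that by (simp add: sum.reindex[OF f] sepd_image[OF f])
    show ?thesis
      unfolding T.dist_eigenvalue_iff dist_eigenvalue_iff
    proof
      assume "\<exists>y. (\<exists>v\<in>f ` V. y v \<noteq> 0) \<and> (\<forall>u\<in>f ` V. (\<Sum>w\<in>f ` V. rd ((`) f ` E) u w * y w) = r * y u)"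
      then obtain y where "\<exists>v\<in>f ` V. y v \<noteq> 0" "\<forall>u\<in>f ` V. (\<Sum>w\<in>f ` V. rd ((`) f ` E) u w * y w) = r * y u"
        by auto
      then show "\<exists>x. (\<exists>v\<in>V. x v \<noteq> 0) \<and> (\<forall>u\<in>V. (\<Sum>w\<in>V. rd E u w * x w) = r * x u)"
        using sum by (intro exI[of _ "y \<circ> f"]) auto
    next
      assume "\<exists>x. (\<exists>v\<in>V. x v \<noteq> 0) \<and> (\<forall>u\<in>V. (\<Sum>w\<in>V. rd E u w * x w) = r * x u)"
      then obtain x where x: "\<exists>v\<in>V. x v \<noteq> 0" "\<forall>u\<in>V. (\<Sum>w\<in>V. rd E u w * x w) = r * x u" by auto
      have "(\<Sum>w\<in>V. rd E u w * x (inv_into V f (f w))) = (\<Sum>w\<in>V. rd E u w * x w)" for u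
        using f by (intro sum.cong) auto
      then show "\<exists>y. (\<exists>v\<in>f ` V. y v \<noteq> 0) \<and> (\<forall>u\<in>f ` V. (\<Sum>w\<in>f ` V. rd ((`) f ` E) u w * y w) = r * y u)"
        using x f sum by (intro exI[of _ "x \<circ> inv_into V f"]) auto
    qed
  qed
  then show ?thesis by (simp add: dist_spectral_radius_def)
qed

lemma in_TT_iff:
  assumes "2 \<le> k"
  shows "in_TT k m \<Delta> n V E \<longleftrightarrow>
    htree V E k \<and> card E = m \<and> Max (deg E ` V) = \<Delta> \<and> card {v\<in>V. deg E v = \<Delta>} = n"
  unfolding in_TT_def using hypertree_htree[OF _ _ assms] htree.hypertree_of by metis

lemma in_TT_image:
  assumes "2 \<le> k" "in_TT k m \<Delta> n V E" "inj_on f V"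
  shows "in_TT k m \<Delta> n (f ` V) ((`) f ` E)"
proof -
  interpret htree V E k using assms in_TT_iff by metis
  have "card ((`) f ` E) = card E" using image_inj_on[OF assms(3) edge_sub] by (simp add: card_image)
  moreover have "deg ((`) f ` E) ` f ` V = deg E ` V"
    using deg_image[OF assms(3)] by (simp add: image_image)
  moreover have "{v\<in>f ` V. deg ((`) f ` E) v = \<Delta>} = f ` {v\<in>V. deg E v = \<Delta>}"
    using deg_image[OF assms(3)] by auto
  then have "card {v\<in>f ` V. deg ((`) f ` E) v = \<Delta>} = card {v\<in>V. deg E v = \<Delta>}"
    using assms(3) by (simp add: card_image inj_on_subset)
  ultimately show ?thesis
    using assms(2) htree_image[OF assms(3)] by (simp add: in_TT_iff[OF assms(1)])
qed

text \<open>A symmetric change of the kernel of rank at most two. Two vectors are allowed because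
  the balancing step pairs the Perron vectors of two hypertrees.\<close>

lemma bilinear_diff:
  fixes d :: "'a \<Rightarrow> 'a \<Rightarrow> real"
  assumes "\<And>u v. u \<in> V \<Longrightarrow> v \<in> V \<Longrightarrow> d' u v = d u v + s u * g v + g u * s v"
  shows "(\<Sum>u\<in>V. \<Sum>v\<in>V. d' u v * x u * y v) = (\<Sum>u\<in>V. \<Sum>v\<in>V. d u v * x u * y v)
    + (\<Sum>u\<in>V. s u * x u) * (\<Sum>v\<in>V. g v * y v) + (\<Sum>u\<in>V. g u * x u) * (\<Sum>v\<in>V. s v * y v)"
proof -
  have "(\<Sum>u\<in>V. \<Sum>v\<in>V. d' u v * x u * y v)
    = (\<Sum>u\<in>V. \<Sum>v\<in>V. d u v * x u * y v + (s u * x u) * (g v * y v) + (g u * x u) * (s v * y v))"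
    using assms by (intro sum.cong) (auto simp: algebra_simps)
  then show ?thesis by (simp add: sum.distrib sum_product)
qed

lemma (in htree) branch_sepd_add:
  assumes "H \<subseteq> E" "\<And>e. e \<in> H \<Longrightarrow> sim e x y" "y \<in> V" "p \<in> branch H x"
  shows "sepd E p y = sepd E p x + sepd E x y"
proof -
  obtain e where "e \<in> H" "x \<in> e" "\<not> sim e x p" "p \<in> V" using assms(4) by (auto simp: branch_def)
  then show ?thesis using assms by (intro sepd_add[of e]) auto
qed

section \<open>The change of the quadratic form under an exchange\<close>

context exchange
begin

definition "shift v = rd E b v - rd E a v"
definition "sgnw u = (if u \<in> P then 1 else if u \<in> Q then -1 else 0 :: real)"
definition "corew v = (if v \<in> P \<union> Q then 0 else shift v)"

text \<open>Pairs inside the moved parts and pairs inside the core keep their distance, and a mixed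
  pair changes by plus or minus \<open>shift\<close>; hence the product form, which makes the gain
  of an exchange factor.\<close>

lemma rd_E':
  assumes "u \<in> V" "v \<in> V"
  shows "rd E' u v = rd E u v + sgnw u * corew v + corew u * sgnw v"
proof -
  have PQ: "rd E' u v = rd E u v + sgnw u * shift v" if "u \<in> P \<union> Q" "v \<in> V - P - Q" for u v
    using that sepd_P[of u v] sepd_Q[of u v] disj by (auto simp: sgnw_def shift_def)
  consider "u \<in> P \<union> Q" "v \<in> P \<union> Q" | "u \<in> P \<union> Q" "v \<in> V - P - Q" | "v \<in> P \<union> Q" "u \<in> V - P - Q"
    | "u \<in> V - P - Q" "v \<in> V - P - Q" using assms by blast
  then show ?thesis
  proof cases
    case 1
    then show ?thesis using sepd_outer by (simp add: corew_def)
  next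
    case 2
    then show ?thesis using PQ[of u v] by (simp add: corew_def sgnw_def)
  next
    case 3
    then show ?thesis using PQ[of v u] sepd_sym[of u v] htree.sepd_sym[OF htree', of u v]
      by (simp add: corew_def sgnw_def)
  next
    case 4
    then show ?thesis using sepd_core[of u v] by (simp add: sgnw_def)
  qed
qed

lemma sum_sgnw: "(\<Sum>u\<in>V. sgnw u * x u) = sum x P - sum x Q"
proof -
  have "(\<Sum>u\<in>V. sgnw u * x u) = (\<Sum>u\<in>V. (if u \<in> P then x u else 0) - (if u \<in> Q then x u else 0))"
    using disj by (intro sum.cong) (auto simp: sgnw_def)
  also have "\<dots> = sum x P - sum x Q"
    using branch_subset by (simp add: sum_subtractf sum.If_cases finV Int_absorb1)
  finally show ?thesis .
qed

lemma sum_corew: "(\<Sum>v\<in>V. corew v * x v) = (\<Sum>v\<in>V - P - Q. shift v * x v)"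
proof -
  have "(\<Sum>v\<in>V - P - Q. shift v * x v) = (\<Sum>v\<in>V. if v \<in> V - P - Q then shift v * x v else 0)"
    using finV by (simp add: sum.If_cases) (rule sum.cong, auto)
  also have "\<dots> = (\<Sum>v\<in>V. corew v * x v)"
    by (intro sum.cong) (auto simp: corew_def)
  finally show ?thesis by simp
qed

lemma gain:
  "qform V (rd E') x = qform V (rd E) x + 2 * (sum x P - sum x Q) * (\<Sum>v\<in>V - P - Q. shift v * x v)"
  unfolding qform_def
  using bilinear_diff[of V "rd E'" "rd E" sgnw corew x x] rd_E' by (simp add: sum_sgnw sum_corew)

text \<open>Relabelling by the transposition lets \<open>a\<close> and \<open>b\<close> travel with
  their branches. The moved parts become \<open>P\<close> with \<open>a\<close> and \<open>Q\<close>
  with \<open>b\<close>, which adds 1 and -1 to \<open>s\<close> there and makes \<open>g\<close>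
  vanish there.\<close>

lemma rd_E'_transpose:
  assumes "u \<in> V" "v \<in> V"
  defines "s \<equiv> \<lambda>w. sgnw w + (if w = a then 1 else 0) - (if w = b then 1 else 0)"
    and "g \<equiv> \<lambda>w. if w = a \<or> w = b then 0 else corew w"
  shows "rd E' (transpose a b u) (transpose a b v) = rd E u v + s u * g v + g u * s v"
proof -
  note sym = sepd_sym htree.sepd_sym[OF htree']
  have core: "sgnw a = 0" "sgnw b = 0" "corew a = rd E a b" "corew b = - rd E a b"
    using notin ab sepd_sym[of a b] by (auto simp: sgnw_def corew_def shift_def)
  have add: "rd E p b = rd E p a + rd E a b" if "p \<in> P" for p
    using branch_sepd_add[OF HE Hab ab(2) that] by simp
  have add': "rd E q a = rd E q b + rd E a b" if "q \<in> Q" for q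
    using branch_sepd_add[OF HE Hba ab(1) that] sepd_sym[of a b] by simp
  have one: "rd E' b v = rd E a v + g v" "rd E' a v = rd E b v - g v" if "v \<in> V" "v \<noteq> a" "v \<noteq> b" for v
    using that rd_E'[of b v] rd_E'[of a v] ab core add[of v] add'[of v] disj
      sepd_sym[of v a] sepd_sym[of v b]
    by (auto simp: g_def corew_def shift_def sgnw_def)
  have both: "rd E' a b = rd E a b" using rd_E'[of a b] ab core by simp
  have zero: "rd E w w = 0" "rd E' w w = 0" for w by (simp_all add: sepd_def)
  consider "u \<in> {a, b}" "v \<in> {a, b}" | "u \<in> {a, b}" "v \<notin> {a, b}" | "v \<in> {a, b}" "u \<notin> {a, b}"
    | "u \<notin> {a, b}" "v \<notin> {a, b}" by blast
  then show ?thesis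
  proof cases
    case 1
    then show ?thesis using both zero sym(1)[of a b] sym(2)[of a b] by (auto simp: g_def)
  next
    case 2
    then show ?thesis using one[of v] assms core ab by (auto simp: s_def g_def)
  next
    case 3
    then show ?thesis using one[of u] assms core ab sym(1)[of u] sym(2)[of u]
      by (auto simp: s_def g_def)
  next
    case 4
    then show ?thesis using rd_E'[OF assms(1,2)] by (auto simp: s_def g_def)
  qed
qed

lemma sum_transpose: "(\<Sum>u\<in>V. h (transpose a b u)) = (\<Sum>u\<in>V. h u)"
proof (rule sum.reindex_bij_betw)
  show "bij_betw (transpose a b) V V"
    using ab by (intro bij_betwI[of _ _ _ "transpose a b"]) (auto simp: transpose_def)
qed

lemma gain_transpose:
  "qform V (rd E') (x \<circ> transpose a b) = qform V (rd E) x
    + 2 * (sum x P + x a - sum x Q - x b) * (\<Sum>v\<in>V - P - Q - {a, b}. shift v * x v)"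
proof -
  let ?t = "transpose a b"
  define s where "s = (\<lambda>w. sgnw w + (if w = a then 1 else 0) - (if w = b then 1 else 0))"
  define g where "g = (\<lambda>w. if w = a \<or> w = b then 0 else corew w)"
  have "qform V (rd E') (x \<circ> ?t) = (\<Sum>u\<in>V. \<Sum>v\<in>V. rd E' (?t u) v * x (?t (?t u)) * x (?t v))"
    unfolding qform_def o_def by (rule sum_transpose[symmetric])
  also have "\<dots> = (\<Sum>u\<in>V. \<Sum>v\<in>V. rd E' (?t u) (?t v) * x (?t (?t u)) * x (?t (?t v)))"
    by (intro sum.cong refl sum_transpose[symmetric])
  also have "\<dots> = (\<Sum>u\<in>V. \<Sum>v\<in>V. rd E' (?t u) (?t v) * x u * x v)" by simp
  also have "\<dots> = qform V (rd E) x + 2 * (\<Sum>u\<in>V. s u * x u) * (\<Sum>v\<in>V. g v * x v)"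
    unfolding qform_def
    using bilinear_diff[of V "\<lambda>u v. rd E' (?t u) (?t v)" "rd E" s g x x] rd_E'_transpose
    by (simp add: s_def g_def)
  also have "(\<Sum>u\<in>V. s u * x u) = (\<Sum>u\<in>V. sgnw u * x u) + (\<Sum>u\<in>V. if u = a then x u else 0)
      - (\<Sum>u\<in>V. if u = b then x u else 0)"
    unfolding sum.distrib[symmetric] sum_subtractf[symmetric]
    by (intro sum.cong) (auto simp: s_def algebra_simps)
  also have "\<dots> = sum x P + x a - sum x Q - x b" using finV ab by (simp add: sum_sgnw)
  also have "(\<Sum>v\<in>V. g v * x v) = (\<Sum>v\<in>V. if v \<in> V - P - Q - {a, b} then shift v * x v else 0)"
    by (intro sum.cong) (auto simp: g_def corew_def)
  also have "\<dots> = (\<Sum>v\<in>V - P - Q - {a, b}. shift v * x v)"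
    using finV by (simp add: sum.If_cases) (rule sum.cong, auto)
  finally show ?thesis .
qed

lemma sqn_transpose: "sqn V (x \<circ> transpose a b) = sqn V x"
  unfolding sqn_def o_def by (rule sum_transpose)

end

section \<open>Moves in an extremal hypertree\<close>

context htree
begin

lemma deg_ge2_iff: "2 \<le> deg E v \<longleftrightarrow> (\<exists>e\<in>E. \<exists>f\<in>E. e \<noteq> f \<and> v \<in> e \<and> v \<in> f)"
proof -
  have "finite {e\<in>E. v \<in> e}" using finE by simp
  then have "card {e\<in>E. v \<in> e} \<le> Suc 0 \<longleftrightarrow> (\<forall>e\<in>{e\<in>E. v \<in> e}. \<forall>f\<in>{e\<in>E. v \<in> e}. e = f)"
    by (rule card_le_Suc0_iff_eq)
  moreover have "2 \<le> deg E v \<longleftrightarrow> \<not> card {e\<in>E. v \<in> e} \<le> Suc 0" unfolding deg_def by linarith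
  ultimately show ?thesis by auto
qed

lemma other_edge:
  assumes "2 \<le> deg E v"
  obtains f where "f \<in> E" "v \<in> f" "f \<noteq> e"
  using assms deg_ge2_iff by metis

lemma edge_inter: "e \<in> E \<Longrightarrow> f \<in> E \<Longrightarrow> e \<noteq> f \<Longrightarrow> u \<in> e \<Longrightarrow> u \<in> f \<Longrightarrow> v \<in> e \<Longrightarrow> v \<in> f \<Longrightarrow> u = v"
  using edge_sep[of e u v] sim_edge[of f e u v] by metis

lemma edge_away:
  assumes "v \<in> V" "s \<in> V" "2 \<le> deg E v"
  obtains h where "h \<in> E" "v \<in> h" "sim h v s"
proof -
  obtain e f where "e \<in> E" "f \<in> E" "e \<noteq> f" "v \<in> e" "v \<in> f" using assms deg_ge2_iff by auto
  then show ?thesis using that branch_disj[of e f v s] assms by metis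
qed

lemma farther:
  assumes "v \<in> V" "s \<in> V" "2 \<le> deg E v"
  obtains v' where "v' \<in> V" "sepd E s v' = sepd E s v + 1" "\<And>e. e \<in> E \<Longrightarrow> \<not> sim e s v \<Longrightarrow> \<not> sim e s v'"
proof -
  obtain h where h: "h \<in> E" "v \<in> h" "sim h v s" using edge_away[OF assms] .
  obtain v' where v': "v' \<in> h" "v' \<noteq> v" using edge_other[OF h(1)] .
  have "sepd E v' s = sepd E v s + 1" using sepd_proj[of h v v' s] h v' assms by auto
  then have "sepd E s v' = sepd E s v + 1" using sepd_sym by metis
  moreover have "\<not> sim e s v'" if e: "e \<in> E" "\<not> sim e s v" for e
  proof -
    have "h \<noteq> e" using e h reach_sym by metis
    then have "sim e v' v" using sim_edge h v' by metis
    then show ?thesis using e reach_trans by metis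
  qed
  moreover have "v' \<in> V" using h v' edge_sub by blast
  ultimately show ?thesis using that by blast
qed

lemma deg_pos: assumes "E \<noteq> {}" "v \<in> V" shows "1 \<le> deg E v"
proof -
  obtain e where e: "e \<in> E" using assms by blast
  obtain u where "u \<in> e" "u \<noteq> v" using edge_other[OF e] .
  then obtain f where "f \<in> E" "v \<in> f" using first_edge[OF assms(2)] edge_sub[OF e] by (metis subsetD)
  then have "0 < card {e\<in>E. v \<in> e}" using finE by (auto simp: card_gt_0_iff)
  then show ?thesis by (simp add: deg_def)
qed

text \<open>Among the vertices beyond \<open>e\<close> take one farthest from \<open>w\<close>; a
  second edge at it would lead to a farther one, still beyond \<open>e\<close>.\<close>

lemma leaf_beyond:
  assumes "e \<in> E" "w \<in> e"
  obtains p where "p \<in> V" "\<not> sim e w p" "deg E p = 1"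
proof -
  let ?S = "{p\<in>V. \<not> sim e w p}"
  have wV: "w \<in> V" using assms edge_sub by blast
  obtain v where "v \<in> e" "v \<noteq> w" using edge_other[OF assms(1)] .
  then have "v \<in> ?S" using edge_sep[of e w v] edge_sub[of e] assms by auto
  then have "Max (sepd E w ` ?S) \<in> sepd E w ` ?S" using finV by (intro Max_in) auto
  then obtain p where p: "p \<in> ?S" "Max (sepd E w ` ?S) = sepd E w p" by (rule imageE)
  have max: "sepd E w q \<le> sepd E w p" if "q \<in> ?S" for q
    unfolding p(2)[symmetric] using that finV by (intro Max_ge) auto
  have "\<not> 2 \<le> deg E p"
  proof
    assume "2 \<le> deg E p"
    then obtain v' where v': "v' \<in> V" "sepd E w v' = sepd E w p + 1" "\<not> sim e w v'"
      using farther[of p w] p(1) wV assms(1) by (metis (no_types, lifting) mem_Collect_eq)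
    then show False using max[of v'] by simp
  qed
  then show ?thesis using that p(1) deg_pos[of p] assms(1) by force
qed

end

section \<open>Competitors of an extremal hypertree\<close>

locale best = htree V E k for V :: "'a set" and E k +
  fixes \<Delta> n :: nat and x :: "'a \<Rightarrow> real"
  assumes D3: "3 \<le> \<Delta>" and n2: "2 \<le> n"
    and maxdeg: "v \<in> V \<Longrightarrow> deg E v \<le> \<Delta>"
    and cardD: "card {v\<in>V. deg E v = \<Delta>} = n"
    and best: "\<And>E2. htree V E2 k \<Longrightarrow> card E2 = card E \<Longrightarrow> (\<And>v. v \<in> V \<Longrightarrow> deg E2 v \<le> \<Delta>) \<Longrightarrow>
      card {v\<in>V. deg E2 v = \<Delta>} = n \<Longrightarrow> dist_spectral_radius V E2 \<le> dist_spectral_radius V E"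
    and perron_x: "is_perron V (rd E) (dist_spectral_radius V E) x"
begin

abbreviation "\<rho> \<equiv> dist_spectral_radius V E"

lemma x_pos: "v \<in> V \<Longrightarrow> 0 < x v"
  using perron_x by (simp add: is_perron_def)

lemma E_ne: "E \<noteq> {}"
proof
  assume "E = {}"
  then have "{v\<in>V. deg E v = \<Delta>} = {}" using D3 by (auto simp: deg_def)
  then show False using cardD n2 by (metis card.empty not_numeral_le_zero)
qed

definition inclass :: "'a set set \<Rightarrow> bool" where
  "inclass E2 \<longleftrightarrow> (\<forall>v\<in>V. deg E2 v \<le> \<Delta>) \<and> card {v\<in>V. deg E2 v = \<Delta>} = n"

text \<open>Only the vertices of degree \<Delta> must correspond under \<open>p\<close>: the
  identity serves when they stay in place, a transposition when the exchange interchanges the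
  degrees of two vertices.\<close>

lemma inclass_bij:
  assumes "bij_betw p V V" "\<And>v. v \<in> V \<Longrightarrow> deg E2 v \<le> \<Delta>"
    and "\<And>v. v \<in> V \<Longrightarrow> deg E2 (p v) = \<Delta> \<longleftrightarrow> deg E v = \<Delta>"
  shows "inclass E2"
proof -
  have "{v\<in>p ` V. deg E2 v = \<Delta>} = p ` {v\<in>V. deg E v = \<Delta>}"
    using assms(3) by auto
  then have "{v\<in>V. deg E2 v = \<Delta>} = p ` {v\<in>V. deg E v = \<Delta>}"
    using assms(1) by (simp add: bij_betw_def)
  then have "card {v\<in>V. deg E2 v = \<Delta>} = n"
    using assms(1) cardD by (metis (no_types, lifting) bij_betw_imp_inj_on card_image inj_on_subset mem_Collect_eq subsetI)
  then show ?thesis using assms(2) by (simp add: inclass_def)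
qed

text \<open>The Rayleigh bound of the competitor holds for every test vector, so the form at
  \<open>y\<close> is at most \<rho> times the squared norm, which is the form at \<open>x\<close>.
  Allowing \<open>y\<close> instead of \<open>x\<close> admits permuted entries.\<close>

lemma no_gain:
  assumes "htree V E2 k" "card E2 = card E" "inclass E2" "sqn V y = sqn V x"
  shows "qform V (rd E2) y \<le> qform V (rd E) x"
proof -
  have "E2 \<noteq> {}" using assms(2) E_ne finE by auto
  then obtain z where "\<And>y. qform V (rd E2) y \<le> dist_spectral_radius V E2 * sqn V y"
    using htree.perron[OF assms(1)] by metis
  then have "qform V (rd E2) y \<le> dist_spectral_radius V E2 * sqn V y" .
  also have "\<dots> \<le> \<rho> * sqn V y"
    using best[OF assms(1,2)] assms(3) sqn_nonneg by (intro mult_right_mono) (auto simp: inclass_def)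
  also have "\<dots> = qform V (rd E) x"
    using perron_x assms(4) by (subst qform_eigen[of V "rd E" x \<rho>]) (auto simp: is_perron_def)
  finally show ?thesis .
qed

lemma sum_pos_branch:
  assumes "H \<subseteq> E" "e \<in> H" "w \<in> e"
  shows "0 < sum x (branch H w)"
proof -
  obtain v where "v \<in> e" "v \<noteq> w" using edge_other[of e] assms by blast
  then have "branch H w \<noteq> {}" using branch_edge assms by blast
  moreover have "finite (branch H w)" using branch_subset finV finite_subset by blast
  ultimately show ?thesis using x_pos branch_subset by (intro sum_pos) auto
qed

lemma x_mono: "A \<subseteq> B \<Longrightarrow> B \<subseteq> V \<Longrightarrow> sum x A \<le> sum x B"
  using x_pos finV finite_subset by (intro sum_mono2) (auto intro: less_imp_le)

lemma x_less:
  assumes "A \<subseteq> B" "B \<subseteq> V" "v \<in> B" "v \<notin> A"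
  shows "sum x A < sum x B"
proof -
  have "sum x A < sum x (insert v A)"
    using assms x_pos finV finite_subset[of A V] by (subst sum.insert) auto
  also have "\<dots> \<le> sum x B" using assms by (intro x_mono) auto
  finally show ?thesis .
qed

lemma exchange_gain:
  assumes "exchange V E k a b H" "inclass (exchange.E' E a b H)"
  shows "(sum x (branch H a) - sum x (branch H b)) *
    (\<Sum>v\<in>V - branch H a - branch H b. (rd E b v - rd E a v) * x v) \<le> 0"
proof -
  interpret ex: exchange V E k a b H by fact
  have "qform V (rd ex.E') x \<le> qform V (rd E) x"
    using no_gain[OF ex.htree' ex.card_E' assms(2)] by simp
  then have "2 * ((sum x ex.P - sum x ex.Q) * (\<Sum>v\<in>V - ex.P - ex.Q. ex.shift v * x v)) \<le> 0"
    by (simp only: ex.gain mult.assoc)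
  then show ?thesis by (simp only: ex.shift_def)
qed

lemma exchange_gain_transpose:
  assumes "exchange V E k a b H" "inclass (exchange.E' E a b H)"
  shows "(sum x (branch H a) + x a - sum x (branch H b) - x b) *
    (\<Sum>v\<in>V - branch H a - branch H b - {a, b}. (rd E b v - rd E a v) * x v) \<le> 0"
proof -
  interpret ex: exchange V E k a b H by fact
  have "qform V (rd ex.E') (x \<circ> transpose a b) \<le> qform V (rd E) x"
    using no_gain[OF ex.htree' ex.card_E' assms(2) ex.sqn_transpose] .
  then have "2 * ((sum x ex.P + x a - sum x ex.Q - x b) *
      (\<Sum>v\<in>V - ex.P - ex.Q - {a, b}. ex.shift v * x v)) \<le> 0"
    by (simp only: ex.gain_transpose mult.assoc)
  then show ?thesis by (simp only: ex.shift_def)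
qed

lemma beyond_exchange:
  assumes "w \<in> V" "p \<in> V" "e \<in> E" "w \<in> e" "\<not> sim e w p" "B \<subseteq> {e\<in>E. w \<in> e} - {e}"
  shows "exchange V E k w p B" "branch B p = {}" "\<And>f. f \<in> B \<Longrightarrow> p \<notin> f"
proof -
  have Bs: "sim f w p" if "f \<in> B" for f
    using that assms branch_disj[of f e w p] by blast
  have "w \<noteq> p" using assms(5) by auto
  then show "exchange V E k w p B" using assms Bs by unfold_locales auto
  show np: "\<And>f. f \<in> B \<Longrightarrow> p \<notin> f"
    using Bs edge_sep[of _ w p] assms(6) \<open>w \<noteq> p\<close> by blast
  show "branch B p = {}" using np by (auto simp: branch_def)
qed

text \<open>The transmission is strictly convex along the path from \<open>p\<close> through \<open>w\<close> to \<open>q\<close>,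
  so a branch hanging at \<open>w\<close> gains by moving to one of the two ends.\<close>

lemma convex_move:
  assumes w: "w \<in> V" and e2: "e2 \<in> E" "w \<in> e2" and e3: "e3 \<in> E" "w \<in> e3" and ne: "e2 \<noteq> e3"
    and p: "p \<in> V" "\<not> sim e2 w p" and q: "q \<in> V" "\<not> sim e3 w q"
    and B: "B \<subseteq> {e\<in>E. w \<in> e} - {e2, e3}" "B \<noteq> {}"
    and cp: "inclass (exchange.E' E w p B)" and cq: "inclass (exchange.E' E w q B)"
  shows False
proof -
  have B2: "B \<subseteq> {e\<in>E. w \<in> e} - {e2}" and B3: "B \<subseteq> {e\<in>E. w \<in> e} - {e3}"
    using B(1) by auto
  note xp = beyond_exchange(1,2)[OF w p(1) e2 p(2) B2]
  note xq = beyond_exchange(1,2)[OF w q(1) e3 q(2) B3]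
  let ?C = "V - branch B w"
  define S where "S y = (\<Sum>v\<in>?C. (rd E y v - rd E w v) * x v)" for y
  obtain e where "e \<in> B" using B by blast
  then have pos: "0 < sum x (branch B w)" using sum_pos_branch[of B e w] B(1) by blast
  have Sp: "S p \<le> 0" and Sq: "S q \<le> 0"
    using exchange_gain[OF xp(1) cp] exchange_gain[OF xq(1) cq] xp(2) xq(2) pos
    by (simp_all add: S_def mult_le_0_iff)
  let ?A = "rd E w p" and ?B = "rd E w q"
  have "w \<noteq> p" "w \<noteq> q" using p q by auto
  then have AB: "0 < ?A" "0 < ?B" using sepd_pos w p q by auto
  \<comment> \<open>Each shift is weighted by the distance from \<open>w\<close> to the other end.
    Every vertex gains the full distance towards one end, and the triangle inequality bounds the
    loss towards the other, so \<open>t\<close> is nonnegative; at \<open>w\<close> it equals 2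
    d(w,p) d(w,q).\<close>
  define t where "t v = ?B * (rd E p v - rd E w v) + ?A * (rd E q v - rd E w v)" for v
  have t0: "0 \<le> t v" if v: "v \<in> V" for v
  proof (cases "sim e2 w v")
    case True
    then have "rd E p v = ?A + rd E w v"
      using sepd_add[OF e2 p(1) v p(2) True] sepd_sym[of p w] by simp
    moreover have "rd E w v \<le> ?B + rd E q v" using sepd_triangle[of w v q] by linarith
    then have "?A * (- ?B) \<le> ?A * (rd E q v - rd E w v)" by (intro mult_left_mono) auto
    ultimately show ?thesis unfolding t_def by (simp add: algebra_simps)
  next
    case False
    then have s3: "sim e3 w v" using branch_disj[of e3 e2 w v] ne e2 e3 v by auto
    then have "rd E q v = ?B + rd E w v"
      using sepd_add[OF e3 q(1) v q(2) s3] sepd_sym[of q w] by simp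
    moreover have "rd E w v \<le> ?A + rd E p v" using sepd_triangle[of w v p] by linarith
    then have "?B * (- ?A) \<le> ?B * (rd E p v - rd E w v)" by (intro mult_left_mono) auto
    ultimately show ?thesis unfolding t_def by (simp add: algebra_simps)
  qed
  have "t w = 2 * ?A * ?B" using sepd_sym[of p w] sepd_sym[of q w] by (simp add: t_def)
  then have "0 < (\<Sum>v\<in>?C. t v * x v)"
    by (intro sum_pos2[of ?C w])
      (use AB w x_pos[OF w] x_pos t0 branch_root finV in \<open>auto simp: less_imp_le\<close>)
  also have "\<dots> = ?B * S p + ?A * S q"
    unfolding S_def t_def sum_distrib_left sum.distrib[symmetric]
    by (intro sum.cong) (auto simp: algebra_simps)
  also have "\<dots> \<le> 0" using Sp Sq AB by (simp add: add_nonpos_nonpos mult_nonneg_nonpos)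
  finally show False by simp
qed

lemma transpose_bij: "a \<in> V \<Longrightarrow> b \<in> V \<Longrightarrow> bij_betw (transpose a b) V V"
  by (intro bij_betwI[of _ _ _ "transpose a b"]) (auto simp: transpose_def)

text \<open>Otherwise one edge at \<open>w\<close> could move to a leaf beyond either of two others:
  \<open>w\<close> stays below \<Delta> and the leaf gets degree 2, so the vertices of degree
  \<Delta> remain the same.\<close>

lemma deg_2_or_D:
  assumes w: "w \<in> V" "2 \<le> deg E w"
  shows "deg E w = 2 \<or> deg E w = \<Delta>"
proof (rule ccontr)
  assume n: "\<not> (deg E w = 2 \<or> deg E w = \<Delta>)"
  then have "3 \<le> card {e\<in>E. w \<in> e}" using w by (simp add: deg_def)
  then obtain e1 e2 e3 where e: "e1 \<in> E" "w \<in> e1" "e2 \<in> E" "w \<in> e2" "e3 \<in> E" "w \<in> e3"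
    "e1 \<noteq> e2" "e1 \<noteq> e3" "e2 \<noteq> e3"
    by (auto simp: card_le_Suc_iff numeral_3_eq_3)
  have cls: "inclass (exchange.E' E w p {e1})"
    if g: "g \<in> E" "w \<in> g" "g \<noteq> e1" and p: "p \<in> V" "\<not> sim g w p" "deg E p = 1" for p g
  proof -
    have ex: "exchange V E k w p {e1}" and pe: "p \<notin> e1"
      using beyond_exchange[OF w(1) p(1) g(1,2) p(2), of "{e1}"] g e by auto
    interpret ex: exchange V E k w p "{e1}" by (rule ex)
    have "{e \<in> {e1}. p \<in> e} = {}" "{e \<in> {e1}. w \<in> e} = {e1}" "{e\<in>E - {e1}. p \<in> e} = {e\<in>E. p \<in> e}"
      "{e\<in>E - {e1}. w \<in> e} = {e\<in>E. w \<in> e} - {e1}" using pe e by auto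
    then have "deg ex.E' w = deg E w - 1" "deg ex.E' p = 2"
      using ex.deg_E'(2,3) p(3) e by (simp_all add: deg_def)
    moreover have "deg ex.E' v = deg E v" if "v \<noteq> w" "v \<noteq> p" for v using ex.deg_E'(1) that by simp
    ultimately have "deg ex.E' v \<le> \<Delta> \<and> (deg ex.E' v = \<Delta> \<longleftrightarrow> deg E v = \<Delta>)" if "v \<in> V" for v
      using that maxdeg[of v] D3 p(3) maxdeg[OF w(1)] w(2) n by (cases "v = w"; cases "v = p") auto
    then show ?thesis by (intro inclass_bij[of id]) auto
  qed
  obtain p where p: "p \<in> V" "\<not> sim e2 w p" "deg E p = 1" using leaf_beyond e by metis
  obtain q where q: "q \<in> V" "\<not> sim e3 w q" "deg E q = 1" using leaf_beyond e by metis
  show False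
    using convex_move[OF w(1) e(3-6) e(9) p(1,2) q(1,2), of "{e1}"] cls e p q by auto
qed

text \<open>Moving all \<Delta> - 2 further edges from \<open>w\<close> to \<open>p\<close> or to
  \<open>q\<close> interchanges the degrees \<Delta> and 2.\<close>

lemma no_2_around_D:
  assumes w: "w \<in> V" "deg E w = \<Delta>" and e: "e2 \<in> E" "w \<in> e2" "e3 \<in> E" "w \<in> e3" "e2 \<noteq> e3"
    and p: "p \<in> V" "\<not> sim e2 w p" "deg E p = 2" and q: "q \<in> V" "\<not> sim e3 w q" "deg E q = 2"
  shows False
proof -
  define B where "B = {e\<in>E. w \<in> e} - {e2, e3}"
  have "card B = \<Delta> - 2"
    unfolding B_def using w e finE by (subst card_Diff_subset) (auto simp: deg_def)
  then have cB: "card B = \<Delta> - 2" "B \<noteq> {}" using D3 by auto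
  have cls: "inclass (exchange.E' E w p B)"
    if g: "g \<in> {e2, e3}" and p: "p \<in> V" "\<not> sim g w p" "deg E p = 2" for p g
  proof -
    have ex: "exchange V E k w p B" and pe: "\<And>f. f \<in> B \<Longrightarrow> p \<notin> f"
      using beyond_exchange[OF w(1) p(1) _ _ p(2), of B] g e by (auto simp: B_def)
    interpret ex: exchange V E k w p B by (rule ex)
    have "card {e \<in> B. p \<in> e} = 0" "{e\<in>E - B. p \<in> e} = {e\<in>E. p \<in> e}"
      using pe by (auto simp: card_eq_0_iff)
    moreover have "{e \<in> B. w \<in> e} = B" "{e\<in>E - B. w \<in> e} = {e2, e3}" using e by (auto simp: B_def)
    ultimately have d: "deg ex.E' w = 2" "deg ex.E' p = \<Delta>"
      unfolding ex.deg_E'(2,3) using p(3) e cB D3 by (simp_all add: deg_def)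
    moreover have "deg ex.E' v = deg E v" if "v \<noteq> w" "v \<noteq> p" for v using ex.deg_E'(1) that by simp
    ultimately have "deg ex.E' (transpose w p v) = deg E v" for v
      using w p by (auto simp: transpose_def)
    moreover have "deg ex.E' v \<le> \<Delta>" if "v \<in> V" for v
      using d maxdeg[OF that] ex.deg_E'(1)[of v] D3 by (cases "v = w"; cases "v = p") auto
    ultimately show ?thesis
      using w p by (intro inclass_bij[OF transpose_bij[of w p]]) auto
  qed
  have BB: "B \<subseteq> {e\<in>E. w \<in> e} - {e2, e3}" by (simp add: B_def)
  show False
    using convex_move[OF w(1) e p(1,2) q(1,2) BB cB(2)] cls p q by blast
qed

text \<open>Exchange \<open>e3\<close> at \<open>w\<close> with another edge \<open>f\<close> at
  \<open>v1\<close>; all degrees stay. The branch on \<open>e3\<close> outweighs the one on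
  \<open>f\<close>, a proper part of the lightest branch. Going from \<open>w\<close> to
  \<open>v1\<close> adds 1 to the distance from \<open>w\<close> and from the branch on
  \<open>e2\<close>, and loses at most 1 inside the branch on \<open>e1\<close>, so the sum over the
  core is at least x(w) plus the weight of the second branch minus that of the first.\<close>

lemma three_edges:
  assumes e: "e1 \<in> E" "w \<in> e1" "e2 \<in> E" "w \<in> e2" "e3 \<in> E" "w \<in> e3"
      "e1 \<noteq> e2" "e1 \<noteq> e3" "e2 \<noteq> e3"
    and v1: "v1 \<in> e1" "v1 \<noteq> w" "2 \<le> deg E v1"
    and le: "sum x (branch {e1} w) \<le> sum x (branch {e2} w)" "sum x (branch {e1} w) \<le> sum x (branch {e3} w)"
  shows False
proof -
  have V: "w \<in> V" "v1 \<in> V" using e v1 edge_sub by blast+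
  obtain f where f: "f \<in> E" "v1 \<in> f" "f \<noteq> e1" using other_edge[OF v1(3)] .
  have wf: "w \<notin> f" using edge_inter[of e1 f w v1] f e v1 by auto
  have v3: "v1 \<notin> e3" "v1 \<notin> e2"
    using edge_inter[OF e(1,5,8,2,6) v1(1)] edge_inter[OF e(1,3,7,2,4) v1(1)] v1(2) by blast+
  have f3: "f \<noteq> e3" using wf e by auto
  have s1: "sim e w v1" if "e \<noteq> e1" for e using sim_edge[of e1 e w v1] e v1 that by auto
  have ns1: "\<not> sim e1 w v1" using edge_sep e v1 by metis
  have ex: "exchange V E k w v1 {e3, f}"
    using V v1 e f s1 by unfold_locales auto
  interpret ex: exchange V E k w v1 "{e3, f}" by (rule ex)
  have P: "branch {e3, f} w = branch {e3} w" and Q: "branch {e3, f} v1 = branch {f} v1"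
    using wf v3 by (auto simp: branch_def)
  have "deg ex.E' v = deg E v" for v
  proof -
    have "{e \<in> {e3, f}. v1 \<in> e} = {f}" "{e \<in> {e3, f}. w \<in> e} = {e3}"
      "{e \<in> E - {e3, f}. w \<in> e} = {e\<in>E. w \<in> e} - {e3}" "{e \<in> E - {e3, f}. v1 \<in> e} = {e\<in>E. v1 \<in> e} - {f}"
      using wf v3 f e by auto
    moreover have "card {e\<in>E. w \<in> e} > 0" "card {e\<in>E. v1 \<in> e} > 0"
      using e f finE by (auto simp: card_gt_0_iff)
    ultimately have "deg ex.E' w = deg E w" "deg ex.E' v1 = deg E v1"
      using ex.deg_E'(2,3) e f by (simp_all add: deg_def)
    then show ?thesis using ex.deg_E'(1)[of v] by metis
  qed
  then have "inclass ex.E'" using maxdeg cardD by (simp add: inclass_def)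
  note g = exchange_gain[OF ex this, unfolded P Q]
  let ?C = "V - branch {e3} w - branch {f} v1"
  have fb: "branch {f} v1 \<subseteq> branch {e1} w - {v1}"
  proof
    fix u assume u: "u \<in> branch {f} v1"
    then have "sim e1 v1 u" using branch_disj[of e1 f v1 u] e f v1 by (auto simp: branch_def)
    then have "\<not> sim e1 w u" using ns1 by (meson reach_sym reach_trans)
    then show "u \<in> branch {e1} w - {v1}" using u e by (auto simp: branch_def)
  qed
  have v1b: "v1 \<in> branch {e1} w" using ns1 V e by (auto simp: branch_def)
  have less: "sum x (branch {f} v1) < sum x (branch {e1} w)"
    using fb v1b branch_subset by (intro x_less[of _ _ v1]) auto
  have val: "rd E v1 v - rd E w v = 1" if "v \<in> V" "sim e1 w v" for v
    using sepd_proj[of e1 w v1 v] that e v1 by auto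
  have val': "rd E v1 v - rd E w v \<ge> -1" if "v \<in> V" for v
    using sepd_triangle[of w v v1] sepd_edge[of e1 w v1] e v1 by auto
  have e2b: "branch {e2} w \<subseteq> ?C" "\<And>v. v \<in> branch {e2} w \<Longrightarrow> sim e1 w v"
    using branch_disj[of e3 e2 w] branch_disj[of e1 e2 w] e fb by (auto simp: branch_def)
  have wC: "w \<in> ?C" using V fb by (auto simp: branch_def)
  let ?X = "?C \<inter> branch {e1} w"
  have "x w + sum x (branch {e2} w) - sum x (branch {e1} w) \<le> sum x (insert w (branch {e2} w)) - sum x ?X"
  proof -
    have "sum x ?X \<le> sum x (branch {e1} w)" using branch_subset by (intro x_mono) auto
    moreover have "sum x (insert w (branch {e2} w)) = x w + sum x (branch {e2} w)"
      using finV branch_subset[of "{e2}" w] finite_subset branch_root by (subst sum.insert) blast+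
    ultimately show ?thesis by linarith
  qed
  also have "\<dots> \<le> sum x (?C - branch {e1} w) - sum x ?X"
  proof -
    have "insert w (branch {e2} w) \<subseteq> ?C - branch {e1} w"
      using e2b wC by (auto simp: branch_def)
    then show ?thesis using x_mono[of "insert w (branch {e2} w)" "?C - branch {e1} w"] by auto
  qed
  also have "\<dots> = (\<Sum>v\<in>?C - branch {e1} w. 1 * x v) + (\<Sum>v\<in>?X. -1 * x v)"
    by (simp add: sum_negf)
  also have "\<dots> \<le> (\<Sum>v\<in>?C - branch {e1} w. (rd E v1 v - rd E w v) * x v)
      + (\<Sum>v\<in>?X. (rd E v1 v - rd E w v) * x v)"
  proof (intro add_mono sum_mono mult_right_mono)
    show "1 \<le> rd E v1 v - rd E w v" if "v \<in> ?C - branch {e1} w" for v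
      using val[of v] that e by (auto simp: branch_def)
    show "- 1 \<le> rd E v1 v - rd E w v" if "v \<in> ?X" for v using val'[of v] that by auto
  qed (use x_pos in \<open>auto intro: less_imp_le\<close>)
  also have "\<dots> = (\<Sum>v\<in>?C. (rd E v1 v - rd E w v) * x v)"
    using finV by (subst sum.Int_Diff[of ?C _ "branch {e1} w"]) auto
  finally have "0 < (\<Sum>v\<in>?C. (rd E v1 v - rd E w v) * x v)"
    using le(1) x_pos[OF V(1)] by linarith
  then show False using g le(2) less by (simp add: mult_le_0_iff)
qed

lemma two_nonpendant:
  assumes e: "e1 \<in> E" "w \<in> e1" "e2 \<in> E" "w \<in> e2" "e3 \<in> E" "w \<in> e3"
      "e1 \<noteq> e2" "e1 \<noteq> e3" "e2 \<noteq> e3"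
    and v1: "v1 \<in> e1" "v1 \<noteq> w" "2 \<le> deg E v1"
    and v2: "v2 \<in> e2" "v2 \<noteq> w" "2 \<le> deg E v2"
    and v3: "v3 \<in> e3" "v3 \<noteq> w" "2 \<le> deg E v3"
  shows False
proof -
  let ?M = "\<lambda>e. sum x (branch {e} w)"
  consider "?M e1 \<le> ?M e2" "?M e1 \<le> ?M e3" | "?M e2 \<le> ?M e1" "?M e2 \<le> ?M e3"
    | "?M e3 \<le> ?M e1" "?M e3 \<le> ?M e2" by linarith
  then show False
  proof cases
    case 1 then show False using three_edges[of e1 w e2 e3 v1] e v1 by blast
  next
    case 2 then show False using three_edges[of e2 w e1 e3 v2] e v2 by blast
  next
    case 3 then show False using three_edges[of e3 w e1 e2 v3] e v3 by blast
  qed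
qed

end

section \<open>Extremal hypertrees are caterpillars\<close>

text \<open>Exchanging all edges but \<open>e\<close> and \<open>f\<close>, with the two entries
  swapped as well, interchanges entire sides of \<open>e\<close> and \<open>f\<close>.\<close>

lemma (in htree) branch_all_but:
  assumes "e \<in> E" "f \<in> E" "v \<in> e" "v \<notin> f"
  shows "branch (E - {e, f}) v = {u\<in>V. sim e v u} - {v}"
proof (intro equalityI subsetI)
  fix u assume "u \<in> branch (E - {e, f}) v"
  then obtain h where "h \<in> E" "h \<noteq> e" "v \<in> h" "\<not> sim h v u" "u \<in> V" by (auto simp: branch_def)
  then show "u \<in> {u\<in>V. sim e v u} - {v}" using branch_disj[of e h v u] assms by auto
next
  fix u assume u: "u \<in> {u\<in>V. sim e v u} - {v}"
  then obtain h where h: "h \<in> E" "v \<in> h" "\<not> sim h v u"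
    using first_edge[of v u] edge_sub[OF assms(1)] assms(3) by auto
  then show "u \<in> branch (E - {e, f}) v" using u assms by (auto simp: branch_def)
qed

context best
begin

text \<open>With another edge \<open>f\<close> at \<open>v1\<close> and another vertex
  \<open>z\<close> of \<open>f\<close>, the side of \<open>v3\<close> at \<open>e\<close> changes
  places with the side of \<open>z\<close> at \<open>f\<close>. Only the degrees of
  \<open>v3\<close> and \<open>z\<close> are interchanged. The second side is lighter, being a
  proper part of the lightest side, that of \<open>v1\<close>.\<close>

lemma three_vertices:
  assumes e: "e \<in> E" and v: "v1 \<in> e" "v2 \<in> e" "v3 \<in> e" "v1 \<noteq> v2" "v1 \<noteq> v3" "v2 \<noteq> v3"
    and nl: "2 \<le> deg E v1"
    and le: "sum x {u\<in>V. sim e v1 u} \<le> sum x {u\<in>V. sim e v2 u}"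
      "sum x {u\<in>V. sim e v1 u} \<le> sum x {u\<in>V. sim e v3 u}"
  shows False
proof -
  obtain f where f: "f \<in> E" "v1 \<in> f" "f \<noteq> e" using other_edge[OF nl] .
  obtain z where z: "z \<in> f" "z \<noteq> v1" using edge_other[OF f(1)] .
  have V: "v1 \<in> V" "v2 \<in> V" "v3 \<in> V" "z \<in> V" using e f v z edge_sub by blast+
  have out: "v3 \<notin> f" "z \<notin> e"
    using edge_inter[OF e f(1) f(3)[symmetric] v(1) f(2)] v(3,5) z by blast+
  define H where "H = E - {e, f}"
  have ex: "exchange V E k v3 z H"
  proof unfold_locales
    show "v3 \<in> V" "z \<in> V" "H \<subseteq> E" "v3 \<noteq> z" using V out v by (auto simp: H_def)
    show "sim h v3 z" if "h \<in> H" for h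
      using that sim_edge[of e h v3 v1] sim_edge[of f h v1 z] e f v z reach_trans[of "E - {h}" v3 v1 z]
      by (auto simp: H_def)
  qed
  interpret ex: exchange V E k v3 z H by (rule ex)
  have P: "branch H v3 = {u\<in>V. sim e v3 u} - {v3}"
    unfolding H_def using branch_all_but[OF e f(1) v(3)] out by blast
  have Q: "branch H z = {u\<in>V. sim f z u} - {z}"
    unfolding H_def using branch_all_but[OF f(1) e z(1)] out by (simp add: insert_commute)
  have same: "deg ex.E' (transpose v3 z w) = deg E w" for w
  proof -
    have "{h\<in>E - H. v3 \<in> h} = {e}" "{h\<in>E - H. z \<in> h} = {f}"
      "{h\<in>H. v3 \<in> h} = {h\<in>E. v3 \<in> h} - {e}" "{h\<in>H. z \<in> h} = {h\<in>E. z \<in> h} - {f}"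
      using e f v z out by (auto simp: H_def)
    moreover have "card {h\<in>E. v3 \<in> h} > 0" "card {h\<in>E. z \<in> h} > 0"
      using e f v z finE by (auto simp: card_gt_0_iff)
    ultimately have "deg ex.E' v3 = deg E z" "deg ex.E' z = deg E v3"
      unfolding ex.deg_E'(2,3) using e f v z finE by (simp_all add: deg_def)
    then show ?thesis using ex.deg_E'(1)[of w] by (auto simp: transpose_def)
  qed
  have "inclass ex.E'"
  proof (rule inclass_bij[OF transpose_bij[OF V(3,4)]])
    show "deg ex.E' w \<le> \<Delta>" if "w \<in> V" for w
      using same[of "transpose v3 z w"] maxdeg[of "transpose v3 z w"] V that
      by (simp add: transpose_def split: if_splits)
  qed (simp add: same)
  note g = exchange_gain_transpose[OF ex this]
  let ?K = "\<lambda>v. {u\<in>V. sim e v u}" and ?L = "{u\<in>V. sim f z u}"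
  let ?C = "V - ?K v3 - ?L"
  have "V - branch H v3 - branch H z - {v3, z} = ?C" unfolding P Q using V by auto
  moreover have "sum x (branch H v3) + x v3 = sum x (?K v3)"
    unfolding P using finV V by (subst sum.remove[of "?K v3" v3]) auto
  moreover have "sum x (branch H z) + x z = sum x ?L"
    unfolding Q using finV V by (subst sum.remove[of ?L z]) auto
  ultimately have g': "(sum x (?K v3) - sum x ?L) * (\<Sum>c\<in>?C. (rd E z c - rd E v3 c) * x c) \<le> 0"
    using g by (simp add: algebra_simps)
  have ns: "\<not> sim e v1 v2" "\<not> sim e v1 v3" "\<not> sim e v2 v3" "\<not> sim f v1 z"
    using edge_sep[OF e] edge_sep[OF f(1)] v f z by blast+
  have fe: "sim e v1 c" if "c \<in> V" "\<not> sim f v1 c" for c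
    using branch_disj[OF e f(1) f(3)[symmetric] v(1) f(2)] that by blast
  have eq: "sim e a c \<Longrightarrow> sim e b c \<Longrightarrow> sim e a b" for a b c using reach_sym reach_trans by metis
  have Lf: "\<not> sim f v1 c" if "c \<in> ?L" for c using that ns(4) reach_sym reach_trans by (metis (lifting) mem_Collect_eq)
  let ?F = "{c\<in>V. \<not> sim f v1 c}"
  have F: "?F \<subseteq> ?K v1 - {v1}" using fe by auto
  have v1K: "v1 \<in> ?K v1" using V by simp
  have Fless: "sum x ?F < sum x (?K v1)"
    using F V by (intro x_less[OF _ _ v1K]) auto
  have "sum x ?L \<le> sum x ?F" using Lf by (intro x_mono) auto
  then have pos: "0 < sum x (?K v3) - sum x ?L" using Fless le(2) by linarith
  \<comment> \<open>A lower bound for the gain at a core vertex: 1 off the side of \<open>v1\<close>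
    at \<open>e\<close>, -1 beyond \<open>f\<close>, 0 elsewhere. The side of \<open>v2\<close>
    collects 1 and outweighs all that lies beyond \<open>f\<close>.\<close>
  let ?one = "\<lambda>c. (if sim e v1 c then 0 else 1) - (if sim f v1 c then 0 else 1 :: real)"
  have val: "?one c \<le> rd E z c - rd E v3 c" if c: "c \<in> ?C" for c
  proof -
    have cV: "c \<in> V" "\<not> sim e v3 c" using c by auto
    show ?thesis
    proof (cases "sim e v1 c")
      case True
      have "rd E v3 c = rd E v1 c + 1" using sepd_proj[OF e v(1,3,5) cV(1) True] by simp
      moreover have "rd E z c = rd E v1 c + 1" if "sim f v1 c"
        using sepd_proj[OF f(1,2) z(1) z(2)[symmetric] cV(1) that] by simp
      moreover have "rd E z c = rd E v1 c" if "\<not> sim f v1 c"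
      proof -
        have u: "proj f c \<in> f" "sim f (proj f c) c" using proj[OF f(1) cV(1)] by auto
        then have "proj f c \<noteq> v1" "proj f c \<noteq> z" using that c by auto
        then show ?thesis
          using sepd_proj[OF f(1) u(1) f(2) _ cV(1) u(2)] sepd_proj[OF f(1) u(1) z(1) _ cV(1) u(2)]
          by simp
      qed
      ultimately show ?thesis using True by (cases "sim f v1 c") auto
    next
      case False
      have u: "proj e c \<in> e" "sim e (proj e c) c" using proj[OF e cV(1)] by auto
      then have "proj e c \<noteq> v1" "proj e c \<noteq> v3" using False cV by auto
      then have "rd E v1 c = rd E v3 c"
        using sepd_proj[OF e u(1) v(1) _ cV(1) u(2)] sepd_proj[OF e u(1) v(3) _ cV(1) u(2)] by simp
      moreover have s: "sim f v1 c" using fe[OF cV(1)] False by blast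
      then have "rd E z c = rd E v1 c + 1"
        using sepd_proj[OF f(1,2) z(1) z(2)[symmetric] cV(1)] by simp
      ultimately show ?thesis using False s by simp
    qed
  qed
  have sub: "?K v2 \<subseteq> ?C - ?K v1"
  proof
    fix c assume c: "c \<in> ?K v2"
    then have cV: "c \<in> V" "sim e v2 c" by auto
    have "\<not> sim e v1 c" "\<not> sim e v3 c" using ns eq[OF _ cV(2)] eq[OF cV(2)] by blast+
    moreover have "c \<notin> ?L" using Lf[of c] fe[OF cV(1)] calculation(1) by blast
    ultimately show "c \<in> ?C - ?K v1" using cV by simp
  qed
  have "sum x (?K v2) - sum x ?F \<le> sum x (?C - ?K v1) - sum x (?C \<inter> ?F)"
    using x_mono[OF sub] x_mono[of "?C \<inter> ?F" ?F] by fastforce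
  also have "\<dots> = (\<Sum>c\<in>?C. if c \<in> ?C - ?K v1 then x c else 0) - (\<Sum>c\<in>?C. if c \<in> ?F then x c else 0)"
    using finV by (simp add: sum.If_cases) (intro arg_cong2[where f = "(-)"] sum.cong; auto)
  also have "\<dots> = (\<Sum>c\<in>?C. ?one c * x c)"
    unfolding sum_subtractf[symmetric] by (intro sum.cong) auto
  also have "\<dots> \<le> (\<Sum>c\<in>?C. (rd E z c - rd E v3 c) * x c)"
    by (intro sum_mono mult_right_mono val) (use x_pos in \<open>auto simp: less_imp_le\<close>)
  finally have "0 < (\<Sum>c\<in>?C. (rd E z c - rd E v3 c) * x c)" using Fless le(1) by linarith
  then show False using g' pos by (simp add: mult_le_0_iff)
qed

lemma two_nonleaf:
  assumes e: "e \<in> E" and v: "v1 \<in> e" "v2 \<in> e" "v3 \<in> e" "v1 \<noteq> v2" "v1 \<noteq> v3" "v2 \<noteq> v3"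
    and nl: "2 \<le> deg E v1" "2 \<le> deg E v2" "2 \<le> deg E v3"
  shows False
proof -
  let ?X = "\<lambda>v. sum x {u\<in>V. sim e v u}"
  consider "?X v1 \<le> ?X v2" "?X v1 \<le> ?X v3" | "?X v2 \<le> ?X v1" "?X v2 \<le> ?X v3"
    | "?X v3 \<le> ?X v1" "?X v3 \<le> ?X v2" by linarith
  then show False
  proof cases
    case 1 then show False using three_vertices[of e v1 v2 v3] e v nl by blast
  next
    case 2 then show False using three_vertices[of e v2 v1 v3] e v nl by blast
  next
    case 3 then show False using three_vertices[of e v3 v1 v2] e v nl by blast
  qed
qed

end

section \<open>Spines and caterpillars\<close>

locale spine = htree V E k for V :: "'a set" and E k +
  fixes L :: nat and u :: "nat \<Rightarrow> 'a" and g :: "nat \<Rightarrow> 'a set"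
  assumes g_E: "i < L \<Longrightarrow> g i \<in> E"
    and u_g: "i < L \<Longrightarrow> u i \<in> g i" "i < L \<Longrightarrow> u (Suc i) \<in> g i"
    and u_step: "i < L \<Longrightarrow> u i \<noteq> u (Suc i)"
    and g_inj: "inj_on g {..<L}"
    and L2: "2 \<le> L"
begin

lemma g_eq: "i < L \<Longrightarrow> j < L \<Longrightarrow> g i = g j \<longleftrightarrow> i = j"
  using g_inj by (auto simp: inj_on_def)

lemma u_V: assumes "i \<le> L" shows "u i \<in> V"
proof (cases "i = L")
  case True
  then show ?thesis using L2 u_g(2)[of "L - 1"] edge_sub[OF g_E[of "L - 1"]] by auto
next
  case False
  then show ?thesis using assms u_g(1)[of i] edge_sub[OF g_E[of i]] by auto
qed

lemma spine_sim:
  assumes "i \<le> j" "j \<le> L" "\<And>l. i \<le> l \<Longrightarrow> l < j \<Longrightarrow> g l \<noteq> h"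
  shows "sim h (u i) (u j)"
  using assms
proof (induction j rule: dec_induct)
  case (step j)
  then have "sim h (u i) (u j)" by simp
  moreover have "sim h (u j) (u (Suc j))"
    using sim_edge[of "g j" h] g_E u_g step by auto
  ultimately show ?case by (rule reach_trans)
qed simp

text \<open>The stretches of the spine before and after \<open>g l\<close> avoid \<open>g l\<close>,
  so joining their ends without \<open>g l\<close> would join two of its vertices. This also makes
  the spine vertices distinct and the spine a shortest path.\<close>

lemma spine_sep:
  assumes "i \<le> l" "l < j" "j \<le> L"
  shows "\<not> sim (g l) (u i) (u j)"
proof
  assume a: "sim (g l) (u i) (u j)"
  have "sim (g l) (u i) (u l)" by (rule spine_sim) (use assms g_eq in auto)
  moreover have "sim (g l) (u (Suc l)) (u j)" by (rule spine_sim) (use assms g_eq in auto)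
  ultimately have "sim (g l) (u l) (u (Suc l))" using a by (meson reach_sym reach_trans)
  then show False using edge_sep[OF g_E] u_g u_step assms by (metis less_le_trans)
qed

lemma u_less_neq: "i < j \<Longrightarrow> j \<le> L \<Longrightarrow> u i \<noteq> u j"
  using spine_sep[of i i j] by auto

lemma u_inj: "i \<le> L \<Longrightarrow> j \<le> L \<Longrightarrow> u i = u j \<longleftrightarrow> i = j"
  using u_less_neq by (metis linorder_neqE_nat)

lemma spine_sepd: assumes "i \<le> j" "j \<le> L" shows "sepd E (u i) (u j) = j - i"
proof -
  have "{e\<in>E. \<not> sim e (u i) (u j)} = g ` {i..<j}"
    using spine_sim[OF assms] spine_sep[of i _ j] assms g_E by fastforce
  moreover have "inj_on g {i..<j}" using g_inj assms by (auto intro: inj_on_subset)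
  ultimately show ?thesis by (simp add: sepd_def card_image)
qed

lemma deg_spine: assumes "0 < i" "i < L" shows "2 \<le> deg E (u i)"
proof -
  have "g (i - 1) \<in> E" "g i \<in> E" "g (i - 1) \<noteq> g i" "u i \<in> g (i - 1)" "u i \<in> g i"
    using assms g_E u_g(1)[of i] u_g(2)[of "i - 1"] g_eq by auto
  then show ?thesis using deg_ge2_iff by blast
qed

end

locale caterpillar = spine V E k L u g for V :: "'a set" and E k L u g +
  assumes nonleaf: "v \<in> V \<Longrightarrow> 2 \<le> deg E v \<Longrightarrow> \<exists>i. 0 < i \<and> i < L \<and> v = u i"

context best
begin

text \<open>The spine is a path realising the diameter. A non-leaf \<open>y\<close> sharing an edge
  with an interior spine vertex is on the spine: otherwise it is a third non-leaf in a spine edge,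
  or its edge is a third non-pendant edge at a spine vertex, or, near an end, a longer path leads
  through \<open>y\<close>. Induction on the distance from spine vertex 1 reaches all
  non-leaves.\<close>

lemma caterpillar_exists: "\<exists>L u g. caterpillar V E k L u g"
proof -
  have "{v\<in>V. deg E v = \<Delta>} \<noteq> {}" using cardD n2 by (metis card.empty not_numeral_le_zero)
  then obtain w0 where w0: "w0 \<in> V" "deg E w0 = \<Delta>" by blast
  let ?S = "(\<lambda>(a, b). sepd E a b) ` (V \<times> V)"
  have "Max ?S \<in> ?S" using finV w0 by (intro Max_in) auto
  then obtain p q where pq: "p \<in> V" "q \<in> V" "Max ?S = sepd E p q" by auto
  have mx: "sepd E a b \<le> sepd E p q" if "a \<in> V" "b \<in> V" for a b
    unfolding pq(3)[symmetric] using that finV by (intro Max_ge) auto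
  obtain vs es where path: "is_path E p q vs es" using reach_imp_path[OF conn[OF pq(1,2)]] by auto
  define L where "L = length es"
  have Lpq: "L = sepd E p q" using path_length[OF path] by (simp add: L_def)
  have ends: "vs ! 0 = p" "vs ! L = q" using is_path_nth[OF path] by (auto simp: L_def)
  \<comment> \<open>From a non-leaf one more step away from \<open>s\<close> is possible, so it
    cannot realise the diameter.\<close>
  have far: "sepd E s v < L" if h: "2 \<le> deg E v" "v \<in> V" "s \<in> V" for s v
  proof -
    obtain v' where "v' \<in> V" "sepd E s v' = sepd E s v + 1" using farther[OF h(2,3,1)] .
    then show ?thesis using mx[of s v'] h Lpq by simp
  qed
  have L2: "2 \<le> L"
  proof -
    have "\<not> V \<subseteq> {w0}"
    proof
      assume "V \<subseteq> {w0}"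
      then have "{v\<in>V. deg E v = \<Delta>} \<subseteq> {w0}" by auto
      then have "card {v\<in>V. deg E v = \<Delta>} \<le> card {w0}" by (rule card_mono[rotated]) simp
      then show False using cardD n2 by simp
    qed
    then obtain s where s: "s \<in> V" "s \<noteq> w0" by blast
    then have "0 < sepd E s w0" using sepd_pos w0 by blast
    moreover have "sepd E s w0 < L" using far s w0 D3 by simp
    ultimately show ?thesis by linarith
  qed
  interpret sp: spine V E k L "(!) vs" "(!) es"
  proof unfold_locales
    show "inj_on ((!) es) {..<L}" using path by (auto simp: is_path_def L_def inj_on_def nth_eq_iff_index_eq)
  qed (use path L2 in \<open>auto simp: is_path_def L_def\<close>)
  let ?u = "\<lambda>i. vs ! i"
  have adj: "\<exists>j. 0 < j \<and> j < L \<and> y = ?u j"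
    if y: "y \<in> V" "2 \<le> deg E y" and e: "e \<in> E" "y \<in> e" "?u i \<in> e" "y \<noteq> ?u i" and i: "0 < i" "i < L" for y e i
  proof (rule ccontr)
    assume n: "\<not> ?thesis"
    have V0: "?u 0 \<in> V" "?u L \<in> V" using sp.u_V by auto
    have "sepd E (?u 0) (?u L) = L" using sp.spine_sepd[of 0 L] by simp
    then have "y \<noteq> ?u 0" "y \<noteq> ?u L"
      using far[OF y(2,1)] V0 sepd_sym[of "?u 0" "?u L"] by (metis less_irrefl)+
    then have ny: "y \<noteq> ?u j" if "j \<le> L" for j
      using n that by (metis le_neq_implies_less neq0_conv)
    have right: False if h: "h \<in> E" "y \<in> h" "?u 1 \<in> h" "sim h (?u 1) (?u L)" for h
    proof -
      have "sepd E y (?u L) = sepd E (?u 1) (?u L) + 1"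
        using sepd_proj[OF h(1,3,2) _ V0(2) h(4)] ny[of 1] L2 by auto
      also have "\<dots> = L" using sp.spine_sepd[of 1 L] L2 by simp
      finally show False using far[OF y(2,1) V0(2)] sepd_sym[of y] by simp
    qed
    have left: False if h: "h \<in> E" "y \<in> h" "?u (L - 1) \<in> h" "sim h (?u 0) (?u (L - 1))" for h
    proof -
      have "sepd E y (?u 0) = sepd E (?u (L - 1)) (?u 0) + 1"
        using sepd_proj[OF h(1,3,2) _ V0(1) reach_sym[OF h(4)]] ny[of "L - 1"] by auto
      also have "\<dots> = L" using sp.spine_sepd[of 0 "L - 1"] sepd_sym[of "?u 0"] L2 by simp
      finally show False using far[OF y(2,1) V0(1)] sepd_sym[of y] by simp
    qed
    show False
    proof (cases "\<exists>l<L. e = es ! l")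
      case True
      then obtain l where l: "l < L" "e = es ! l" by blast
      consider "l = 0" | "l = L - 1" | "0 < l" "Suc l < L" using l by linarith
      then show False
      proof cases
        case 1
        have "sim e (?u 1) (?u L)"
          by (rule sp.spine_sim) (use l 1 sp.g_eq L2 in auto)
        then show False using right[OF e(1,2)] sp.u_g(2)[of 0] l 1 L2 by auto
      next
        case 2
        have "sim e (?u 0) (?u (L - 1))"
          by (rule sp.spine_sim) (use l 2 sp.g_eq L2 in auto)
        then show False using left[OF e(1,2)] sp.u_g(1)[of "L - 1"] l 2 L2 by auto
      next
        case 3
        then have "2 \<le> deg E (?u l)" "2 \<le> deg E (?u (Suc l))" using sp.deg_spine by auto
        then show False
          using two_nonleaf[of e "?u l" "?u (Suc l)" y] e(1,2) sp.u_g l y(2) ny[of l] ny[of "Suc l"] sp.u_step[of l]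
          by (metis Suc_leI less_imp_le_nat)
      qed
    next
      case False
      then have ne: "es ! l \<noteq> e" if "l < L" for l using that by blast
      have sim: "sim e (?u a) (?u b)" if "a \<le> b" "b \<le> L" for a b
        by (rule sp.spine_sim[OF that]) (use that ne in auto)
      consider "i = 1" | "i = L - 1" | "1 < i" "Suc i < L" using i by linarith
      then show False
      proof cases
        case 1
        then show False using right[OF e(1,2)] e(3) sim[of 1 L] L2 by auto
      next
        case 2
        then show False using left[OF e(1,2)] e(3) sim[of 0 "L - 1"] by auto
      next
        case 3
        have i': "i - 1 < L" "Suc (i - 1) = i" using 3 by auto
        have "es ! (i - 1) \<noteq> es ! i" "es ! (i - 1) \<noteq> e" "es ! i \<noteq> e"
          using sp.g_eq[of "i - 1" i] 3 ne i' i by auto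
        moreover have "?u (i - 1) \<noteq> ?u i" "?u (Suc i) \<noteq> ?u i"
          using sp.u_step[of "i - 1"] sp.u_step[of i] i i' by auto
        moreover have "2 \<le> deg E (?u (i - 1))" "2 \<le> deg E (?u (Suc i))" using sp.deg_spine 3 by auto
        ultimately show False
          using two_nonpendant[of "es ! (i - 1)" "?u i" "es ! i" e "?u (i - 1)" "?u (Suc i)" y]
            sp.g_E[of i] sp.g_E[of "i - 1"] sp.u_g[of i] sp.u_g[of "i - 1"] i i' e y(2) by simp
      qed
    qed
  qed
  have all: "\<exists>i. 0 < i \<and> i < L \<and> y = ?u i" if "y \<in> V" "2 \<le> deg E y" for y
    using that
  proof (induction "sepd E (?u 1) y" arbitrary: y rule: less_induct)
    case less
    have V1: "?u 1 \<in> V" using sp.u_V[of 1] L2 by auto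
    show ?case
    proof (cases "y = ?u 1")
      case True
      then show ?thesis using L2 by (intro exI[of _ 1]) auto
    next
      case False
      then obtain e where e: "e \<in> E" "y \<in> e" "\<not> sim e y (?u 1)"
        using first_edge[OF less.prems(1) V1] by metis
      define v where "v = proj e (?u 1)"
      have v: "v \<in> e" "sim e v (?u 1)" using proj[OF e(1) V1] by (auto simp: v_def)
      have vy: "v \<noteq> y" using v e by auto
      have vV: "v \<in> V" using edge_sub e v by blast
      have "sepd E y (?u 1) = sepd E v (?u 1) + 1" using sepd_proj[OF e(1) v(1) e(2) vy V1 v(2)] .
      then have less1: "sepd E (?u 1) v < sepd E (?u 1) y" using sepd_sym by (metis less_add_one)
      have "2 \<le> deg E v"
      proof (cases "v = ?u 1")
        case True
        then show ?thesis using sp.deg_spine[of 1] L2 by simp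
      next
        case vn: False
        obtain e' where "e' \<in> E" "v \<in> e'" "\<not> sim e' v (?u 1)" using first_edge[OF vV V1] vn by metis
        then show ?thesis using v e deg_ge2_iff by metis
      qed
      then obtain i where "0 < i" "i < L" "v = ?u i" using less.hyps[OF less1 vV] by blast
      then show ?thesis using adj[OF less.prems e(1,2)] v vy by metis
    qed
  qed
  have "caterpillar V E k L ((!) vs) ((!) es)"
    by unfold_locales (use all in blast)
  then show ?thesis by blast
qed

end

section \<open>The Perron vector along the spine of a caterpillar\<close>

text \<open>Here \<open>y i\<close> is the Perron entry at the \<open>i\<close>-th spine vertex, \<open>A i\<close> and \<open>C i\<close> are the weights on the
  two sides of the \<open>i\<close>-th spine edge, \<open>z i\<close> is the entry at its leaves and \<open>s i\<close> the weight of the star at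
  vertex \<open>i\<close>. Once the mirrored difference \<open>D\<close> is negative, the recurrences keep it negative and
  decreasing up to the centre of the spine, where it is antisymmetric.\<close>

lemma reflect_numeric:
  fixes y A C z s :: "nat \<Rightarrow> real" and r \<kappa> S :: real
  assumes r: "0 < r" and \<kappa>: "0 \<le> \<kappa>"
    and E1: "\<And>i. i < L \<Longrightarrow> r * (y (Suc i) - y i) = A i - C i"
    and E2: "\<And>i. i < L \<Longrightarrow> (r + 1) * z i = r * y (Suc i) + C i"
    and E3: "\<And>i. i < L \<Longrightarrow> A i + C i + \<kappa> * z i = S"
    and E4: "\<And>i. Suc i < L \<Longrightarrow> A (Suc i) + C i = S + y (Suc i) + s (Suc i)"
    and E5: "A 0 = y 0" "C (L - 1) = y L"
    and E6: "\<And>i. 0 < i \<Longrightarrow> 2 * i \<le> L \<Longrightarrow> y (L - i) < y i \<Longrightarrow> s (L - i) \<le> s i"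
    and i: "2 * i \<le> L"
  shows "y i \<le> y (L - i)"
proof (rule ccontr)
  assume neg: "\<not> y i \<le> y (L - i)"
  define D where "D j = y (L - j) - y j" for j
  define O' where "O' j = C (L - 1 - j) - A j" for j
  define Z where "Z j = z (L - 1 - j) - z j" for j
  have R1: "r * (D (Suc j) - D j) = 2 * O' j + \<kappa> * Z j" if j: "j < L" for j
  proof -
    have idx: "L - 1 - j < L" "Suc (L - 1 - j) = L - j" using j by auto
    have "r * (y (L - j) - y (L - 1 - j)) = A (L - 1 - j) - C (L - 1 - j)"
      using E1[OF idx(1)] idx(2) by simp
    then show ?thesis
      using E1[OF j] E3[OF j] E3[OF idx(1)] by (simp add: D_def O'_def Z_def algebra_simps)
  qed
  have R2: "(r + 1) * Z j = r * D j + O' j" if j: "j < L" for j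
  proof -
    have idx: "L - 1 - j < L" "Suc (L - 1 - j) = L - j" using j by auto
    show ?thesis using E2[OF idx(1)] E2[OF j] E1[OF j] idx(2)
      by (simp add: D_def O'_def Z_def algebra_simps)
  qed
  have R3: "(r + 1) * Z j = r * D (Suc j) - (O' j + \<kappa> * Z j)" if j: "j < L" for j
    using R1[OF j] R2[OF j] by (simp add: algebra_simps)
  have R4: "O' (Suc j) = O' j + \<kappa> * Z j + D (Suc j) + (s (L - Suc j) - s (Suc j))" if j: "Suc j < L" for j
  proof -
    have idx: "Suc (L - 1 - Suc j) < L" "Suc (L - 1 - Suc j) = L - 1 - j" "L - 1 - j < L"
      using j by auto
    have "A (L - 1 - j) + C (L - 1 - Suc j) = S + y (L - 1 - j) + s (L - 1 - j)"
      using E4[OF idx(1)] idx(2) by simp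
    then show ?thesis
      using E4[OF j] E3[of j] E3[OF idx(3)] j
      by (simp add: O'_def D_def Z_def algebra_simps)
  qed
  have Zneg: "Z j < 0" if "j < L" "D j < 0" "O' j < 0" for j
  proof -
    have "r * D j < 0" using r that by (simp add: mult_pos_neg)
    then have "(r + 1) * Z j < 0" using R2[OF that(1)] that by linarith
    then show ?thesis using r by (simp add: mult_less_0_iff)
  qed
  have next_D: "D (Suc j) < D j" if "j < L" "D j < 0" "O' j < 0" for j
  proof -
    have "\<kappa> * Z j \<le> 0" using \<kappa> Zneg[OF that] by (simp add: mult_nonneg_nonpos)
    then have "r * (D (Suc j) - D j) < 0" using R1[OF that(1)] that by linarith
    then show ?thesis using r by (simp add: mult_less_0_iff)
  qed
  have star: "s (L - j) \<le> s j" if "0 < j" "2 * j \<le> L" "D j < 0" for j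
    using E6[OF that(1,2)] that(3) by (simp add: D_def)
  have negi: "D i < 0" using neg by (simp add: D_def)
  define m where "m = (LEAST j. D j < 0)"
  have m: "D m < 0" "\<And>j. j < m \<Longrightarrow> 0 \<le> D j" "m \<le> i"
  proof -
    show "D m < 0" "m \<le> i" unfolding m_def by (rule LeastI[of "\<lambda>j. D j < 0", OF negi], rule Least_le[of "\<lambda>j. D j < 0", OF negi])
    show "0 \<le> D j" if "j < m" for j using not_less_Least[OF that[unfolded m_def]] by simp
  qed
  have Lpos: "0 < L" using m i by (cases L) (auto simp: D_def)
  have mL: "2 * m \<le> L" "m < L" using m i Lpos by linarith+
  have base: "O' m < 0"
  proof (cases m)
    case 0
    then show ?thesis using m(1) E5 by (simp add: O'_def D_def)
  next
    case (Suc j)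
    have j: "j < L" "Suc j < L" using mL Suc by auto
    have "0 \<le> D j" using m(2) Suc by simp
    then have dec: "2 * O' j + \<kappa> * Z j < 0"
      using R1[OF j(1)] m(1) Suc r mult_pos_neg[of r "D (Suc j) - D j"] by simp
    \<comment> \<open>The sign change gives only 2 O' + \<kappa> Z < 0. Were O' + \<kappa> Z
      nonnegative, \<open>R3\<close> would make Z negative, and 2 (O' + \<kappa> Z) - \<kappa> Z
      would be nonnegative.\<close>
    have I: "O' j + \<kappa> * Z j < 0"
    proof (rule ccontr)
      assume a: "\<not> O' j + \<kappa> * Z j < 0"
      have "r * D (Suc j) < 0" using r m(1) Suc by (simp add: mult_pos_neg)
      then have "(r + 1) * Z j < 0" using R3[OF j(1)] a by linarith
      then have "Z j < 0" using r by (simp add: mult_less_0_iff)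
      then have "\<kappa> * Z j \<le> 0" using \<kappa> by (simp add: mult_nonneg_nonpos)
      then show False using dec a by linarith
    qed
    have "s (L - Suc j) \<le> s (Suc j)" using star[of "Suc j"] mL m(1) Suc by simp
    then show ?thesis using R4[OF j(2)] I m(1) Suc by simp
  qed
  have run: "2 * j \<le> L \<Longrightarrow> D j < 0 \<and> O' j < 0" if "m \<le> j" for j
    using that
  proof (induction j rule: dec_induct)
    case base
    then show ?case using m(1) \<open>O' m < 0\<close> by simp
  next
    case (step j)
    then have IH: "D j < 0" "O' j < 0" and j: "j < L" "Suc j < L" using Lpos by auto
    have "D (Suc j) < 0" using next_D[OF j(1) IH] IH by simp
    moreover have "\<kappa> * Z j \<le> 0" using \<kappa> Zneg[OF j(1) IH] by (simp add: mult_nonneg_nonpos)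
    moreover have "s (L - Suc j) \<le> s (Suc j)" using star[of "Suc j"] step.prems calculation(1) by simp
    ultimately show ?case using R4[OF j(2)] IH by simp
  qed
  \<comment> \<open>At the centre antisymmetry contradicts the decrease: for L = 2c the value
    \<open>D c\<close> is 0, for L = 2c + 1 the values at c and c + 1 are opposite.\<close>
  show False
  proof (cases "even L")
    case True
    then obtain c where "L = 2 * c" by (rule evenE)
    then show False using run[of c] mL by (simp add: D_def)
  next
    case False
    then obtain c where c: "L = 2 * c + 1" by (rule oddE)
    then have "D c < 0" "O' c < 0" using run[of c] mL by auto
    then have "D (Suc c) < D c" using next_D[of c] c by simp
    then show False using \<open>D c < 0\<close> c by (simp add: D_def)
  qed
qed

text \<open>If the slope at \<open>j\<close> is positive it stays positive up to \<open>l\<close>;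
  otherwise it is negative everywhere before \<open>j\<close>.\<close>

lemma strict_convex_less_max:
  fixes y :: "nat \<Rightarrow> real"
  assumes conv: "\<And>i. Suc i < L \<Longrightarrow> y (Suc i) - y i < y (Suc (Suc i)) - y (Suc i)"
    and ijl: "i < j" "j < l" "l \<le> L"
  shows "y j < y i \<or> y j < y l"
proof -
  define d where "d t = y (Suc t) - y t" for t
  have mono: "d t < d t'" if "t < t'" "t' < L" for t t'
    using that
  proof (induction t' rule: less_Suc_induct[of t])
  qed (use conv in \<open>auto simp: d_def\<close>)
  show ?thesis
  proof (cases "0 < d j")
    case True
    have "y j < y t" if "j < t" "t \<le> L" for t
      using that
    proof (induction t rule: less_induct)
      case (less t)
      then obtain t0 where t0: "t = Suc t0" "j \<le> t0" by (cases t) auto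
      have "0 < d t0" using True mono[of j t0] t0 less.prems by (cases "t0 = j") auto
      moreover have "y j \<le> y t0" using less.IH[of t0] t0 less.prems by (cases "t0 = j") auto
      ultimately show ?case using t0 by (simp add: d_def)
    qed
    then show ?thesis using ijl by blast
  next
    case False
    have neg: "d t < 0" if "t < j" for t using mono[of t j] that ijl False by simp
    have "y j < y t" if "t < j" for t
      using that
    proof (induction "j - t" arbitrary: t)
      case (Suc q)
      have "y j \<le> y (Suc t)" using Suc.hyps(1)[of "Suc t"] arg_cong[OF Suc.hyps(2), of "\<lambda>i. i - 1"] Suc.prems by (cases "Suc t = j") auto
      then show ?case using neg[OF Suc.prems] by (simp add: d_def)
    qed simp
    then show ?thesis using ijl by blast
  qed
qed

section \<open>Eigenvector equations at edges and vertices\<close>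

context htree
begin

definition cls :: "'a set \<Rightarrow> 'a \<Rightarrow> 'a set" where
  "cls e v = {c\<in>V. sim e v c}"

lemma eigen_diff:
  assumes "is_perron V (rd E) r x" "a \<in> V" "b \<in> V"
  shows "(\<Sum>c\<in>V. (rd E a c - rd E b c) * x c) = r * (x a - x b)"
  using assms by (simp add: is_perron_def sum_subtractf left_diff_distrib right_diff_distrib)

text \<open>The distances from \<open>c\<close> to \<open>a\<close> and to \<open>b\<close> differ
  only if \<open>c\<close> lies on the side of one of them, and then by 1; so the difference of two
  eigenvector equations compares the weights of two sides.\<close>

lemma eigen_edge:
  assumes p: "is_perron V (rd E) r x" and e: "e \<in> E" "a \<in> e" "b \<in> e" "a \<noteq> b"
  shows "r * (x a - x b) = sum x (cls e b) - sum x (cls e a)"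
proof -
  have V: "a \<in> V" "b \<in> V" using e edge_sub by blast+
  have val: "rd E a c - rd E b c = (if c \<in> cls e b then 1 else 0) - (if c \<in> cls e a then 1 else 0)"
    if c: "c \<in> V" for c
  proof -
    have u: "proj e c \<in> e" "sim e (proj e c) c" using proj[OF e(1) c] by auto
    have iff: "c \<in> cls e w \<longleftrightarrow> proj e c = w" if "w \<in> e" for w
      using proj_unique[OF e(1) c that] u c by (auto simp: cls_def)
    have da: "rd E a c = rd E (proj e c) c + (if proj e c = a then 0 else 1)"
      using sepd_proj[OF e(1) u(1) e(2) _ c u(2)] by simp
    have db: "rd E b c = rd E (proj e c) c + (if proj e c = b then 0 else 1)"
      using sepd_proj[OF e(1) u(1) e(3) _ c u(2)] by simp
    show ?thesis unfolding da db iff[OF e(2)] iff[OF e(3)] using e(4) by simp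
  qed
  have "r * (x a - x b) = (\<Sum>c\<in>V. (rd E a c - rd E b c) * x c)" using eigen_diff[OF p V] by simp
  also have "\<dots> = (\<Sum>c\<in>V. (if c \<in> cls e b then x c else 0) - (if c \<in> cls e a then x c else 0))"
    using val by (intro sum.cong) auto
  also have "\<dots> = sum x (cls e b) - sum x (cls e a)"
    using finV by (simp add: sum_subtractf sum.If_cases cls_def Int_def)
  finally show ?thesis .
qed

lemma edge_partition:
  fixes x :: "'a \<Rightarrow> real"
  assumes "e \<in> E"
  shows "(\<Sum>v\<in>e. sum x (cls e v)) = sum x V"
proof -
  have "(\<Sum>v\<in>e. sum x (cls e v)) = sum x (\<Union>v\<in>e. cls e v)"
  proof (rule sum.UNION_disjoint[symmetric])
    show "\<forall>v\<in>e. \<forall>w\<in>e. v \<noteq> w \<longrightarrow> cls e v \<inter> cls e w = {}"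
      using proj_unique[OF assms] by (auto simp: cls_def)
  qed (use fin_edge assms finV in \<open>auto simp: cls_def\<close>)
  also have "(\<Union>v\<in>e. cls e v) = V" using proj[OF assms] by (auto simp: cls_def)
  finally show ?thesis .
qed

text \<open>Every vertex other than \<open>v\<close> lies beyond exactly one edge at
  \<open>v\<close>.\<close>

lemma vertex_partition:
  fixes x :: "'a \<Rightarrow> real"
  assumes "v \<in> V"
  shows "sum x V - x v = (\<Sum>e\<in>{e\<in>E. v \<in> e}. sum x V - sum x (cls e v))"
proof -
  have "(\<Sum>e\<in>{e\<in>E. v \<in> e}. sum x V - sum x (cls e v)) = (\<Sum>e\<in>{e\<in>E. v \<in> e}. sum x (V - cls e v))"
    using finV by (intro sum.cong refl) (simp add: sum_diff cls_def)
  also have "\<dots> = sum x (\<Union>e\<in>{e\<in>E. v \<in> e}. V - cls e v)"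
  proof (rule sum.UNION_disjoint[symmetric])
    show "\<forall>e\<in>{e\<in>E. v \<in> e}. \<forall>f\<in>{e\<in>E. v \<in> e}. e \<noteq> f \<longrightarrow> (V - cls e v) \<inter> (V - cls f v) = {}"
      using branch_disj[of _ _ v] by (auto simp: cls_def)
  qed (use finE finV in auto)
  also have "(\<Union>e\<in>{e\<in>E. v \<in> e}. V - cls e v) = V - {v}"
  proof (intro equalityI subsetI)
    fix c assume "c \<in> V - {v}"
    then obtain e where "e \<in> E" "v \<in> e" "\<not> sim e v c" using first_edge[OF assms, of c] by blast
    then show "c \<in> (\<Union>e\<in>{e\<in>E. v \<in> e}. V - cls e v)" using \<open>c \<in> V - {v}\<close> by (auto simp: cls_def)
  qed (auto simp: cls_def)
  also have "sum x (V - {v}) = sum x V - x v" using finV assms by (simp add: sum_diff1)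
  finally show ?thesis by simp
qed

lemma leaf_cls:
  fixes x :: "'a \<Rightarrow> real"
  assumes "e \<in> E" "v \<in> e" "\<not> 2 \<le> deg E v"
  shows "sum x (cls e v) = x v"
proof -
  have eq: "{f\<in>E. v \<in> f} = {e}"
  proof (intro equalityI subsetI)
    fix f assume "f \<in> {f\<in>E. v \<in> f}"
    then show "f \<in> {e}" using assms deg_ge2_iff[of v] by blast
  qed (use assms in simp)
  have "v \<in> V" using edge_sub[OF assms(1)] assms(2) by blast
  from vertex_partition[OF this, of x] show ?thesis unfolding eq by simp
qed

end

context caterpillar
begin

lemma end_leaf: "\<not> 2 \<le> deg E (u 0)" "\<not> 2 \<le> deg E (u L)"
  using nonleaf[of "u 0"] nonleaf[of "u L"] u_V u_inj by fastforce+

lemma spine_mem: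
  assumes "i < L" "j \<le> L"
  shows "u j \<in> g i \<longleftrightarrow> j = i \<or> j = Suc i"
proof
  assume m: "u j \<in> g i"
  show "j = i \<or> j = Suc i"
  proof (rule ccontr)
    assume n: "\<not> ?thesis"
    consider "j < i" | "Suc i < j" using n by linarith
    then show False
    proof cases
      case 1
      have "sim (g i) (u j) (u i)" by (rule spine_sim) (use 1 assms g_eq in auto)
      then show False using edge_sep[OF g_E m u_g(1)] assms 1 u_inj[of j i] by simp
    next
      case 2
      have "sim (g i) (u (Suc i)) (u j)" by (rule spine_sim) (use 2 assms g_eq in auto)
      then show False using edge_sep[OF g_E u_g(2) m] assms 2 u_inj[of "Suc i" j] by simp
    qed
  qed
qed (use assms u_g in auto)

text \<open>Meant for 0 < i < L, where exactly two edges at \<open>u i\<close> belong to the spine;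
  by \<open>pend_leaf\<close> the others are pendant.\<close>

definition pend :: "nat \<Rightarrow> 'a set set" where
  "pend i = {e\<in>E. u i \<in> e} - {g (i - 1), g i}"

lemma pend_not_spine: "0 < i \<Longrightarrow> i < L \<Longrightarrow> e \<in> pend i \<Longrightarrow> l < L \<Longrightarrow> e \<noteq> g l"
  using spine_mem[of l i] by (auto simp: pend_def)

lemma card_pend:
  assumes "0 < i" "i < L"
  shows "card (pend i) = deg E (u i) - 2"
proof -
  have "{g (i - 1), g i} \<subseteq> {e\<in>E. u i \<in> e}" using assms g_E u_g(1)[of i] u_g(2)[of "i - 1"] by auto
  moreover have "card {g (i - 1), g i} = 2" using g_eq[of "i - 1" i] assms by auto
  ultimately show ?thesis unfolding pend_def by (simp add: card_Diff_subset deg_def)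
qed

lemma pend_leaf:
  assumes "0 < i" "i < L" "e \<in> pend i" "v \<in> e" "v \<noteq> u i"
  shows "\<not> 2 \<le> deg E v"
proof
  have e: "e \<in> E" "u i \<in> e" using assms by (auto simp: pend_def)
  assume "2 \<le> deg E v"
  then obtain j where j: "0 < j" "j < L" "v = u j" using nonleaf edge_sub e assms by blast
  have ne: "g l \<noteq> e" if "l < L" for l using pend_not_spine[OF assms(1-3) that] by simp
  have sim: "sim e (u a) (u b)" if "a \<le> b" "b \<le> L" for a b
    by (rule spine_sim[OF that]) (use ne that in auto)
  have "sim e (u i) (u j)" using sim[of i j] sim[of j i] j assms
    by (metis le_cases less_imp_le_nat reach_sym)
  then show False using edge_sep[OF e(1) e(2), of v] assms j by auto
qed

lemma edge_leaf:
  assumes "i < L" "v \<in> g i" "v \<noteq> u i" "v \<noteq> u (Suc i)"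
  shows "\<not> 2 \<le> deg E v"
proof
  assume "2 \<le> deg E v"
  then obtain j where "0 < j" "j < L" "v = u j" using nonleaf edge_sub[OF g_E] assms by blast
  then show False using spine_mem[of i j] assms by auto
qed

context
  fixes r :: real and x :: "'a \<Rightarrow> real"
  assumes p: "is_perron V (rd E) r x"
begin

lemma r_pos: "0 < r" and x_pos: "v \<in> V \<Longrightarrow> 0 < x v"
  using p by (auto simp: is_perron_def)

definition "y i = x (u i)"
definition "S = sum x V"
definition "A i = sum x (cls (g i) (u i))"
definition "C i = sum x (cls (g i) (u (Suc i)))"
text \<open>The solution of r (z - y) = C - z, the edge equation for a leaf. A formula instead of a
  chosen leaf also makes sense for k = 2, where the spine edge has no further vertex.\<close>

definition "z i = (r * y (Suc i) + C i) / (r + 1)"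
text \<open>Each pendant edge has k - 1 leaves with a common entry l. Its edge equation is r (l - y)
  = X - l with X = S - (k - 1) l, hence (r + k) l = r y + S.\<close>

definition "s i = real (deg E (u i) - 2) * (real (k - 1) * ((r * y i + S) / (r + real k)))"

lemma S_nonneg: "0 \<le> S"
  unfolding S_def using x_pos by (intro sum_nonneg) (simp add: less_imp_le)

lemma eq1: "i < L \<Longrightarrow> r * (y (Suc i) - y i) = A i - C i"
  using eigen_edge[OF p g_E u_g(2) u_g(1)] u_step[of i] by (simp add: y_def A_def C_def)

lemma eq2: "(r + 1) * z i = r * y (Suc i) + C i"
  using r_pos by (simp add: z_def)

lemma eq3: assumes "i < L" shows "A i + C i + real (k - 2) * z i = S"
proof -
  let ?R = "g i - {u i, u (Suc i)}"
  have leaf: "sum x (cls (g i) v) = z i" if v: "v \<in> ?R" for v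
  proof -
    have vx: "sum x (cls (g i) v) = x v" using leaf_cls[OF g_E[OF assms]] edge_leaf[OF assms] v by simp
    have "r * (x v - y (Suc i)) = C i - x v"
      using eigen_edge[OF p g_E[OF assms], of v "u (Suc i)"] u_g(2)[OF assms] v vx
      by (simp add: y_def C_def)
    then have "(r + 1) * x v = r * y (Suc i) + C i" by (simp add: algebra_simps)
    then have "(r + 1) * x v = (r + 1) * z i" using eq2 by simp
    then show ?thesis using vx r_pos by simp
  qed
  have "S = (\<Sum>v\<in>g i. sum x (cls (g i) v))" using edge_partition[OF g_E[OF assms], of x] by (simp add: S_def)
  also have "\<dots> = (\<Sum>v\<in>?R. sum x (cls (g i) v)) + (\<Sum>v\<in>{u i, u (Suc i)}. sum x (cls (g i) v))"
    using u_g[OF assms] fin_edge[OF g_E[OF assms]] by (intro sum.subset_diff) auto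
  also have "(\<Sum>v\<in>{u i, u (Suc i)}. sum x (cls (g i) v)) = A i + C i"
    using u_step[OF assms] by (simp add: A_def C_def)
  also have "(\<Sum>v\<in>?R. sum x (cls (g i) v)) = real (card ?R) * z i" using leaf by simp
  also have "card ?R = k - 2"
    using u_g[OF assms] u_step[OF assms] edge_card[OF g_E[OF assms]] by (simp add: card_Diff_subset)
  finally show ?thesis by simp
qed

lemma pend_weight:
  assumes i: "0 < i" "i < L" and e: "e \<in> pend i"
  shows "S - sum x (cls e (u i)) = real (k - 1) * ((r * y i + S) / (r + real k))"
proof -
  have eE: "e \<in> E" "u i \<in> e" using e by (auto simp: pend_def)
  let ?X = "sum x (cls e (u i))"
  define l where "l = (r * y i + ?X) / (r + 1)"
  have leaf: "sum x (cls e v) = l" if v: "v \<in> e - {u i}" for v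
  proof -
    have vx: "sum x (cls e v) = x v" using leaf_cls[OF eE(1)] pend_leaf[OF i e] v by simp
    have "r * (x v - y i) = ?X - x v"
      using eigen_edge[OF p eE(1), of v "u i"] eE(2) v vx by (simp add: y_def)
    then have "(r + 1) * x v = r * y i + ?X" by (simp add: algebra_simps)
    also have "\<dots> = (r + 1) * l" using r_pos by (simp add: l_def)
    finally show ?thesis using vx r_pos by simp
  qed
  have "S = (\<Sum>v\<in>e. sum x (cls e v))" using edge_partition[OF eE(1), of x] by (simp add: S_def)
  also have "\<dots> = ?X + (\<Sum>v\<in>e - {u i}. sum x (cls e v))"
    using eE fin_edge by (intro sum.remove) auto
  also have "(\<Sum>v\<in>e - {u i}. sum x (cls e v)) = real (k - 1) * l"
    using leaf eE edge_card[OF eE(1)] by simp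
  finally have S: "S = ?X + real (k - 1) * l" .
  have "(r + 1) * l = r * y i + ?X" using r_pos by (simp add: l_def)
  then have "(r + 1) * l = r * y i + S - real (k - 1) * l" using S by simp
  moreover have "real (k - 1) = real k - 1" using k2 by simp
  ultimately have "(r + real k) * l = r * y i + S" by (simp add: algebra_simps)
  then have "l = (r * y i + S) / (r + real k)" using r_pos by (simp add: field_simps)
  then show ?thesis using S by simp
qed

lemma eq4: assumes "Suc i < L" shows "A (Suc i) + C i = S + y (Suc i) + s (Suc i)"
proof -
  let ?j = "Suc i"
  let ?f = "\<lambda>e. S - sum x (cls e (u ?j))"
  have g: "g i \<in> E" "g ?j \<in> E" "u ?j \<in> g i" "u ?j \<in> g ?j" "g i \<noteq> g ?j"
    using assms g_E u_g g_eq by auto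
  have "S - y ?j = (\<Sum>e\<in>{e\<in>E. u ?j \<in> e}. ?f e)"
    using vertex_partition[of "u ?j" x] u_V[of ?j] assms by (simp add: S_def y_def)
  also have "\<dots> = (\<Sum>e\<in>pend ?j. ?f e) + (\<Sum>e\<in>{g i, g ?j}. ?f e)"
    unfolding pend_def diff_Suc_1 using g finE by (intro sum.subset_diff) auto
  also have "(\<Sum>e\<in>{g i, g ?j}. ?f e) = (S - C i) + (S - A ?j)" using g by (simp add: A_def C_def)
  also have "(\<Sum>e\<in>pend ?j. ?f e) = s ?j"
    using pend_weight[of ?j] card_pend[of ?j] assms by (simp add: s_def)
  finally show ?thesis by simp
qed

lemma eq5: "A 0 = y 0" "C (L - 1) = y L"
proof -
  show "A 0 = y 0"
    unfolding A_def y_def using leaf_cls[OF g_E u_g(1) end_leaf(1)] L2 by simp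
  have "Suc (L - 1) = L" "L - 1 < L" using L2 by auto
  then show "C (L - 1) = y L"
    unfolding C_def y_def using leaf_cls[OF g_E[of "L - 1"] _ end_leaf(2), of x] u_g(2)[of "L - 1"] by simp
qed

lemma ry_nonneg: assumes "i \<le> L" shows "0 < (r * y i + S) / (r + real k)"
  using x_pos[OF u_V[OF assms]] r_pos S_nonneg by (simp add: y_def add_pos_nonneg)

lemma s_nonneg: "i \<le> L \<Longrightarrow> 0 \<le> s i"
  unfolding s_def using ry_nonneg[of i] by (intro mult_nonneg_nonneg) auto

lemma z_nonneg: assumes "i < L" shows "0 \<le> z i"
proof -
  have "0 \<le> C i" unfolding C_def using x_pos by (intro sum_nonneg) (auto simp: cls_def less_imp_le)
  then show ?thesis using x_pos[OF u_V[of "Suc i"]] r_pos assms by (simp add: z_def y_def)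
qed

text \<open>By \<open>eq3\<close> and \<open>eq4\<close>, passing a spine vertex raises A by its
  entry, its star and the leaves of the edge just left, and lowers C by the entry, the star and the
  leaves of the next edge; the slope is (A - C) / r.\<close>

lemma y_convex: assumes "Suc i < L" shows "y (Suc i) - y i < y (Suc (Suc i)) - y (Suc i)"
proof -
  have nn: "0 \<le> real (k - 2) * z i" "0 \<le> real (k - 2) * z (Suc i)" using z_nonneg assms by simp_all
  have pos: "0 < y (Suc i)" using x_pos u_V[of "Suc i"] assms by (simp add: y_def)
  have "A i < A (Suc i)" "C (Suc i) < C i"
    using eq4[OF assms] eq3[of i] eq3[OF assms] nn pos s_nonneg[of "Suc i"] assms by auto
  then have "r * (y (Suc i) - y i) < r * (y (Suc (Suc i)) - y (Suc i))"
    using eq1[of i] eq1[OF assms] assms by simp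
  then show ?thesis using r_pos by simp
qed

text \<open>Where the left entry is larger and the left degree is at least as large, the left star
  is at least as heavy, as \<open>s\<close> grows with both. This is \<open>E6\<close> of
  \<open>reflect_numeric\<close>.\<close>

lemma reflect:
  assumes "\<And>i. 0 < i \<Longrightarrow> 2 * i \<le> L \<Longrightarrow> deg E (u (L - i)) \<le> deg E (u i)" "2 * i \<le> L"
  shows "y i \<le> y (L - i)"
proof (rule reflect_numeric[where y = y and A = A and C = C and z = z and s = s and L = L and r = r
      and \<kappa> = "real (k - 2)" and S = S, OF r_pos _ eq1 eq2 eq3 eq4 eq5])
  fix j assume j: "0 < j" "2 * j \<le> L" "y (L - j) < y j"
  have a: "real (k - 1) * ((r * y (L - j) + S) / (r + real k)) \<le> real (k - 1) * ((r * y j + S) / (r + real k))"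
    using j r_pos by (intro mult_left_mono divide_right_mono) auto
  have b: "real (deg E (u (L - j)) - 2) \<le> real (deg E (u j) - 2)" using assms(1)[OF j(1,2)] by simp
  have c: "0 \<le> real (k - 1) * ((r * y (L - j) + S) / (r + real k))"
    using ry_nonneg[of "L - j"] by (intro mult_nonneg_nonneg) auto
  show "s (L - j) \<le> s j" unfolding s_def by (rule mult_mono[OF b a _ c]) simp
qed (use assms in auto)

text \<open>Convexity puts the entry at \<open>a\<close> below that at \<open>i\<close> or at
  \<open>L - i\<close>, and by reflection the latter is not the smaller one.\<close>

lemma inner_less:
  assumes "\<And>i. 0 < i \<Longrightarrow> 2 * i \<le> L \<Longrightarrow> deg E (u (L - i)) \<le> deg E (u i)"
    and "i < a" "a < L - i"
  shows "x (u a) < x (u (L - i))"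
proof -
  have "y a < y i \<or> y a < y (L - i)"
    by (rule strict_convex_less_max[of L y]) (use y_convex assms in auto)
  moreover have "y i \<le> y (L - i)" using reflect[OF assms(1)] assms(2,3) by auto
  ultimately show ?thesis by (auto simp: y_def)
qed

end

end

section \<open>Balancing the two ends\<close>

context caterpillar
begin

lemma pend_spine_mem:
  assumes "0 < i" "i < L" "e \<in> pend i" "l \<le> L" "u l \<in> e"
  shows "l = i"
proof (rule ccontr)
  assume n: "l \<noteq> i"
  have e: "e \<in> E" "u i \<in> e" using assms by (auto simp: pend_def)
  have ne: "g j \<noteq> e" if "j < L" for j using pend_not_spine[OF assms(1-3) that] by simp
  have sim: "sim e (u a) (u b)" if "a \<le> b" "b \<le> L" for a b
    by (rule spine_sim[OF that]) (use ne that in auto)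
  have "sim e (u i) (u l)" using sim[of i l] sim[of l i] assms
    by (metis le_cases less_imp_le_nat reach_sym)
  moreover have "u i \<noteq> u l" using n u_inj[of i l] assms by auto
  ultimately show False using edge_sep[OF e(1) e(2) assms(5)] by blast
qed

text \<open>The vertex of \<open>e\<close> on the side of \<open>u 1\<close> is a non-leaf, hence an
  interior spine vertex.\<close>

lemma edge_spine_or_pend:
  assumes "e \<in> E" "e \<notin> g ` {..<L}"
  obtains i where "0 < i" "i < L" "e \<in> pend i"
proof -
  have V1: "u 1 \<in> V" using u_V[of 1] L2 by auto
  let ?v = "proj e (u 1)"
  have v: "?v \<in> e" "sim e ?v (u 1)" using proj[OF assms(1) V1] by auto
  have vV: "?v \<in> V" using v edge_sub assms by blast
  have "2 \<le> deg E ?v"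
  proof (cases "?v = u 1")
    case True
    then show ?thesis using deg_spine[of 1] L2 by simp
  next
    case False
    then obtain f where "f \<in> E" "?v \<in> f" "\<not> sim f ?v (u 1)" using first_edge[OF vV V1] by metis
    then show ?thesis using v assms(1) deg_ge2_iff by metis
  qed
  then obtain i where i: "0 < i" "i < L" "?v = u i" using nonleaf[OF vV] by blast
  have "e \<noteq> g i" "e \<noteq> g (i - 1)" using assms(2) i by (auto simp: image_iff)
  then have "e \<in> pend i" using v i assms by (simp add: pend_def)
  then show ?thesis using that i by blast
qed

lemma caterpillar_rev: "caterpillar V E k L (\<lambda>i. u (L - i)) (\<lambda>i. g (L - Suc i))"
proof unfold_locales
  show "g (L - Suc i) \<in> E" if "i < L" for i using that g_E by simp
  show "u (L - i) \<in> g (L - Suc i)" "u (L - Suc i) \<in> g (L - Suc i)" "u (L - i) \<noteq> u (L - Suc i)"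
    if "i < L" for i
    using that u_g[of "L - Suc i"] u_step[of "L - Suc i"] Suc_diff_Suc[of i L] by auto
  show "inj_on (\<lambda>i. g (L - Suc i)) {..<L}"
    using g_eq by (intro inj_onI) (metis Suc_diff_Suc Suc_inject diff_Suc_less diff_diff_cancel lessThan_iff less_imp_le_nat not_less0 neq0_conv)
  show "2 \<le> L" by (rule L2)
  show "\<exists>i>0. i < L \<and> v = u (L - i)" if v: "v \<in> V" "2 \<le> deg E v" for v
  proof -
    obtain i where "0 < i" "i < L" "v = u i" using nonleaf v by blast
    then show ?thesis by (intro exI[of _ "L - i"]) auto
  qed
qed

end

context best
begin

text \<open>The star moves to \<open>u c\<close>, closer to an end of the spine. For
  \<open>x\<close> the sum over the core is \<rho> (x_q - x_p) - x(P) d(p,q), of unclear sign; for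
  the new Perron vector it carries + x'(P) d(p,q) instead. In the mixed form the two corrections
  cancel.\<close>

lemma star_move:
  assumes cat: "caterpillar V E k L u g"
    and ac: "0 < a" "a < c" "c < L" "L - c < a"
    and da: "deg E (u a) = \<Delta>" and dc: "deg E (u c) = 2"
    and T: "\<And>i. 0 < i \<Longrightarrow> 2 * i \<le> L \<Longrightarrow> deg E (u (L - i)) \<le> deg E (u i)"
  defines "d2 \<equiv> \<lambda>i. if i = a then 2 else if i = c then \<Delta> else deg E (u i)"
  assumes T2: "\<And>i. 0 < i \<Longrightarrow> 2 * i \<le> L \<Longrightarrow> d2 (L - i) \<le> d2 i"
  shows False
proof -
  interpret cp: caterpillar V E k L u g by (rule cat)
  let ?p = "u a" and ?q = "u c"
  define H where "H = cp.pend a"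
  have pV: "?p \<in> V" and qV: "?q \<in> V" using cp.u_V ac by auto
  have pq: "?p \<noteq> ?q" using cp.u_less_neq[of a c] ac by auto
  have HE: "H \<subseteq> E" by (auto simp: H_def cp.pend_def)
  have Hg: "g l \<notin> H" if "l < L" for l
    using cp.pend_not_spine[of a "g l" l] that ac unfolding H_def by auto
  have Hsim: "sim e ?p ?q" if "e \<in> H" for e
    by (rule cp.spine_sim) (use Hg that ac in auto)
  interpret ex: exchange V E k ?p ?q H
    using pV qV pq HE Hsim by unfold_locales auto
  let ?E = "ex.E'"
  have qH: "?q \<notin> e" if "e \<in> H" for e
    using edge_sep[of e ?p ?q] Hsim[OF that] that HE pq by (auto simp: H_def cp.pend_def)
  have Q: "branch H ?q = {}" using qH by (auto simp: branch_def)
  have ga: "g (a - 1) \<in> E" "g a \<in> E" "?p \<in> g (a - 1)" "?p \<in> g a" "g (a - 1) \<noteq> g a"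
    using ac cp.g_E cp.u_g(1)[of a] cp.u_g(2)[of "a - 1"] cp.g_eq[of "a - 1" a] by auto
  have sets: "{e\<in>E - H. ?p \<in> e} = {g (a - 1), g a}" "{e\<in>H. ?p \<in> e} = H"
    "{e\<in>E - H. ?q \<in> e} = {e\<in>E. ?q \<in> e}" "card {e\<in>H. ?q \<in> e} = 0"
    using ga qH by (auto simp: H_def cp.pend_def card_eq_0_iff)
  have cH: "card H = \<Delta> - 2" using cp.card_pend[of a] ac da by (simp add: H_def)
  have dp: "deg ?E ?p = 2" "deg ?E ?q = \<Delta>"
    unfolding ex.deg_E'(2,3) sets using ga(5) cH dc D3 by (simp_all add: deg_def)
  have dother: "deg ?E v = deg E v" if "v \<noteq> ?p" "v \<noteq> ?q" for v using ex.deg_E'(1) that by simp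
  have deg2: "deg ?E (u i) = d2 i" if "i \<le> L" for i
    using dp dother[of "u i"] cp.u_inj[of i a] cp.u_inj[of i c] that ac by (auto simp: d2_def)
  have inc: "inclass ?E"
  proof (rule inclass_bij[OF transpose_bij[OF pV qV]])
    show "deg ?E v \<le> \<Delta>" if "v \<in> V" for v
      using dp dother[of v] maxdeg[OF that] D3 by (cases "v = ?p"; cases "v = ?q") auto
    show "deg ?E (transpose ?p ?q v) = \<Delta> \<longleftrightarrow> deg E v = \<Delta>" if "v \<in> V" for v
      using dp dother[of v] da dc by (auto simp: transpose_def)
  qed
  have cat2: "caterpillar V ?E k L u g"
  proof -
    interpret h2: htree V ?E k by (rule ex.htree')
    have gE: "g i \<in> ?E" if "i < L" for i
      using ex.xedge_none[of "g i"] Hg[OF that] cp.g_E[OF that] unfolding ex.E'_def by (metis image_eqI)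
    show ?thesis
    proof unfold_locales
      show "\<exists>i>0. i < L \<and> v = u i" if "v \<in> V" "2 \<le> deg ?E v" for v
      proof (cases "v = ?p \<or> v = ?q")
        case True
        then show ?thesis using ac by (metis less_trans)
      next
        case False
        then show ?thesis using dother[of v] cp.nonleaf that by auto
      qed
    qed (use gE cp.u_g cp.u_step cp.g_inj cp.L2 in auto)
  qed
  have "?E \<noteq> {}" using ex.card_E' E_ne finE by auto
  then obtain x' where x': "is_perron V (rd ?E) (dist_spectral_radius V ?E) x'"
    using htree.perron[OF ex.htree'] by metis
  let ?r = "dist_spectral_radius V ?E"
  have le: "?r \<le> \<rho>"
    using best[OF ex.htree' ex.card_E'] inc by (auto simp: inclass_def)
  \<comment> \<open>The mirror image of \<open>c\<close> is L - c, and L - c < a < c.\<close>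
  have up: "x ?p < x ?q"
    using caterpillar.inner_less[OF cat perron_x T, of "L - c" a] ac by auto
  have up': "x' ?p < x' ?q"
    using caterpillar.inner_less[OF cat2 x', of "L - c" a] deg2 T2 ac by auto
  let ?B = "sum x (branch H ?p)" and ?B' = "sum x' (branch H ?p)" and ?d = "rd E ?p ?q"
  have x'_pos: "0 < x' v" if "v \<in> V" for v using x' that by (simp add: is_perron_def)
  obtain e where eH: "e \<in> H" using cH D3 by (metis card.empty diff_is_0_eq ex_in_conv not_less_eq_eq numeral_2_eq_2 numeral_3_eq_3)
  then have B: "0 < ?B" using sum_pos_branch[OF HE eH] by (auto simp: H_def cp.pend_def)
  have Bne: "branch H ?p \<noteq> {}" using B by auto
  have B': "0 < ?B'"
    using Bne branch_subset[of H ?p] finV finite_subset x'_pos by (intro sum_pos) auto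
  have split: "(\<Sum>v\<in>V. h v) = (\<Sum>v\<in>V - branch H ?p. h v) + (\<Sum>v\<in>branch H ?p. h v)" for h :: "'a \<Rightarrow> real"
    using finV branch_subset by (intro sum.subset_diff) auto
  have core: "(\<Sum>v\<in>V. ex.corew v * y v) = (\<Sum>v\<in>V - branch H ?p. ex.shift v * y v)" for y
    using ex.sum_corew[of y] Q by simp
  have f: "(\<Sum>v\<in>V. ex.corew v * x v) = \<rho> * (x ?q - x ?p) - ?B * ?d"
  proof -
    have "(\<Sum>v\<in>branch H ?p. ex.shift v * x v) = (\<Sum>v\<in>branch H ?p. ?d * x v)"
    proof (intro sum.cong refl)
      fix v assume v: "v \<in> branch H ?p"
      have "sepd E v ?q = sepd E v ?p + sepd E ?p ?q" by (rule branch_sepd_add[OF HE Hsim qV v])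
      then show "ex.shift v * x v = ?d * x v"
        by (simp add: ex.shift_def sepd_sym[of ?q v] sepd_sym[of ?p v])
    qed
    moreover have "(\<Sum>v\<in>V. ex.shift v * x v) = \<rho> * (x ?q - x ?p)"
      using eigen_diff[OF perron_x qV pV] by (simp add: ex.shift_def)
    moreover have "(\<Sum>v\<in>branch H ?p. ?d * x v) = ?d * ?B" by (simp add: sum_distrib_left)
    moreover have "(\<Sum>v\<in>V. ex.corew v * x v)
        = (\<Sum>v\<in>V. ex.shift v * x v) - (\<Sum>v\<in>branch H ?p. ex.shift v * x v)"
      using split[of "\<lambda>v. ex.shift v * x v"] core[of x] by linarith
    ultimately show ?thesis by (simp only: mult.commute[of ?B ?d])
  qed
  have f': "(\<Sum>v\<in>V. ex.corew v * x' v) = ?r * (x' ?q - x' ?p) + ?B' * ?d"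
  proof -
    have w: "ex.sgnw ?p = 0" "ex.sgnw ?q = 0" "ex.corew ?p = ?d" "ex.corew ?q = - ?d"
      using ex.notin sepd_sym[of ?p ?q] by (auto simp: ex.sgnw_def ex.corew_def ex.shift_def)
    have "(rd ?E ?q v - rd ?E ?p v) = ex.shift v - 2 * ?d * (if v \<in> branch H ?p then 1 else 0)" if "v \<in> V" for v
      using ex.rd_E'[OF qV that] ex.rd_E'[OF pV that] w Q by (simp add: ex.sgnw_def ex.shift_def)
    then have "(\<Sum>v\<in>V. (rd ?E ?q v - rd ?E ?p v) * x' v)
      = (\<Sum>v\<in>V. (ex.shift v - 2 * ?d * (if v \<in> branch H ?p then 1 else 0)) * x' v)"
      by (intro sum.cong) auto
    also have "\<dots> = (\<Sum>v\<in>V - branch H ?p. ex.shift v * x' v) + (\<Sum>v\<in>branch H ?p. - ?d * x' v)"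
    proof -
      have "(\<Sum>v\<in>branch H ?p. (ex.shift v - 2 * ?d * (if v \<in> branch H ?p then 1 else 0)) * x' v)
        = (\<Sum>v\<in>branch H ?p. - ?d * x' v)"
      proof (intro sum.cong refl)
        fix v assume v: "v \<in> branch H ?p"
        have "sepd E v ?q = sepd E v ?p + sepd E ?p ?q" by (rule branch_sepd_add[OF HE Hsim qV v])
        then show "(ex.shift v - 2 * ?d * (if v \<in> branch H ?p then 1 else 0)) * x' v = - ?d * x' v"
          using v by (simp add: ex.shift_def sepd_sym[of ?q v] sepd_sym[of ?p v])
      qed
      moreover have "(\<Sum>v\<in>V - branch H ?p. (ex.shift v - 2 * ?d * (if v \<in> branch H ?p then 1 else 0)) * x' v)
        = (\<Sum>v\<in>V - branch H ?p. ex.shift v * x' v)"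
        by (intro sum.cong) auto
      ultimately show ?thesis by (subst split) simp
    qed
    also have "(\<Sum>v\<in>branch H ?p. - ?d * x' v) = - (?d * ?B')" by (simp add: sum_distrib_left sum_negf)
    finally have "(\<Sum>v\<in>V. (rd ?E ?q v - rd ?E ?p v) * x' v)
      = (\<Sum>v\<in>V. ex.corew v * x' v) + - (?d * ?B')" using core[of x'] by (simp only:)
    then show ?thesis using htree.eigen_diff[OF ex.htree' x' qV pV] mult.commute[of ?B' ?d] by linarith
  qed
  let ?xx = "\<Sum>v\<in>V. x v * x' v"
  have "(\<Sum>v\<in>V. \<Sum>w\<in>V. rd ?E v w * x v * x' w) = ?r * ?xx"
  proof -
    have "(\<Sum>v\<in>V. \<Sum>w\<in>V. rd ?E v w * x v * x' w) = (\<Sum>v\<in>V. x v * (\<Sum>w\<in>V. rd ?E v w * x' w))"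
      unfolding sum_distrib_left by (intro sum.cong refl) (simp add: mult_ac)
    also have "\<dots> = (\<Sum>v\<in>V. ?r * (x v * x' v))"
      using x' by (intro sum.cong refl) (simp add: is_perron_def)
    finally show ?thesis by (simp add: sum_distrib_left)
  qed
  moreover have "(\<Sum>v\<in>V. \<Sum>w\<in>V. rd E v w * x v * x' w) = \<rho> * ?xx"
  proof -
    have "(\<Sum>v\<in>V. \<Sum>w\<in>V. rd E v w * x v * x' w) = (\<Sum>w\<in>V. (\<Sum>v\<in>V. rd E w v * x v) * x' w)"
      unfolding sum_distrib_right by (subst sum.swap) (simp add: sepd_sym)
    also have "\<dots> = (\<Sum>w\<in>V. \<rho> * (x w * x' w))"
      using perron_x by (intro sum.cong refl) (simp add: is_perron_def)
    finally show ?thesis by (simp add: sum_distrib_left)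
  qed
  ultimately have "?r * ?xx = \<rho> * ?xx + ?B * (?r * (x' ?q - x' ?p) + ?B' * ?d)
      + (\<rho> * (x ?q - x ?p) - ?B * ?d) * ?B'"
    using bilinear_diff[of V "rd ?E" "rd E" ex.sgnw ex.corew x x'] ex.rd_E'
    by (simp add: ex.sum_sgnw Q f f')
  then have eq: "(\<rho> - ?r) * ?xx + ?B * (?r * (x' ?q - x' ?p)) + \<rho> * (x ?q - x ?p) * ?B' = 0"
    by (simp add: algebra_simps)
  have "0 < ?r" "0 < \<rho>" using x' perron_x by (auto simp: is_perron_def)
  then have "0 < ?B * (?r * (x' ?q - x' ?p))" "0 < \<rho> * (x ?q - x ?p) * ?B'" using B B' up up' by simp_all
  moreover have "0 \<le> ?xx" using x_pos x'_pos by (intro sum_nonneg) (simp add: less_imp_le)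
  then have "0 \<le> (\<rho> - ?r) * ?xx" using le by simp
  ultimately show False using eq by linarith
qed

text \<open>There are p - 1 stars on the left and L - 1 - c on the right. If the bound fails, the
  left has at least two more, so the left degrees dominate their mirror images even after the star
  at p - 1 has moved to c.\<close>

lemma balanced:
  assumes cat: "caterpillar V E k L u g"
    and pc: "0 < p" "p \<le> c" "c < L"
    and D: "\<And>i. 0 < i \<Longrightarrow> i < L \<Longrightarrow> deg E (u i) = (if p \<le> i \<and> i \<le> c then 2 else \<Delta>)"
  shows "p + c \<le> L + 1"
proof (rule ccontr)
  assume n: "\<not> p + c \<le> L + 1"
  let ?d2 = "\<lambda>j. if j = p - 1 then 2 else if j = c then \<Delta> else deg E (u j)"
  have d2: "?d2 j = (if p - 1 \<le> j \<and> j < c then 2 else \<Delta>)" if "0 < j" "j < L" for j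
    using D[OF that] pc by auto
  show False
  proof (rule star_move[OF cat, of "p - 1" c])
    fix i assume i: "0 < i" "2 * i \<le> L"
    then have r: "0 < L - i" "L - i < L" "i < L" "i \<le> L - i" using pc by auto
    show "deg E (u (L - i)) \<le> deg E (u i)"
      using D[OF r(1,2)] D[OF i(1) r(3)] D3 r n pc by auto
    have "p - 1 \<le> i \<and> i < c \<Longrightarrow> p - 1 \<le> L - i \<and> L - i < c" using r n pc by linarith
    then show "?d2 (L - i) \<le> ?d2 i"
      unfolding d2[OF r(1,2)] d2[OF i(1) r(3)] using D3 by simp
  qed (use n pc D[of "p - 1"] D[of c] in auto)
qed

text \<open>By \<open>no_2_around_D\<close> the positions of degree 2 form an interval from p to c;
  \<open>balanced\<close>, applied to the spine and to its reversal, makes the numbers of stars at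
  the two ends differ by at most one.\<close>

lemma extremal_caterpillar:
  "\<exists>L u g. caterpillar V E k L u g \<and>
    (\<forall>i. 0 < i \<longrightarrow> i < L \<longrightarrow> deg E (u i) = (if i \<in> C_attach L (n div 2) ((n + 1) div 2) then \<Delta> else 2))"
proof -
  obtain L u g where cat: "caterpillar V E k L u g" using caterpillar_exists by blast
  interpret cp: caterpillar V E k L u g by (rule cat)
  have deg: "deg E (u i) = 2 \<or> deg E (u i) = \<Delta>" if "0 < i" "i < L" for i
    using deg_2_or_D[of "u i"] cp.deg_spine[OF that] cp.u_V[of i] that by simp
  define I where "I = {i. 0 < i \<and> i < L \<and> deg E (u i) = \<Delta>}"
  have "{v\<in>V. deg E v = \<Delta>} = u ` I"
    using cp.nonleaf D3 cp.u_V by (force simp: I_def)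
  moreover have "inj_on u I" using cp.u_inj by (auto simp: inj_on_def I_def)
  ultimately have cI: "card I = n" using cardD by (simp add: card_image)
  have between: False if h: "0 < i" "i < j" "j < l" "l < L" "deg E (u i) = 2" "deg E (u l) = 2" "deg E (u j) = \<Delta>" for i j l
  proof (rule no_2_around_D[of "u j" "g (j - 1)" "g j" "u i" "u l"])
    show "\<not> sim (g (j - 1)) (u j) (u i)" using cp.spine_sep[of i "j - 1" j] h reach_sym by fastforce
    show "\<not> sim (g j) (u j) (u l)" using cp.spine_sep[of j j l] h by simp
  qed (use h cp.u_V cp.g_E cp.u_g(1)[of j] cp.u_g(2)[of "j - 1"] cp.g_eq[of "j - 1" j] in auto)
  define T where "T = {i. 0 < i \<and> i < L \<and> deg E (u i) = 2}"
  show ?thesis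
  proof (cases "T = {}")
    case True
    then have all: "deg E (u i) = \<Delta>" if "0 < i" "i < L" for i
      using deg[OF that] that by (auto simp: T_def)
    have "I = {0<..<L}"
      unfolding I_def set_eq_iff mem_Collect_eq greaterThanLessThan_iff using all by blast
    then have nL: "n = L - 1" using cI by simp
    have "i \<in> C_attach L (n div 2) ((n + 1) div 2)" if "0 < i" "i < L" for i
    proof (cases "i \<le> n div 2")
      case False
      then have "L - (n + 1) div 2 \<le> i" using nL that by linarith
      moreover have "i \<le> L - 1" using that by linarith
      ultimately show ?thesis using that by (simp add: C_attach_def)
    qed (use that in \<open>simp add: C_attach_def\<close>)
    then have "\<forall>i. 0 < i \<longrightarrow> i < L \<longrightarrow>
        deg E (u i) = (if i \<in> C_attach L (n div 2) ((n + 1) div 2) then \<Delta> else 2)"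
      using all by simp
    then show ?thesis using cat by blast
  next
    case False
    have finT: "finite T" by (simp add: T_def)
    define p c where "p = Min T" and "c = Max T"
    have pT: "p \<in> T" "c \<in> T" using False finT by (auto simp: p_def c_def)
    have pc: "0 < p" "p \<le> c" "c < L" using pT finT by (auto simp: T_def p_def)
    have bounds: "p \<le> i" "i \<le> c" if "i \<in> T" for i using that finT by (auto simp: p_def c_def)
    have D: "deg E (u i) = (if p \<le> i \<and> i \<le> c then 2 else \<Delta>)" if i: "0 < i" "i < L" for i
    proof (cases "p \<le> i \<and> i \<le> c")
      case True
      have "deg E (u i) \<noteq> \<Delta> \<or> i = p \<or> i = c"
        using between[of p i c] True pT by (auto simp: T_def le_less)
      then show ?thesis using True deg[OF i] pT by (auto simp: T_def)
    next
      case n: False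
      then have "i \<notin> T" using bounds by blast
      then show ?thesis using n deg[OF i] i by (auto simp: T_def)
    qed
    have up: "p + c \<le> L + 1" by (rule balanced[OF cat pc D])
    have "(L - c) + (L - p) \<le> L + 1"
    proof (rule balanced[OF cp.caterpillar_rev])
      fix i assume "0 < i" "i < L"
      then show "deg E (u (L - i)) = (if L - c \<le> i \<and> i \<le> L - p then 2 else \<Delta>)"
        using D[of "L - i"] pc by auto
    qed (use pc in auto)
    then have low: "L \<le> p + c + 1" using pc by linarith
    have "I = {0<..<p} \<union> {c<..<L}"
    proof (rule set_eqI)
      fix i
      show "i \<in> I \<longleftrightarrow> i \<in> {0<..<p} \<union> {c<..<L}"
        using D[of i] D3 pc by (cases "0 < i \<and> i < L") (auto simp: I_def)
    qed
    moreover have "card ({0<..<p} \<union> {c<..<L}) = (p - 1) + (L - 1 - c)"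
      using pc by (subst card_Un_disjoint) auto
    ultimately have n: "n = (p - 1) + (L - 1 - c)" using cI by simp
    show ?thesis
    proof (cases "p + c \<le> L")
      case True
      then have "n div 2 = p - 1" "(n + 1) div 2 = L - 1 - c" using n low pc by auto
      then have "i \<in> C_attach L (n div 2) ((n + 1) div 2) \<longleftrightarrow> \<not> (p \<le> i \<and> i \<le> c)"
        if "0 < i" "i < L" for i
        using that pc by (auto simp: C_attach_def)
      then show ?thesis using cat D by (intro exI[of _ L] exI[of _ u] exI[of _ g]) auto
    next
      \<comment> \<open>The left end has the extra star; the reversed spine puts the smaller number
        first, as \<open>C_attach\<close> demands.\<close>
      case False
      then have "n div 2 = L - 1 - c" "(n + 1) div 2 = p - 1" using n up pc by auto
      then have "i \<in> C_attach L (n div 2) ((n + 1) div 2) \<longleftrightarrow> \<not> (p \<le> L - i \<and> L - i \<le> c)"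
        if "0 < i" "i < L" for i
        using that pc by (auto simp: C_attach_def)
      then show ?thesis using cp.caterpillar_rev D
        by (intro exI[of _ L] exI[of _ "\<lambda>i. u (L - i)"] exI[of _ "\<lambda>i. g (L - Suc i)"]) auto
    qed
  qed
qed

end

section \<open>The isomorphism\<close>

definition path_edge :: "nat \<Rightarrow> nat \<Rightarrow> (nat \<times> nat \<times> nat) set" where
  "path_edge k i = {(0, i - 1, 0), (0, i, 0)} \<union> {(1, i, j) | j. 1 \<le> j \<and> j \<le> k - 2}"

definition star_edge :: "nat \<Rightarrow> nat \<Rightarrow> nat \<Rightarrow> (nat \<times> nat \<times> nat) set" where
  "star_edge k i t = insert (0, i, 0) {(t + 1, i, j) | j. 1 \<le> j \<and> j \<le> k - 1}"

lemma C_E_alt: "C_E k m \<Delta> a b = {path_edge k i | i. 1 \<le> i \<and> i \<le> m}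
    \<union> {star_edge k i t | i t. i \<in> C_attach m a b \<and> 1 \<le> t \<and> t \<le> \<Delta> - 2}"
  unfolding C_E_def path_edge_def star_edge_def ..

context caterpillar
begin

text \<open>Spine edges and pendant edges exhaust \<open>E\<close>; with n stars the count
  identifies the spine length with m - n (\<Delta> - 2).\<close>

lemma card_edges:
  assumes "\<And>i. 0 < i \<Longrightarrow> i < L \<Longrightarrow> deg E (u i) = (if i \<in> I then \<Delta> else 2)" "I \<subseteq> {0<..<L}"
  shows "card E = L + card I * (\<Delta> - 2)"
proof -
  have "card (\<Union>i\<in>I. pend i) = (\<Sum>i\<in>I. card (pend i))"
  proof (rule card_UN_disjoint)
    show "finite I" using assms(2) finite_subset by blast
    show "\<forall>i\<in>I. finite (pend i)" using finE by (simp add: pend_def)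
    show "\<forall>i\<in>I. \<forall>j\<in>I. i \<noteq> j \<longrightarrow> pend i \<inter> pend j = {}"
    proof (intro ballI impI, rule ccontr)
      fix i j assume ij: "i \<in> I" "j \<in> I" "i \<noteq> j" "pend i \<inter> pend j \<noteq> {}"
      then obtain e where "e \<in> pend i" "u j \<in> e" by (auto simp: pend_def)
      then show False using pend_spine_mem[of i e j] ij assms(2) by fastforce
    qed
  qed
  also have "\<dots> = card I * (\<Delta> - 2)"
    using card_pend assms by (simp add: subset_iff)
  finally have c: "card (\<Union>i\<in>I. pend i) = card I * (\<Delta> - 2)" .
  have "E = g ` {..<L} \<union> (\<Union>i\<in>I. pend i)"
  proof (intro equalityI subsetI)
    fix e assume e: "e \<in> E"
    show "e \<in> g ` {..<L} \<union> (\<Union>i\<in>I. pend i)"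
    proof (cases "e \<in> g ` {..<L}")
      case False
      then obtain i where i: "0 < i" "i < L" "e \<in> pend i" using edge_spine_or_pend[OF e] by blast
      then have "0 < card (pend i)" using finE by (auto simp: card_gt_0_iff pend_def)
      then have "i \<in> I" using card_pend[OF i(1,2)] assms(1)[OF i(1,2)] by (auto split: if_splits)
      then show ?thesis using i by blast
    qed simp
  qed (use g_E in \<open>auto simp: pend_def\<close>)
  moreover have "g ` {..<L} \<inter> (\<Union>i\<in>I. pend i) = {}"
  proof (rule ccontr)
    assume "\<not> ?thesis"
    then obtain i l where "i \<in> I" "l < L" "g l \<in> pend i" by auto
    then show False using pend_not_spine[of i "g l" l] assms(2) by auto
  qed
  moreover have "card (g ` {..<L}) = L" using g_inj by (simp add: card_image)
  moreover have "finite (\<Union>i\<in>I. pend i)" using finE by (rule finite_subset[rotated]) (auto simp: pend_def)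
  ultimately show ?thesis using c by (metis card_Un_disjoint finite_imageI finite_lessThan)
qed

lemma leaf_unique: "\<not> 2 \<le> deg E v \<Longrightarrow> e \<in> E \<Longrightarrow> f \<in> E \<Longrightarrow> v \<in> e \<Longrightarrow> v \<in> f \<Longrightarrow> e = f"
  using deg_ge2_iff by blast

text \<open>The inverse map \<open>G\<close> is assembled from enumerations: \<open>al\<close> of
  the further vertices of spine edges, \<open>ta\<close> of the pendant edges, \<open>ga\<close> of
  their leaves. It is injective since a leaf lies in one edge only, which determines its indices.
  Path edge i of the model goes to \<open>g (i - 1)\<close>.\<close>

lemma iso_C:
  assumes deg: "\<And>i. 0 < i \<Longrightarrow> i < L \<Longrightarrow> deg E (u i) = (if i \<in> C_attach L a b then \<Delta> else 2)"
    and ab: "a + b < L" "3 \<le> \<Delta>"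
  shows "hg_iso V E (C_V k L \<Delta> a b) (C_E k L \<Delta> a b)"
proof -
  let ?I = "C_attach L a b"
  have I: "0 < i" "i < L" if "i \<in> ?I" for i using that ab by (auto simp: C_attach_def)
  have "\<exists>h. bij_betw h {1..k - 2} (g i - {u i, u (Suc i)})" if "i < L" for i
  proof -
    have "card (g i - {u i, u (Suc i)}) = k - 2"
      using u_g[OF that] u_step[OF that] edge_card[OF g_E[OF that]] by (simp add: card_Diff_subset)
    then show ?thesis using fin_edge[OF g_E[OF that]] by (intro finite_same_card_bij) auto
  qed
  then obtain al where al: "\<And>i. i < L \<Longrightarrow> bij_betw (al i) {1..k - 2} (g i - {u i, u (Suc i)})" by metis
  have "\<exists>h. bij_betw h {1..\<Delta> - 2} (pend i)" if "i \<in> ?I" for i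
    using card_pend[OF I[OF that]] deg[OF I[OF that]] that finE
    by (intro finite_same_card_bij) (auto simp: pend_def)
  then obtain ta where ta: "\<And>i. i \<in> ?I \<Longrightarrow> bij_betw (ta i) {1..\<Delta> - 2} (pend i)" by metis
  have taP: "ta i t \<in> pend i" if "i \<in> ?I" "t \<in> {1..\<Delta> - 2}" for i t
    using bij_betwE[OF ta[OF that(1)]] that(2) by blast
  have pE: "e \<in> E" "u i \<in> e" if "e \<in> pend i" for e i using that by (auto simp: pend_def)
  have "\<exists>h. bij_betw h {1..k - 1} (ta i t - {u i})" if "i \<in> ?I" "t \<in> {1..\<Delta> - 2}" for i t
  proof -
    have "card (ta i t - {u i}) = k - 1"
      using pE[OF taP[OF that]] edge_card by simp
    then show ?thesis using fin_edge[OF pE(1)[OF taP[OF that]]] by (intro finite_same_card_bij) auto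
  qed
  then obtain ga where ga: "\<And>i t. i \<in> ?I \<Longrightarrow> t \<in> {1..\<Delta> - 2} \<Longrightarrow> bij_betw (ga i t) {1..k - 1} (ta i t - {u i})"
    by metis
  define G where "G = (\<lambda>(s, i, j). if s = 0 then u i else if s = 1 then al (i - 1) j else ga i (s - 1) j)"
  have G0: "G (0, i, j) = u i" and G1: "G (1, i, j) = al (i - 1) j" for i j by (simp_all add: G_def)
  have G2: "G (t + 1, i, j) = ga i t j" if "1 \<le> t" for t i j using that by (simp add: G_def)
  have path: "G ` path_edge k i = g (i - 1)" if i: "1 \<le> i" "i \<le> L" for i
  proof -
    have l: "i - 1 < L" "Suc (i - 1) = i" using i by auto
    have "{(1::nat, i, j) | j. 1 \<le> j \<and> j \<le> k - 2} = (\<lambda>j. (1, i, j)) ` {1..k - 2}" by auto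
    then have "G ` {(1, i, j) | j. 1 \<le> j \<and> j \<le> k - 2} = al (i - 1) ` {1..k - 2}"
      by (simp only: image_image G1)
    also have "\<dots> = g (i - 1) - {u (i - 1), u i}" using al[OF l(1)] l(2) by (simp add: bij_betw_def)
    finally show ?thesis
      unfolding path_edge_def using u_g[OF l(1)] l(2) by (auto simp: image_Un G0)
  qed
  have star: "G ` star_edge k i t = ta i t" if it: "i \<in> ?I" "t \<in> {1..\<Delta> - 2}" for i t
  proof -
    have "G ` {(t + 1, i, j) | j. 1 \<le> j \<and> j \<le> k - 1} = ga i t ` {1..k - 1}"
      using G2[of t i] it(2) by (force simp: image_iff)
    also have "\<dots> = ta i t - {u i}" using ga[OF it] by (simp add: bij_betw_def)
    finally show ?thesis
      unfolding star_edge_def using pE(2)[OF taP[OF it]] by (auto simp: image_insert G0)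
  qed
  have imE: "(`) G ` C_E k L \<Delta> a b = E"
  proof (intro equalityI subsetI)
    fix e assume "e \<in> (`) G ` C_E k L \<Delta> a b"
    then consider i where "1 \<le> i" "i \<le> L" "e = G ` path_edge k i"
      | i t where "i \<in> ?I" "t \<in> {1..\<Delta> - 2}" "e = G ` star_edge k i t"
      unfolding C_E_alt by auto
    then show "e \<in> E"
    proof cases
      case 1
      then show ?thesis using path[OF 1(1,2)] g_E[of "i - 1"] by simp
    next
      case 2
      then show ?thesis using star[OF 2(1,2)] pE(1)[OF taP] by simp
    qed
  next
    fix e assume e: "e \<in> E"
    show "e \<in> (`) G ` C_E k L \<Delta> a b"
    proof (cases "e \<in> g ` {..<L}")
      case True
      then obtain i where i: "i < L" "e = g i" by blast
      have "e = G ` path_edge k (Suc i)" using path[of "Suc i"] i by simp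
      moreover have "path_edge k (Suc i) \<in> C_E k L \<Delta> a b" unfolding C_E_alt using i by fastforce
      ultimately show ?thesis by blast
    next
      case False
      then obtain i where i: "0 < i" "i < L" "e \<in> pend i" using edge_spine_or_pend[OF e] by blast
      then have "0 < card (pend i)" using finE by (auto simp: card_gt_0_iff pend_def)
      then have iI: "i \<in> ?I" using card_pend[OF i(1,2)] deg[OF i(1,2)] by (auto split: if_splits)
      then have "e \<in> ta i ` {1..\<Delta> - 2}" using ta[OF iI] i(3) by (simp add: bij_betw_def)
      then obtain t where t: "t \<in> {1..\<Delta> - 2}" "e = ta i t" by blast
      have "e = G ` star_edge k i t" using star[OF iI t(1)] t(2) by simp
      moreover have "star_edge k i t \<in> C_E k L \<Delta> a b" unfolding C_E_alt using iI t(1) by auto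
      ultimately show ?thesis by blast
    qed
  qed
  have spine_sub: "(0, i, 0) \<in> C_V k L \<Delta> a b" if "i \<le> L" for i using that by (auto simp: C_V_def)
  have imV: "G ` C_V k L \<Delta> a b = V"
  proof (intro equalityI subsetI)
    fix v assume "v \<in> G ` C_V k L \<Delta> a b"
    then consider i where "i \<le> L" "v = G (0, i, 0)" | c where "c \<in> C_E k L \<Delta> a b" "v \<in> G ` c"
      unfolding C_V_def by blast
    then show "v \<in> V"
    proof cases
      case 1
      then show ?thesis using u_V by (simp add: G0)
    next
      case 2
      then have "G ` c \<in> E" using imE by blast
      then show ?thesis using 2 edge_sub by blast
    qed
  next
    fix v assume v: "v \<in> V"
    have "E \<noteq> {}" using g_E[of 0] L2 by auto
    then have "0 < deg E v" using deg_pos[OF _ v] by simp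
    then obtain e where "e \<in> E" "v \<in> e" unfolding deg_def by (metis (no_types, lifting) card_gt_0_iff ex_in_conv mem_Collect_eq)
    then obtain c where "c \<in> C_E k L \<Delta> a b" "v \<in> G ` c" using imE by blast
    then show "v \<in> G ` C_V k L \<Delta> a b" unfolding C_V_def by blast
  qed
  have forms: "(\<exists>i\<le>L. w = (0, i, 0)) \<or> (\<exists>i j. 1 \<le> i \<and> i \<le> L \<and> j \<in> {1..k - 2} \<and> w = (1, i, j))
      \<or> (\<exists>i t j. i \<in> ?I \<and> t \<in> {1..\<Delta> - 2} \<and> j \<in> {1..k - 1} \<and> w = (t + 1, i, j))"
    if "w \<in> C_V k L \<Delta> a b" for w
    using that I unfolding C_V_def C_E_alt path_edge_def star_edge_def
    by (auto simp: less_imp_le)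
  have leaf1: "al (i - 1) j \<in> g (i - 1)" "\<not> 2 \<le> deg E (al (i - 1) j)" "\<forall>l\<le>L. al (i - 1) j \<noteq> u l"
    if "1 \<le> i" "i \<le> L" "j \<in> {1..k - 2}" for i j
  proof -
    have l: "i - 1 < L" using that by auto
    have m: "al (i - 1) j \<in> g (i - 1) - {u (i - 1), u (Suc (i - 1))}"
      using bij_betwE[OF al[OF l]] that(3) by blast
    show "al (i - 1) j \<in> g (i - 1)" using m by blast
    show "\<not> 2 \<le> deg E (al (i - 1) j)" by (rule edge_leaf[OF l]) (use m in auto)
    show "\<forall>l\<le>L. al (i - 1) j \<noteq> u l"
    proof (intro allI impI notI)
      fix l' assume l': "l' \<le> L" "al (i - 1) j = u l'"
      then have "l' = i - 1 \<or> l' = Suc (i - 1)" using spine_mem[OF l l'(1)] m by simp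
      then show False using m l'(2) by auto
    qed
  qed
  have leaf2: "ga i t j \<in> ta i t" "\<not> 2 \<le> deg E (ga i t j)" "\<forall>l\<le>L. ga i t j \<noteq> u l"
    if "i \<in> ?I" "t \<in> {1..\<Delta> - 2}" "j \<in> {1..k - 1}" for i t j
  proof -
    have m: "ga i t j \<in> ta i t - {u i}" using bij_betwE[OF ga[OF that(1,2)]] that(3) by blast
    show "ga i t j \<in> ta i t" using m by blast
    show "\<not> 2 \<le> deg E (ga i t j)"
      by (rule pend_leaf[OF I[OF that(1)] taP[OF that(1,2)]]) (use m in auto)
    show "\<forall>l\<le>L. ga i t j \<noteq> u l"
    proof (intro allI impI notI)
      fix l assume l: "l \<le> L" "ga i t j = u l"
      then have "l = i" using pend_spine_mem[OF I[OF that(1)] taP[OF that(1,2)] l(1)] m by simp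
      then show False using m l(2) by auto
    qed
  qed
  have inj: "inj_on G (C_V k L \<Delta> a b)"
  proof (rule inj_onI)
    fix w w' assume w: "w \<in> C_V k L \<Delta> a b" "w' \<in> C_V k L \<Delta> a b" and eq: "G w = G w'"
    have one: "w = w'"
      if "1 \<le> i" "i \<le> L" "j \<in> {1..k - 2}" "w = (1, i, j)" "1 \<le> i'" "i' \<le> L" "j' \<in> {1..k - 2}" "w' = (1, i', j')"
      for i j i' j'
    proof -
      have e: "al (i - 1) j = al (i' - 1) j'" using eq that by (simp only: G1)
      then have "g (i - 1) = g (i' - 1)"
        using leaf_unique[OF leaf1(2)[OF that(1-3)] g_E g_E leaf1(1)[OF that(1-3)]] leaf1(1)[OF that(5-7)] that by auto
      moreover have "i - 1 < L" "i' - 1 < L" using that(1,2,5,6) by linarith+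
      ultimately have "i - 1 = i' - 1" using g_eq by metis
      then have "i = i'" using that(1,5) by linarith
      then show ?thesis using e al[of "i - 1"] that by (auto simp: bij_betw_def inj_on_def)
    qed
    have two: "w = w'"
      if "i \<in> ?I" "t \<in> {1..\<Delta> - 2}" "j \<in> {1..k - 1}" "w = (t + 1, i, j)"
        "i' \<in> ?I" "t' \<in> {1..\<Delta> - 2}" "j' \<in> {1..k - 1}" "w' = (t' + 1, i', j')"
      for i t j i' t' j'
    proof -
      have e: "ga i t j = ga i' t' j'" using eq that G2 by simp
      then have te: "ta i t = ta i' t'"
        using leaf_unique[OF leaf2(2)[OF that(1-3)] pE(1)[OF taP[OF that(1,2)]] pE(1)[OF taP[OF that(5,6)]]
          leaf2(1)[OF that(1-3)]] leaf2(1)[OF that(5-7)] by simp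
      have "i' = i"
        using pend_spine_mem[OF I[OF that(1)] taP[OF that(1,2)], of i'] I[OF that(5)]
          pE(2)[OF taP[OF that(5,6)]] te by simp
      moreover have "t = t'" using te calculation ta[OF that(1)] that(2,6) by (auto simp: bij_betw_def inj_on_def)
      ultimately show ?thesis using e ga[OF that(1,2)] that by (auto simp: bij_betw_def inj_on_def)
    qed
    have mixed: False if "1 \<le> i" "i \<le> L" "j \<in> {1..k - 2}" "i' \<in> ?I" "t' \<in> {1..\<Delta> - 2}" "j' \<in> {1..k - 1}"
        "al (i - 1) j = ga i' t' j'" for i j i' t' j'
    proof -
      have l: "i - 1 < L" using that by auto
      have "ta i' t' = g (i - 1)"
        using leaf_unique[OF leaf1(2)[OF that(1-3)] pE(1)[OF taP[OF that(4,5)]] g_E[OF l] _ leaf1(1)[OF that(1-3)]]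
          leaf2(1)[OF that(4-6)] that(7) by simp
      then show False using pend_not_spine[OF I[OF that(4)] taP[OF that(4,5)] l] by simp
    qed
    consider (u) i where "i \<le> L" "w = (0, i, 0)"
      | (p) i j where "1 \<le> i" "i \<le> L" "j \<in> {1..k - 2}" "w = (1, i, j)"
      | (s) i t j where "i \<in> ?I" "t \<in> {1..\<Delta> - 2}" "j \<in> {1..k - 1}" "w = (t + 1, i, j)"
      using forms[OF w(1)] by blast
    note cw = this
    consider (u) i where "i \<le> L" "w' = (0, i, 0)"
      | (p) i j where "1 \<le> i" "i \<le> L" "j \<in> {1..k - 2}" "w' = (1, i, j)"
      | (s) i t j where "i \<in> ?I" "t \<in> {1..\<Delta> - 2}" "j \<in> {1..k - 1}" "w' = (t + 1, i, j)"
      using forms[OF w(2)] by blast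
    note cw' = this
    show "w = w'"
    proof (cases rule: cw)
      case u: (u i)
      have Gw: "G w = u i" using u by (simp add: G0)
      show ?thesis
      proof (cases rule: cw')
        case (u i')
        then show ?thesis using Gw eq \<open>w = (0, i, 0)\<close> \<open>i \<le> L\<close> u_inj[of i i'] by (simp add: G0)
      next
        case (p i' j)
        then show ?thesis using Gw eq u(1) leaf1(3)[OF p(1-3)] by (metis G1)
      next
        case (s i' t j)
        then have "G w' = ga i' t j" using G2 by simp
        then show ?thesis using Gw eq u(1) leaf2(3)[OF s(1-3)] by metis
      qed
    next
      case p: (p i j)
      have Gw: "G w = al (i - 1) j" using p by (simp only: G1)
      show ?thesis
      proof (cases rule: cw')
        case (u i')
        then show ?thesis using Gw eq leaf1(3)[OF p(1-3)] by (metis G0)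
      next
        case p': (p i' j')
        show ?thesis by (rule one[OF p p'])
      next
        case (s i' t j')
        then have "G w' = ga i' t j'" using G2 by simp
        then show ?thesis using Gw eq mixed[OF p(1-3) s(1-3)] by simp
      qed
    next
      case s: (s i t j)
      have Gw: "G w = ga i t j" using s G2 by simp
      show ?thesis
      proof (cases rule: cw')
        case (u i')
        then show ?thesis using Gw eq leaf2(3)[OF s(1-3)] by (metis G0)
      next
        case p': (p i' j')
        then have "G w' = al (i' - 1) j'" by (simp only: G1)
        then show ?thesis using Gw eq mixed[OF p'(1-3) s(1-3)] by simp
      next
        case s': (s i' t' j')
        show ?thesis by (rule two[OF s s'])
      qed
    qed
  qed
  define f where "f = inv_into (C_V k L \<Delta> a b) G"
  have "bij_betw f V (C_V k L \<Delta> a b)"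
    unfolding f_def by (rule bij_betw_inv_into) (simp add: bij_betw_def inj imV)
  moreover have "f ` G ` c = c" if "c \<in> C_E k L \<Delta> a b" for c
    unfolding f_def using that by (intro inv_into_image_cancel[OF inj]) (auto simp: C_V_def)
  then have "(\<lambda>e. f ` e) ` E = C_E k L \<Delta> a b"
    unfolding imE[symmetric] image_image by simp
  ultimately show ?thesis unfolding hg_iso_def by blast
qed

end

theorem theorem2:
  fixes k m \<Delta> n :: nat and V :: "'a set" and E :: "'a set set"
  assumes "k \<ge> 2" and "m \<ge> 1" and "\<Delta> \<ge> 3" and "n \<ge> 2"
    and "in_TT k m \<Delta> n V E"
    and "\<forall>(V' :: nat set) E'. in_TT k m \<Delta> n V' E' \<longrightarrow>
           dist_spectral_radius V' E' \<le> dist_spectral_radius V E"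
  shows "hg_iso V E
           (C_V k (m - n * (\<Delta> - 2)) \<Delta> (n div 2) ((n + 1) div 2))
           (C_E k (m - n * (\<Delta> - 2)) \<Delta> (n div 2) ((n + 1) div 2))"
proof -
  have T: "htree V E k" "card E = m" "Max (deg E ` V) = \<Delta>" "card {v\<in>V. deg E v = \<Delta>} = n"
    using assms(5) in_TT_iff[OF assms(1)] by blast+
  interpret htree V E k by (rule T(1))
  have "E \<noteq> {}" using T(2) assms(2) by auto
  then obtain x where x: "is_perron V (rd E) (dist_spectral_radius V E) x" using perron by metis
  obtain f :: "'a \<Rightarrow> nat" where f: "inj_on f V" using finite_imp_inj_to_nat_seg[OF finV] by blast
  interpret best V E k \<Delta> n x
  proof
    show "deg E v \<le> \<Delta>" if "v \<in> V" for v using that T(3) finV by auto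
    show "dist_spectral_radius V E2 \<le> dist_spectral_radius V E"
      if E2: "htree V E2 k" "card E2 = card E" "\<And>v. v \<in> V \<Longrightarrow> deg E2 v \<le> \<Delta>" "card {v\<in>V. deg E2 v = \<Delta>} = n"
      for E2
    proof -
      have "{v\<in>V. deg E2 v = \<Delta>} \<noteq> {}" using E2(4) assms(4) by (metis card.empty not_numeral_le_zero)
      then have "\<Delta> \<in> deg E2 ` V" by auto
      then have "Max (deg E2 ` V) = \<Delta>" using E2(3) finV by (intro Max_eqI) auto
      then have "in_TT k m \<Delta> n V E2" using E2 T(2) in_TT_iff[OF assms(1)] by blast
      then have "in_TT k m \<Delta> n (f ` V) ((`) f ` E2)" by (rule in_TT_image[OF assms(1) _ f])
      then have "dist_spectral_radius (f ` V) ((`) f ` E2) \<le> dist_spectral_radius V E" using assms(6) by blast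
      then show ?thesis using htree.dist_spectral_radius_image[OF E2(1) f] by simp
    qed
  qed (use assms T x in auto)
  obtain L u g where cat: "caterpillar V E k L u g"
    and deg: "\<And>i. 0 < i \<Longrightarrow> i < L \<Longrightarrow> deg E (u i) = (if i \<in> C_attach L (n div 2) ((n + 1) div 2) then \<Delta> else 2)"
    using extremal_caterpillar by blast
  interpret caterpillar V E k L u g by (rule cat)
  \<comment> \<open>Until n < L is known, the attachment ranges might leave the interior of the
    spine, and truncated subtraction might even add 0.\<close>
  let ?I = "C_attach L (n div 2) ((n + 1) div 2) \<inter> {0<..<L}"
  have "{v\<in>V. deg E v = \<Delta>} = u ` ?I"
  proof (intro equalityI subsetI)
    fix v assume v: "v \<in> {v\<in>V. deg E v = \<Delta>}"
    then obtain i where "0 < i" "i < L" "v = u i" using nonleaf[of v] assms(3) by auto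
    then show "v \<in> u ` ?I" using v deg[of i] assms(3) by (auto split: if_splits)
  qed (use deg u_V in auto)
  moreover have "inj_on u ?I" using u_inj by (auto simp: inj_on_def)
  ultimately have cI: "card ?I = n" using T(4) by (simp add: card_image)
  have "card ?I \<le> card {0<..<L}" by (rule card_mono) auto
  then have nL: "n < L" using cI L2 by simp
  have "card E = L + card ?I * (\<Delta> - 2)" by (rule card_edges) (use deg in auto)
  then have "m - n * (\<Delta> - 2) = L" using cI T(2) by simp
  moreover have "n div 2 + (n + 1) div 2 < L" using nL by linarith
  ultimately show ?thesis using iso_C[OF deg] assms(3) by simp
qed

end
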